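(* Let $r\in\mathbb N$ and let $x\in L^r_{\infty,\infty}(\mathbb R)$ be a $1$-periodic function. Suppose that one of the following conditions holds: a) the numbers $a_1=0$, $a_2\ge 0$, $\lambda>0$ and $b\ne 0$ are such that $\|x^{(k)}\|\le\|\Psi^{(k)}_{a_1,a_2,b,\lambda}\|$ for $k\in\{0,r-1,r\}$; b) the numbers $a_1\ge 0$, $a_2=0$, $\lambda>0$ and $b\neq 0$ are such that $\|x^{(k)}\|\le\|\Psi^{(k)}_{a_1,a_2,b,\lambda}\|$ for $k\in\{0,r-2,r\}$; c) the numbers $a_1\ge 0$, $a_2\ge 0$, $\lambda>0$ and $b\ne 0$ are such that $\|x^{(k)}\|\le\|\Psi^{(k)}_{a_1,a_2,b,\lambda}\|$ for $k\in\{0,r-2,r-1,r\}$. Then for all $1\le p<\infty$ and all natural $k\ge 1$ with $k<r-2$ (and, if condition a) holds, for all natural $k\ge 1$ with $k<r-1$) $$\|x^{(k)}\|_{L_p(0,1)}\le\lambda^{r-k}\,\|\Psi^{(k)}_{a_1,a_2,b,1}\|_{L_p(0,1)}.$$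
   Context: $\|\cdot\|$ is the norm of $L_\infty(\mathbb R)$, and $\|f\|_{L_p(\alpha,\beta)}=\left(\int_\alpha^\beta|f(t)|^p\,dt\right)^{1/p}$. $L^r_\infty(\mathbb R)$ is the space of functions $x:\mathbb R\to\mathbb R$ such that $x^{(r-1)}$ (with $x^{(0)}=x$) is locally absolutely continuous and $x^{(r)}\in L_\infty(\mathbb R)$; $L^r_{\infty,\infty}(\mathbb R)=L^r_\infty(\mathbb R)\cap L_\infty(\mathbb R)$. For $a_1,a_2\ge 0$ put $T=a_1+a_2+2$ and define $\psi_1(a_1,a_2;t)$ on $[0,T]$ to be $0$ for $t\in[0,a_1]$, $t-a_1$ for $t\in[a_1,a_1+1]$, $1$ for $t\in[a_1+1,a_1+a_2+1]$, and $2+a_1+a_2-t$ for $t\in[a_1+a_2+1,T]$. Extend it to $[T,2T]$ by $\psi_1(a_1,a_2;t)=-\psi_1(a_1,a_2;t-T)$ and then $2T$-periodically to $\mathbb R$. For $r\ge 2$, $\psi_r(a_1,a_2;\cdot)$ is the $2T$-periodic function with zero mean over the period such that $\psi_r'(a_1,a_2;t)=\psi_{r-1}(a_1,a_2;t)$. For $r\in\mathbb N$, $a_1,a_2\ge0$, $\lambda>0$, $b\in\mathbb R$, $$\Psi_{a_1,a_2,b,\lambda}(t)=\Psi_{r;a_1,a_2,b,\lambda}(t)=b\left(\frac{\lambda}{2a_1+2a_2+4}\right)^{r}\psi_r\!\left(a_1,a_2;\frac{2a_1+2a_2+4}{\lambda}\,t\right),$$ a $\lambda$-periodic function; $\Psi_{a_1,a_2,b,1}$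 is the same with $\lambda=1$ (same $r$). *)

theory Defs
  imports "HOL-Probability.Essential_Supremum"
begin

section \<open>Norms and function spaces\<close>

text \<open>The essential supremum of a function that is not Lebesgue measurable is \<open>top\<close>.\<close>

definition Linf_norm :: "(real \<Rightarrow> real) \<Rightarrow> ennreal" where
  "Linf_norm f = esssup lebesgue (\<lambda>t. ennreal \<bar>f t\<bar>)"

definition Linf :: "(real \<Rightarrow> real) set" where
  "Linf = {f. f \<in> borel_measurable lebesgue \<and> Linf_norm f < top}"

definition Lp_norm :: "real \<Rightarrow> real \<Rightarrow> real \<Rightarrow> (real \<Rightarrow> real) \<Rightarrow> real" where
  "Lp_norm p \<alpha> \<beta> f = (LINT t:{\<alpha><..<\<beta>}|lebesgue. \<bar>f t\<bar> powr p) powr (1 / p)"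

definition abs_cont_on :: "real \<Rightarrow> real \<Rightarrow> (real \<Rightarrow> real) \<Rightarrow> bool" where
  "abs_cont_on \<alpha> \<beta> f \<longleftrightarrow>
     (\<forall>\<epsilon>>0. \<exists>\<delta>>0. \<forall>I :: (real \<times> real) set.
        finite I \<longrightarrow> (\<forall>(u, v)\<in>I. \<alpha> \<le> u \<and> u \<le> v \<and> v \<le> \<beta>) \<longrightarrow>
        disjoint_family_on (\<lambda>(u, v). {u<..<v}) I \<longrightarrow>
        (\<Sum>(u, v)\<in>I. v - u) < \<delta> \<longrightarrow> (\<Sum>(u, v)\<in>I. \<bar>f v - f u\<bar>) < \<epsilon>)"

definition locally_abs_cont :: "(real \<Rightarrow> real) \<Rightarrow> bool" where
  "locally_abs_cont f \<longleftrightarrow> (\<forall>\<alpha> \<beta>. \<alpha> \<le> \<beta> \<longrightarrow> abs_cont_on \<alpha> \<beta> f)"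

text \<open>
  Derivatives are iterates of \<^const>\<open>deriv\<close>, so their existence has to be required separately:
  everywhere for the orders up to \<open>r - 1\<close>, almost everywhere for the order \<open>r\<close>. The latter requirement
  only spells out what the \<open>r\<close>-th derivative means: by Lebesgue's theorem it follows from the local
  absolute continuity of the derivative of order \<open>r - 1\<close>. On the null set where the derivative of order
  \<open>r - 1\<close> is not differentiable, \<^const>\<open>deriv\<close> has an unspecified value, which does not affect
  measurability or the essential supremum.
\<close>

definition Lr_inf :: "nat \<Rightarrow> (real \<Rightarrow> real) set" where
  "Lr_inf r = {x.
     (\<forall>k<r - 1. \<forall>t. (deriv ^^ k) x field_differentiable at t) \<and>
     locally_abs_cont ((deriv ^^ (r - 1)) x) \<and>
     (AE t in lebesgue. (deriv ^^ (r - 1)) x field_differentiable at t) \<and>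
     (deriv ^^ r) x \<in> Linf}"

definition Lr_inf_inf :: "nat \<Rightarrow> (real \<Rightarrow> real) set" where
  "Lr_inf_inf r = Lr_inf r \<inter> Linf"


section \<open>The comparison functions\<close>

definition half_period :: "real \<Rightarrow> real \<Rightarrow> real" where
  "half_period a1 a2 = a1 + a2 + 2"

definition psi1_half :: "real \<Rightarrow> real \<Rightarrow> real \<Rightarrow> real" where
  "psi1_half a1 a2 t =
     (if t \<le> a1 then 0
      else if t \<le> a1 + 1 then t - a1
      else if t \<le> a1 + a2 + 1 then 1
      else 2 + a1 + a2 - t)"

text \<open>Here \<open>s\<close> is the representative of \<open>t\<close> modulo \<open>2T\<close> in \<open>[0, 2T)\<close>.\<close>

definition psi1 :: "real \<Rightarrow> real \<Rightarrow> real \<Rightarrow> real" where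
  "psi1 a1 a2 t =
     (let T = half_period a1 a2; s = t - 2 * T * of_int \<lfloor>t / (2 * T)\<rfloor>
      in if s \<le> T then psi1_half a1 a2 s else - psi1_half a1 a2 (s - T))"

definition zero_mean_primitive :: "real \<Rightarrow> (real \<Rightarrow> real) \<Rightarrow> (real \<Rightarrow> real) \<Rightarrow> bool" where
  "zero_mean_primitive P g f \<longleftrightarrow>
     (\<forall>t. f (t + P) = f t) \<and> integral {0..P} f = 0 \<and> (\<forall>t. (f has_real_derivative g t) (at t))"

text \<open>
  The index \<open>0\<close> is a dummy. That the description determines a function for \<open>a1, a2 \<ge> 0\<close> is shown
  in \<open>psi_Suc_Suc\<close> below.
\<close>

fun psi :: "nat \<Rightarrow> real \<Rightarrow> real \<Rightarrow> real \<Rightarrow> real" where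
  "psi 0 a1 a2 = (\<lambda>t. 0)"
| "psi (Suc 0) a1 a2 = psi1 a1 a2"
| "psi (Suc (Suc n)) a1 a2 =
     (THE f. zero_mean_primitive (2 * half_period a1 a2) (psi (Suc n) a1 a2) f)"

definition Psi :: "nat \<Rightarrow> real \<Rightarrow> real \<Rightarrow> real \<Rightarrow> real \<Rightarrow> real \<Rightarrow> real" where
  "Psi r a1 a2 b lam t =
     b * (lam / (2 * a1 + 2 * a2 + 4)) ^ r * psi r a1 a2 ((2 * a1 + 2 * a2 + 4) / lam * t)"

definition deriv_norms_le :: "nat set \<Rightarrow> (real \<Rightarrow> real) \<Rightarrow> (real \<Rightarrow> real) \<Rightarrow> bool" where
  "deriv_norms_le K x y \<longleftrightarrow> (\<forall>k\<in>K. Linf_norm ((deriv ^^ k) x) \<le> Linf_norm ((deriv ^^ k) y))"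


section \<open>The comparison functions are well defined\<close>

lemma zero_mean_primitive_unique:
  assumes P: "P > 0" and f: "zero_mean_primitive P g f" and h: "zero_mean_primitive P g h"
  shows "f = h"
proof -
  have d: "((\<lambda>t. f t - h t) has_real_derivative 0) (at t)" for t
    using f h DERIV_diff[of f "g t" t UNIV h "g t"] by (auto simp: zero_mean_primitive_def)
  then have "f t - h t = f 0 - h 0" for t
    using DERIV_isconst_all[of "\<lambda>t. f t - h t"] by blast
  then have e: "f t = h t + (f 0 - h 0)" for t by (simp add: algebra_simps)
  have "continuous_on {0..P} h"
    using h by (meson DERIV_isCont continuous_at_imp_continuous_on zero_mean_primitive_def)
  then have "h integrable_on {0..P}" by (rule integrable_continuous_real)
  then have "integral {0..P} (\<lambda>t. h t + (f 0 - h 0)) = integral {0..P} h + P * (f 0 - h 0)"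
    using P by (subst Henstock_Kurzweil_Integration.integral_add) auto
  moreover have "(\<lambda>t. h t + (f 0 - h 0)) = f" by (rule ext) (rule e[symmetric])
  moreover have "integral {0..P} f = 0" "integral {0..P} h = 0"
    using f h by (auto simp: zero_mean_primitive_def)
  ultimately have "P * (f 0 - h 0) = 0" by (simp only: add_0)
  then have "f 0 - h 0 = 0" using P by (metis less_irrefl mult_eq_0_iff)
  then have "f t = h t" for t using e[of t] by linarith
  then show ?thesis by (rule ext)
qed

lemma zero_mean_primitive_exists:
  assumes P: "P > 0" and g: "continuous_on UNIV g" "\<And>t. g (t + P) = g t" "integral {0..P} g = 0"
  shows "\<exists>f. zero_mean_primitive P g f"
proof -
  obtain F where F: "\<And>t. (F has_real_derivative g t) (at t)"
  proof -
    have "\<exists>F. \<forall>t::real. (F has_vector_derivative g t) (at t)"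
    proof -
      define F where "F t = (if t \<ge> 0 then integral {0..t} g else - integral {t..0} g)" for t
      have "(F has_vector_derivative g t) (at t)" for t
      proof -
        define A where "A = - \<bar>t\<bar> - 1"
        define B where "B = \<bar>t\<bar> + 1"
        have AB: "A < t" "t < B" "A < 0" "B > 0" by (auto simp: A_def B_def)
        have int: "g integrable_on {u..v}" for u v
          by (intro integrable_continuous_real continuous_on_subset[OF g(1)]) auto
        have eq: "F s = integral {A..s} g - integral {A..0} g" if "s \<in> {A..B}" for s
        proof (cases "s \<ge> 0")
          case True
          then show ?thesis
            using Henstock_Kurzweil_Integration.integral_combine[of A 0 s g] AB int that
            by (simp add: F_def)
        next
          case False
          then show ?thesis
            using Henstock_Kurzweil_Integration.integral_combine[of A s 0 g] AB int that
            by (simp add: F_def)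
        qed
        have "((\<lambda>s. integral {A..s} g) has_vector_derivative g t) (at t within {A..B})"
          using AB by (intro integral_has_vector_derivative continuous_on_subset[OF g(1)]) auto
        then have "((\<lambda>s. integral {A..s} g - integral {A..0} g) has_vector_derivative g t - 0)
            (at t within {A..B})"
          by (intro has_vector_derivative_diff has_vector_derivative_const)
        then have "(F has_vector_derivative g t) (at t within {A..B})"
          using AB eq has_vector_derivative_transform
            [of t "{A..B}" F "\<lambda>s. integral {A..s} g - integral {A..0} g" "g t"] by auto
        moreover have "at t within {A..B} = at t"
          using AB by (intro at_within_interior) (auto simp: interior_atLeastAtMost_real)
        ultimately show ?thesis by simp
      qed
      then show ?thesis by blast
    qed
    then show ?thesis using that by (auto simp: has_real_derivative_iff_has_vector_derivative)
  qed
  define m where "m = integral {0..P} F / P"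
  have contF: "continuous_on {u..v} F" for u v
    using F by (meson DERIV_isCont continuous_at_imp_continuous_on)
  have per: "F (t + P) = F t" for t
  proof -
    have "((\<lambda>t. F (t + P) - F t) has_real_derivative 0) (at t)" for t
      using DERIV_diff[of "\<lambda>t. F (t + P)" "g (t + P)" t UNIV F "g t"] F[of "t + P"] F[of t]
      by (simp add: DERIV_shift g(2))
    then have "F (t + P) - F t = F (0 + P) - F 0"
      using DERIV_isconst_all[of "\<lambda>t. F (t + P) - F t"] by blast
    moreover have "(g has_integral F P - F 0) {0..P}"
      using P F by (intro fundamental_theorem_of_calculus)
        (auto simp: has_real_derivative_iff_has_vector_derivative has_vector_derivative_at_within)
    then have "F P - F 0 = 0" using g(3) by (simp add: integral_unique)
    ultimately show ?thesis by simp
  qed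
  have "integral {0..P} (\<lambda>t. F t - m) = integral {0..P} F - P * m"
    using P contF[of 0 P] by (subst Henstock_Kurzweil_Integration.integral_diff)
      (auto intro: integrable_continuous_real)
  then have "integral {0..P} (\<lambda>t. F t - m) = 0" using P by (simp add: m_def)
  moreover have "((\<lambda>t. F t - m) has_real_derivative g t) (at t)" for t
    using F[of t] by (auto intro!: derivative_eq_intros)
  ultimately have "zero_mean_primitive P g (\<lambda>t. F t - m)"
    by (simp add: zero_mean_primitive_def per)
  then show ?thesis by blast
qed

context
  fixes a1 a2 :: real
  assumes nonneg: "a1 \<ge> 0" "a2 \<ge> 0"
begin

lemma half_period_pos: "half_period a1 a2 > 0"
  using nonneg by (simp add: half_period_def)

lemma psi1_shift: "psi1 a1 a2 (t + 2 * half_period a1 a2) = psi1 a1 a2 t"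
proof -
  have "(t + 2 * half_period a1 a2) / (2 * half_period a1 a2) = t / (2 * half_period a1 a2) + 1"
    using half_period_pos by (simp add: field_simps)
  then show ?thesis by (simp add: psi1_def Let_def algebra_simps)
qed

definition psi1_period :: "real \<Rightarrow> real" where
  "psi1_period s = (if s \<le> half_period a1 a2 then psi1_half a1 a2 s
     else - psi1_half a1 a2 (s - half_period a1 a2))"

lemma psi1_half_eq: "0 \<le> t \<Longrightarrow> t \<le> half_period a1 a2 \<Longrightarrow>
    psi1_half a1 a2 t = max 0 (min 1 (min (t - a1) (2 + a1 + a2 - t)))"
  using nonneg by (auto simp: psi1_half_def half_period_def)

lemma continuous_psi1_period: "continuous_on {0..2 * half_period a1 a2} psi1_period"
proof -
  let ?T = "half_period a1 a2" and ?m = "\<lambda>t. max 0 (min 1 (min (t - a1) (2 + a1 + a2 - t)))"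
  have T: "?T > 0" by (rule half_period_pos)
  have "continuous_on ({0..?T} \<union> {?T..2 * ?T}) psi1_period"
  proof (rule continuous_on_closed_Un)
    have "continuous_on {0..?T} ?m" by (intro continuous_intros)
    then show "continuous_on {0..?T} psi1_period"
      by (rule continuous_on_eq) (simp add: psi1_period_def psi1_half_eq)
    have "continuous_on {?T..2 * ?T} (\<lambda>t. - ?m (t - ?T))" by (intro continuous_intros)
    then show "continuous_on {?T..2 * ?T} psi1_period"
    proof (rule continuous_on_eq)
      fix s assume s: "s \<in> {?T..2 * ?T}"
      show "- ?m (s - ?T) = psi1_period s"
      proof (cases "s = ?T")
        case True
        then show ?thesis using nonneg T psi1_half_eq[of ?T]
          by (simp add: psi1_period_def half_period_def)
      next
        case False
        then show ?thesis using s psi1_half_eq[of "s - ?T"] by (simp add: psi1_period_def)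
      qed
    qed
  qed auto
  moreover have "{0..?T} \<union> {?T..2 * ?T} = {0..2 * ?T}" using T by auto
  ultimately show ?thesis by simp
qed

lemma psi1_eq_period:
  assumes "2 * half_period a1 a2 * of_int k \<le> t" "t \<le> 2 * half_period a1 a2 * (of_int k + 1)"
  shows "psi1 a1 a2 t = psi1_period (t - 2 * half_period a1 a2 * of_int k)"
proof (cases "t = 2 * half_period a1 a2 * (of_int k + 1)")
  case True
  then have "t / (2 * half_period a1 a2) = of_int (k + 1)"
    using half_period_pos by simp
  then have "\<lfloor>t / (2 * half_period a1 a2)\<rfloor> = k + 1" by linarith
  moreover have "t - 2 * half_period a1 a2 * of_int k = 2 * half_period a1 a2"
    using True by (simp add: algebra_simps)
  ultimately show ?thesis
    using True half_period_pos nonneg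
    by (auto simp: psi1_def psi1_period_def Let_def algebra_simps psi1_half_eq)
      (simp_all add: half_period_def)
next
  case False
  then have "\<lfloor>t / (2 * half_period a1 a2)\<rfloor> = k"
    using half_period_pos assms by (intro floor_unique) (auto simp: field_simps)
  then show ?thesis by (simp add: psi1_def psi1_period_def Let_def)
qed

lemma continuous_psi1: "continuous_on UNIV (psi1 a1 a2)"
proof -
  let ?P = "2 * half_period a1 a2"
  have P: "?P > 0" using half_period_pos by simp
  have piece: "continuous_on {?P * of_int k..?P * (of_int k + 1)} (psi1 a1 a2)" for k :: int
  proof -
    have "continuous_on {?P * of_int k..?P * (of_int k + 1)} (\<lambda>t. psi1_period (t - ?P * of_int k))"
      by (rule continuous_on_compose2[OF continuous_psi1_period])
        (auto intro!: continuous_intros simp: algebra_simps)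
    then show ?thesis
      by (rule continuous_on_eq) (rule psi1_eq_period[symmetric], auto)
  qed
  have "isCont (psi1 a1 a2) t" for t
  proof -
    define k where "k = \<lfloor>t / ?P\<rfloor>"
    have "of_int k \<le> t / ?P" "t / ?P < of_int k + 1" by (auto simp: k_def)
    then have k: "?P * of_int k \<le> t" "t < ?P * (of_int k + 1)"
      using P by (auto simp: field_simps)
    have "continuous_on ({?P * of_int (k - 1)..?P * (of_int (k - 1) + 1)} \<union>
        {?P * of_int k..?P * (of_int k + 1)}) (psi1 a1 a2)"
      by (rule continuous_on_closed_Un[OF _ _ piece piece]) auto
    then have c: "continuous_on {?P * (of_int k - 1)<..<?P * (of_int k + 1)} (psi1 a1 a2)"
      by (rule continuous_on_subset) (auto simp: algebra_simps)
    have "t \<in> {?P * (of_int k - 1)<..<?P * (of_int k + 1)}"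
      using k P by (auto simp: algebra_simps)
    with c show ?thesis by (simp add: continuous_on_eq_continuous_at)
  qed
  then show ?thesis by (simp add: continuous_at_imp_continuous_on)
qed

lemma integral_psi1: "integral {0..2 * half_period a1 a2} (psi1 a1 a2) = 0"
proof -
  let ?T = "half_period a1 a2"
  have T: "?T > 0" by (rule half_period_pos)
  have int: "psi1 a1 a2 integrable_on {u..v}" for u v
    by (intro integrable_continuous_real continuous_on_subset[OF continuous_psi1]) auto
  have anti: "psi1 a1 a2 (t + ?T) = - psi1 a1 a2 t" if "t \<in> {0..?T}" for t
    using that nonneg T psi1_eq_period[of 0 t] psi1_eq_period[of 0 "t + ?T"] psi1_half_eq[of 0]
      psi1_half_eq[of ?T]
    by (cases "t = 0") (auto simp: psi1_period_def half_period_def)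
  have "integral {0..2 * ?T} (psi1 a1 a2) =
      integral {0..?T} (psi1 a1 a2) + integral {?T..2 * ?T} (psi1 a1 a2)"
    using T int by (subst Henstock_Kurzweil_Integration.integral_combine) auto
  also have "integral {?T..2 * ?T} (psi1 a1 a2) = integral {0..?T} (\<lambda>t. psi1 a1 a2 (t + ?T))"
    using integral_shift_real_ivl[of ?T ?T "2 * ?T" "psi1 a1 a2"] by simp
  also have "\<dots> = integral {0..?T} (\<lambda>t. - psi1 a1 a2 t)"
    by (rule integral_cong) (rule anti)
  finally show ?thesis by simp
qed

lemma psi_aux:
  "continuous_on UNIV (psi (Suc n) a1 a2) \<and>
   (\<forall>t. psi (Suc n) a1 a2 (t + 2 * half_period a1 a2) = psi (Suc n) a1 a2 t) \<and>
   integral {0..2 * half_period a1 a2} (psi (Suc n) a1 a2) = 0 \<and>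
   zero_mean_primitive (2 * half_period a1 a2) (psi (Suc n) a1 a2) (psi (Suc (Suc n)) a1 a2)"
proof (induction n)
  have step: "zero_mean_primitive (2 * half_period a1 a2) (psi (Suc n) a1 a2)
      (psi (Suc (Suc n)) a1 a2)"
    if hyps: "continuous_on UNIV (psi (Suc n) a1 a2)"
      "\<forall>t. psi (Suc n) a1 a2 (t + 2 * half_period a1 a2) = psi (Suc n) a1 a2 t"
      "integral {0..2 * half_period a1 a2} (psi (Suc n) a1 a2) = 0" for n
  proof -
    have P: "2 * half_period a1 a2 > 0" using half_period_pos by simp
    obtain f where f: "zero_mean_primitive (2 * half_period a1 a2) (psi (Suc n) a1 a2) f"
      using zero_mean_primitive_exists[OF P hyps(1) _ hyps(3)] hyps(2) by blast
    show ?thesis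
      unfolding psi.simps
      by (rule theI[of "zero_mean_primitive _ _", OF f]) (rule zero_mean_primitive_unique[OF P _ f])
  qed
  {
    case 0
    show ?case
      using step[of 0] continuous_psi1 psi1_shift integral_psi1 by simp
  next
    case (Suc n)
    then have z: "zero_mean_primitive (2 * half_period a1 a2) (psi (Suc n) a1 a2)
      (psi (Suc (Suc n)) a1 a2)" by blast
    then have "continuous_on UNIV (psi (Suc (Suc n)) a1 a2)"
      by (meson DERIV_isCont continuous_at_imp_continuous_on zero_mean_primitive_def)
    then show ?case
      using z step[of "Suc n"] unfolding zero_mean_primitive_def by blast
  }
qed

lemma psi_Suc_Suc:
  "zero_mean_primitive (2 * half_period a1 a2) (psi (Suc n) a1 a2) (psi (Suc (Suc n)) a1 a2)"
  using psi_aux by blast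

end

end

theory Submission
  imports Defs
begin

text \<open>
  After rescaling, the derivatives of \<open>x\<close> are compared with the splines \<open>psi m\<close>. Enlarging \<open>lam\<close>
  slightly makes the two periods commensurable, so that the sign changes of a difference
  \<open>psi m (t + c) - \<theta> * g m t\<close> (where \<open>\<bar>\<theta>\<bar> < 1\<close>) can be counted over a common period. By Rolle's theorem
  their number does not decrease under differentiation. At the order \<open>1\<close> (condition a) or \<open>2\<close>
  (conditions b and c) the difference changes sign only once on each monotone branch of the spline,
  whereas a point at which \<open>\<theta> * g m\<close> is steeper than the spline at the same height would produce two
  additional sign changes. Hence, in the manner of Kolmogorov, \<open>\<theta> * g m = psi m \<circ> \<tau>\<close> up to a translation,
  with \<open>\<bar>\<tau>'\<bar> \<le> 1\<close>.

  The integral of \<open>\<bar>\<theta> * g m\<bar> powr p\<close> is estimated on each interval between neighbouring zeros. Let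
  \<open>M\<close> be the maximum there. If \<open>h \<le> 0\<close> on \<open>{0..M}\<close>, then, since \<open>\<tau>\<close> is a contraction, the integral of
  \<open>h\<close> along the hump is at most the one along the part of the spline below the height \<open>M\<close>. On humps shorter
  than those of the spline one takes \<open>h y = y powr p - M powr p\<close>; on the longer ones one takes
  \<open>h y = y powr p - M powr (p - 1) * y\<close> and bounds the area below the hump by the oscillation of the
  primitive, that is, of the derivative of the preceding order.
\<close>

section \<open>Absolutely continuous functions and essential bounds\<close>

text \<open>The intervals tagged in \<open>E\<close> do not overlap and lie in \<open>U\<close>, so
  their total length is below \<open>\<delta>\<close> and absolute continuity bounds their
  increments. They are the part of a tagged division where nothing is known about the
  derivative.\<close>

lemma abs_cont_on_bad_intervals:
  fixes p :: "(real \<times> real set) set" and f :: "real \<Rightarrow> real"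
  assumes p: "p tagged_division_of {\<alpha>..\<beta>}"
    and U: "open U" "emeasure lebesgue U < ennreal \<delta>"
    and sub: "\<And>t k. (t, k) \<in> p \<Longrightarrow> t \<in> E \<Longrightarrow> k \<subseteq> U"
    and \<delta>: "\<And>I :: (real \<times> real) set. finite I \<Longrightarrow> (\<forall>(u, v)\<in>I. \<alpha> \<le> u \<and> u \<le> v \<and> v \<le> \<beta>) \<Longrightarrow>
        disjoint_family_on (\<lambda>(u, v). {u<..<v}) I \<Longrightarrow>
        (\<Sum>(u, v)\<in>I. v - u) < \<delta> \<Longrightarrow> (\<Sum>(u, v)\<in>I. \<bar>f v - f u\<bar>) < \<epsilon>"
  shows "(\<Sum>(t, k)\<in>{(t, k)\<in>p. t \<in> E}. \<bar>f (Sup k) - f (Inf k)\<bar>) < \<epsilon>"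
proof -
  \<comment> \<open>Degenerate intervals contribute zero and are dropped. On the others, equal
    endpoints would give overlapping interiors, so \<open>ends\<close> is injective and the sum can
    be reindexed by endpoint pairs.\<close>
  define B where "B = {(t, k)\<in>p. t \<in> E \<and> Inf k < Sup k}"
  define ends where "ends = (\<lambda>(t::real, k::real set). (Inf k, Sup k))"
  have fin: "finite p" using p by blast
  then have finB: "finite B" unfolding B_def by (rule rev_finite_subset) auto
  have K: "k = {Inf k..Sup k}" "Inf k \<le> Sup k" "\<alpha> \<le> Inf k" "Sup k \<le> \<beta>" if tk: "(t, k) \<in> p" for t k
  proof -
    obtain a b where ab: "k = {a..b}" using tagged_division_ofD(4)[OF p tk] unfolding box_real by blast
    have ne: "t \<in> k" using tagged_division_ofD(2)[OF p tk] .
    then have le: "a \<le> b" using ab by auto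
    then show "k = {Inf k..Sup k}" "Inf k \<le> Sup k" using ab by auto
    have "k \<subseteq> {\<alpha>..\<beta>}" using tagged_division_ofD(3)[OF p tk] .
    then show "\<alpha> \<le> Inf k" "Sup k \<le> \<beta>" using ab le by auto
  qed
  have disj: "{Inf k<..<Sup k} \<inter> {Inf k'<..<Sup k'} = {}"
    if "(t, k) \<in> p" "(t', k') \<in> p" "(t, k) \<noteq> (t', k')" for t k t' k'
  proof -
    have "interior k \<inter> interior k' = {}" using tagged_division_ofD(5)[OF p that] .
    moreover have "interior k = {Inf k<..<Sup k}" "interior k' = {Inf k'<..<Sup k'}"
      using K(1)[OF that(1)] K(1)[OF that(2)] interior_atLeastAtMost_real by metis+
    ultimately show ?thesis by simp
  qed
  have inj: "inj_on ends B"
  proof (rule inj_onI)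
    fix y z assume yz: "y \<in> B" "z \<in> B" "ends y = ends z"
    obtain t k t' k' where [simp]: "y = (t, k)" "z = (t', k')" by fastforce
    have eq: "Inf k = Inf k'" "Sup k = Sup k'" "Inf k < Sup k" "(t, k) \<in> p" "(t', k') \<in> p"
      using yz by (auto simp: ends_def B_def)
    have "{Inf k<..<Sup k} \<noteq> {}" using eq(3) by simp
    then show "y = z" using disj[OF eq(4,5)] eq(1,2) by auto
  qed
  have disjI: "disjoint_family_on (\<lambda>(u, v). {u<..<v}) (ends ` B)"
    unfolding disjoint_family_on_def
  proof (intro ballI impI)
    fix y z assume yz: "y \<in> ends ` B" "z \<in> ends ` B" "y \<noteq> z"
    then obtain t k t' k' where *: "(t, k) \<in> B" "(t', k') \<in> B" "y = ends (t, k)" "z = ends (t', k')"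
      by (metis imageE surj_pair)
    then have "(t, k) \<noteq> (t', k')" using yz by metis
    with * disj[of t k t' k'] show "(case y of (u, v) \<Rightarrow> {u<..<v}) \<inter> (case z of (u, v) \<Rightarrow> {u<..<v}) = {}"
      by (auto simp: ends_def B_def)
  qed
  have finm: "emeasure lebesgue (case i of (u, v) \<Rightarrow> {u<..<v}) \<noteq> \<infinity>" if "i \<in> ends ` B" for i
    using that by (auto simp: ends_def B_def)
  have Usets: "U \<in> sets lebesgue" using U(1) by simp
  have Ufin: "emeasure lebesgue U \<noteq> \<infinity>" using U(2) by (metis ennreal_less_top infinity_ennreal_def less_trans order_less_irrefl)
  have "(\<Sum>(u, v)\<in>ends ` B. v - u) = (\<Sum>i\<in>ends ` B. measure lebesgue (case i of (u, v) \<Rightarrow> {u<..<v}))"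
    by (intro sum.cong) (auto simp: ends_def B_def)
  also have "\<dots> = measure lebesgue (\<Union>i\<in>ends ` B. case i of (u, v) \<Rightarrow> {u<..<v})"
    using finB disjI finm by (subst measure_finite_Union) auto
  also have "\<dots> \<le> measure lebesgue U"
  proof (rule measure_mono_fmeasurable)
    show "(\<Union>i\<in>ends ` B. case i of (u, v) \<Rightarrow> {u<..<v}) \<subseteq> U"
    proof
      fix y assume "y \<in> (\<Union>i\<in>ends ` B. case i of (u, v) \<Rightarrow> {u<..<v})"
      then have "\<exists>i\<in>B. y \<in> (case ends i of (u, v) \<Rightarrow> {u<..<v})"
        by (simp only: UN_iff bex_simps)
      then obtain i where i: "i \<in> B" "y \<in> (case ends i of (u, v) \<Rightarrow> {u<..<v})"
        by (rule bexE)
      moreover obtain t k where "i = (t, k)" by fastforce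
      ultimately have "(t, k) \<in> B" "y \<in> (case ends (t, k) of (u, v) \<Rightarrow> {u<..<v})" by simp_all
      then have "(t, k) \<in> p" "t \<in> E" "y \<in> {Inf k<..<Sup k}" by (auto simp: B_def ends_def)
      moreover from this have "y \<in> {Inf k..Sup k}" by simp
      ultimately show "y \<in> U" using K(1)[of t k] sub[of t k] by blast
    qed
    show "(\<Union>i\<in>ends ` B. case i of (u, v) \<Rightarrow> {u<..<v}) \<in> sets lebesgue"
      using finB by (intro sets.finite_UN) auto
    show "U \<in> fmeasurable lebesgue" using Usets Ufin by (simp add: fmeasurable_def less_top)
  qed
  also have "\<dots> < \<delta>"
    using U(2) Ufin by (metis emeasure_eq_ennreal_measure ennreal_less_iff infinity_ennreal_def measure_nonneg)
  finally have "(\<Sum>(u, v)\<in>ends ` B. \<bar>f v - f u\<bar>) < \<epsilon>"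
    using finB disjI K by (intro \<delta>) (auto simp: ends_def B_def)
  moreover have "(\<Sum>(u, v)\<in>ends ` B. \<bar>f v - f u\<bar>) = (\<Sum>(t, k)\<in>B. \<bar>f (Sup k) - f (Inf k)\<bar>)"
    by (subst sum.reindex[OF inj]) (auto simp: ends_def intro!: sum.cong)
  moreover have "(\<Sum>(t, k)\<in>{(t, k)\<in>p. t \<in> E}. \<bar>f (Sup k) - f (Inf k)\<bar>) = (\<Sum>(t, k)\<in>B. \<bar>f (Sup k) - f (Inf k)\<bar>)"
  proof (rule sum.mono_neutral_right)
    show "finite {(t, k)\<in>p. t \<in> E}" using fin by (rule rev_finite_subset) auto
    show "\<forall>i\<in>{(t, k)\<in>p. t \<in> E} - B. (case i of (t, k) \<Rightarrow> \<bar>f (Sup k) - f (Inf k)\<bar>) = 0"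
    proof
      fix i assume i: "i \<in> {(t, k)\<in>p. t \<in> E} - B"
      obtain t k where [simp]: "i = (t, k)" by fastforce
      have "Inf k = Sup k" using i K(2)[of t k] by (auto simp: B_def)
      then show "(case i of (t, k) \<Rightarrow> \<bar>f (Sup k) - f (Inf k)\<bar>) = 0" by simp
    qed
  qed (auto simp: B_def)
  ultimately show ?thesis by simp
qed

text \<open>A Cousin-type argument takes the place of integrating the derivative. Tags outside the
  null set \<open>E\<close> get intervals so short that the increment is at most
  \<open>C + \<epsilon>\<close> times the length; tags in \<open>E\<close> get intervals inside an
  open set of measure below \<open>\<delta>\<close>, whose increments sum to less than
  \<open>\<epsilon>\<close>.\<close>

lemma abs_cont_on_lipschitz:
  assumes ac: "abs_cont_on \<alpha> \<beta> f" and le: "\<alpha> \<le> \<beta>" and C: "C \<ge> 0"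
    and ae: "AE t in lebesgue. \<exists>D. (f has_real_derivative D) (at t) \<and> \<bar>D\<bar> \<le> C"
  shows "\<bar>f \<beta> - f \<alpha>\<bar> \<le> C * (\<beta> - \<alpha>)"
proof (rule field_le_epsilon)
  fix e :: real assume e: "e > 0"
  \<comment> \<open>The total error will be
    \<open>\<epsilon> * (\<beta> - \<alpha>) + \<epsilon>\<close>, which this choice makes equal to
    \<open>e\<close>.\<close>
  define \<epsilon> where "\<epsilon> = e / (\<beta> - \<alpha> + 1)"
  have \<epsilon>: "\<epsilon> > 0" using e le by (simp add: \<epsilon>_def)
  obtain \<delta> where \<delta>: "\<delta> > 0" "\<And>I :: (real \<times> real) set. finite I \<Longrightarrow>
        (\<forall>(u, v)\<in>I. \<alpha> \<le> u \<and> u \<le> v \<and> v \<le> \<beta>) \<Longrightarrow>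
        disjoint_family_on (\<lambda>(u, v). {u<..<v}) I \<Longrightarrow>
        (\<Sum>(u, v)\<in>I. v - u) < \<delta> \<Longrightarrow> (\<Sum>(u, v)\<in>I. \<bar>f v - f u\<bar>) < \<epsilon>"
    using ac \<epsilon> unfolding abs_cont_on_def by meson
  obtain E where E: "E \<in> null_sets lebesgue"
    "\<And>t. t \<notin> E \<Longrightarrow> \<exists>D. (f has_real_derivative D) (at t) \<and> \<bar>D\<bar> \<le> C"
    using ae by (rule AE_E3) (rule that, auto)
  have "E \<in> sets lebesgue" using E(1) by (rule null_setsD2)
  then obtain U where U: "open U" "E \<subseteq> U" "emeasure lebesgue (U - E) < ennreal \<delta>"
    using \<delta>(1) by (rule sets_lebesgue_outer_open)
  have Um: "emeasure lebesgue U < ennreal \<delta>"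
    using emeasure_Diff_null_set[OF E(1), of U] U by simp
  have "\<exists>d>0. (t \<in> E \<longrightarrow> ball t d \<subseteq> U) \<and>
      (t \<notin> E \<longrightarrow> (\<forall>u v. u \<le> t \<and> t \<le> v \<and> {u..v} \<subseteq> ball t d \<longrightarrow> \<bar>f v - f u\<bar> \<le> (C + \<epsilon>) * (v - u)))" for t
  proof (cases "t \<in> E")
    case True
    then have "t \<in> U" using U(2) by blast
    then obtain d where "d > 0" "ball t d \<subseteq> U" using U(1) open_contains_ball by blast
    then show ?thesis using True by blast
  next
    case False
    then obtain D where D: "(f has_real_derivative D) (at t)" "\<bar>D\<bar> \<le> C" using E(2) by blast
    then have "(f has_derivative (*) D) (at t)" by (simp add: has_field_derivative_def)
    then obtain d where d: "d > 0" "\<And>y. norm (y - t) < d \<Longrightarrow> norm (f y - f t - D * (y - t)) \<le> \<epsilon> * norm (y - t)"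
      using \<epsilon> unfolding has_derivative_at_alt by blast
    \<comment> \<open>Both endpoints are compared with the tag. Since it lies between them, the two
      errors add up to \<open>\<epsilon> * (v - u)\<close>.\<close>
    have "\<bar>f v - f u\<bar> \<le> (C + \<epsilon>) * (v - u)" if uv: "u \<le> t" "t \<le> v" "{u..v} \<subseteq> ball t d" for u v
    proof -
      have "u \<in> {u..v}" "v \<in> {u..v}" using uv by simp_all
      then have "u \<in> ball t d" "v \<in> ball t d" using uv(3) by blast+
      then have "\<bar>f u - f t - D * (u - t)\<bar> \<le> \<epsilon> * (t - u)" "\<bar>f v - f t - D * (v - t)\<bar> \<le> \<epsilon> * (v - t)"
        using d(2)[of u] d(2)[of v] uv by (auto simp: dist_real_def)
      moreover have "\<bar>D * (v - u)\<bar> \<le> C * (v - u)" using D(2) uv by (auto simp: abs_mult intro!: mult_right_mono)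
      ultimately show ?thesis by (simp add: algebra_simps abs_le_iff)
    qed
    then show ?thesis using False d(1) by blast
  qed
  then obtain d where d: "\<And>t. d t > 0" "\<And>t. t \<in> E \<Longrightarrow> ball t (d t) \<subseteq> U"
    "\<And>t u v. t \<notin> E \<Longrightarrow> u \<le> t \<Longrightarrow> t \<le> v \<Longrightarrow> {u..v} \<subseteq> ball t (d t) \<Longrightarrow> \<bar>f v - f u\<bar> \<le> (C + \<epsilon>) * (v - u)"
    by metis
  have "gauge (\<lambda>t. ball t (d t))" using d(1) by (simp add: gauge_def)
  then obtain p where p: "p tagged_division_of {\<alpha>..\<beta>}" "(\<lambda>t. ball t (d t)) fine p"
    using fine_division_exists_real by blast
  have fin: "finite p" using p by blast
  have tot: "(\<Sum>(t, k)\<in>p. Sup k - Inf k) = \<beta> - \<alpha>"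
    using additive_tagged_division_1[OF le p(1), of "\<lambda>t. t"] by simp
  have good: "\<bar>f (Sup k) - f (Inf k)\<bar> \<le> (C + \<epsilon>) * (Sup k - Inf k)" "Inf k \<le> Sup k"
    if tk: "(t, k) \<in> p" "t \<notin> E" for t k
  proof -
    obtain a b where ab: "k = {a..b}" using tagged_division_ofD(4)[OF p(1) tk(1)] unfolding box_real by blast
    have "t \<in> k" using tagged_division_ofD(2)[OF p(1) tk(1)] .
    moreover have "k \<subseteq> ball t (d t)" using p(2) tk(1) by (auto simp: fine_def)
    ultimately show "\<bar>f (Sup k) - f (Inf k)\<bar> \<le> (C + \<epsilon>) * (Sup k - Inf k)" "Inf k \<le> Sup k"
      using d(3)[OF tk(2), of a b] ab by auto
  qed
  have nonneg: "Sup k - Inf k \<ge> 0" if "(t, k) \<in> p" for t k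
    using tagged_division_ofD(2,4)[OF p(1) that] by (auto simp: box_real)
  have subU: "k \<subseteq> U" if "(t, k) \<in> p" "t \<in> E" for t k
  proof -
    have "k \<subseteq> ball t (d t)" using p(2) that(1) by (auto simp: fine_def)
    then show ?thesis using d(2)[OF that(2)] by simp
  qed
  have "\<bar>f \<beta> - f \<alpha>\<bar> = \<bar>\<Sum>(t, k)\<in>p. f (Sup k) - f (Inf k)\<bar>"
    using additive_tagged_division_1[OF le p(1), of f] by simp
  also have "\<dots> \<le> (\<Sum>(t, k)\<in>p. \<bar>f (Sup k) - f (Inf k)\<bar>)"
    by (rule order_trans[OF sum_abs]) (auto intro!: sum_mono)
  also have "\<dots> = (\<Sum>(t, k)\<in>p - {(t, k)\<in>p. t \<in> E}. \<bar>f (Sup k) - f (Inf k)\<bar>) +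
      (\<Sum>(t, k)\<in>{(t, k)\<in>p. t \<in> E}. \<bar>f (Sup k) - f (Inf k)\<bar>)"
    using fin by (intro sum.subset_diff) auto
  also have "(\<Sum>(t, k)\<in>{(t, k)\<in>p. t \<in> E}. \<bar>f (Sup k) - f (Inf k)\<bar>) \<le> \<epsilon>"
    by (rule less_imp_le, rule abs_cont_on_bad_intervals[OF p(1) U(1) Um subU \<delta>(2)])
  also have "(\<Sum>(t, k)\<in>p - {(t, k)\<in>p. t \<in> E}. \<bar>f (Sup k) - f (Inf k)\<bar>) \<le>
      (\<Sum>(t, k)\<in>p - {(t, k)\<in>p. t \<in> E}. (C + \<epsilon>) * (Sup k - Inf k))"
    using good by (intro sum_mono) auto
  also have "\<dots> \<le> (\<Sum>(t, k)\<in>p. (C + \<epsilon>) * (Sup k - Inf k))"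
    using fin nonneg C \<epsilon> by (intro sum_mono2) auto
  also have "\<dots> = (C + \<epsilon>) * (\<beta> - \<alpha>)"
    unfolding tot[symmetric] by (simp add: sum_distrib_left split_def)
  finally have "\<bar>f \<beta> - f \<alpha>\<bar> \<le> (C + \<epsilon>) * (\<beta> - \<alpha>) + \<epsilon>" by simp
  also have "\<dots> = C * (\<beta> - \<alpha>) + \<epsilon> * (\<beta> - \<alpha> + 1)" by (simp add: algebra_simps)
  also have "\<epsilon> * (\<beta> - \<alpha> + 1) = e" using le by (simp add: \<epsilon>_def)
  finally show "\<bar>f \<beta> - f \<alpha>\<bar> \<le> C * (\<beta> - \<alpha>) + e" by simp
qed

section \<open>Antiderivatives and essential bounds\<close>

lemma antiderivative_exists:
  fixes g :: "real \<Rightarrow> real"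
  assumes "continuous_on UNIV g"
  obtains G where "\<And>t. (G has_real_derivative g t) (at t)"
proof
  fix t :: real
  define A where "A = - \<bar>t\<bar> - 1"
  define B where "B = \<bar>t\<bar> + 1"
  have AB: "A < t" "t < B" "A < 0" "0 < B" by (auto simp: A_def B_def)
  have "((\<lambda>u. LBINT y=ereal 0..ereal u. g y) has_vector_derivative g t) (at t within {A..B})"
    using AB assms by (intro interval_integral_FTC2) (auto intro: continuous_on_subset)
  moreover have "at t within {A..B} = at t"
    using AB by (intro at_within_interior) (auto simp: interior_atLeastAtMost_real)
  ultimately show "((\<lambda>u. LBINT y=ereal 0..ereal u. g y) has_real_derivative g t) (at t)"
    by (simp add: has_real_derivative_iff_has_vector_derivative)
qed

lemma integral_eq_antiderivative_diff:
  fixes H h :: "real \<Rightarrow> real"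
  assumes "\<And>t. (H has_real_derivative h t) (at t)" "u \<le> v"
  shows "integral {u..v} h = H v - H u"
  using assms by (intro integral_unique fundamental_theorem_of_calculus)
    (auto simp: has_real_derivative_iff_has_vector_derivative has_vector_derivative_at_within)

text \<open>For continuous \<open>f\<close> the set where the bound fails is open, and a nonempty
  open set is not negligible.\<close>

lemma Linf_norm_le_pointwise:
  assumes "Linf_norm f \<le> ennreal M" "continuous_on UNIV f" "M \<ge> 0"
  shows "\<bar>f t\<bar> \<le> M"
proof (rule ccontr)
  assume n: "\<not> \<bar>f t\<bar> \<le> M"
  define S where "S = {s. M < \<bar>f s\<bar>}"
  have "open S" unfolding S_def
    by (intro open_Collect_less continuous_intros assms(2))
  moreover have "t \<in> S" using n by (simp add: S_def)
  ultimately obtain d where d: "d > 0" "ball t d \<subseteq> S" using open_contains_ball by blast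
  have "AE s in lebesgue. ennreal \<bar>f s\<bar> \<le> ennreal M"
    using esssup_AE[of "\<lambda>s. ennreal \<bar>f s\<bar>" lebesgue] assms(1) unfolding Linf_norm_def
    by (auto elim!: eventually_mono)
  then have "AE s in lebesgue. s \<notin> S"
    using assms(3) by (auto elim!: eventually_mono simp: S_def ennreal_le_iff)
  then obtain N where N: "N \<in> null_sets lebesgue" "S \<subseteq> N"
    by (rule AE_E3) (rule that, auto)
  then have "ball t d \<in> null_sets lebesgue" using d by (intro null_sets_subset[OF N(1)]) auto
  then have "negligible (ball t d)" by (simp add: negligible_iff_null_sets)
  then show False using d(1) open_not_negligible[of "ball t d"] by auto
qed

lemma Linf_norm_le_AE:
  assumes "f \<in> borel_measurable lebesgue" "AE t in lebesgue. \<bar>f t\<bar> \<le> M"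
  shows "Linf_norm f \<le> ennreal M"
proof -
  have "(\<lambda>t. ennreal \<bar>f t\<bar>) \<in> borel_measurable lebesgue" using assms(1) by measurable
  moreover have "AE t in lebesgue. ennreal \<bar>f t\<bar> \<le> ennreal M"
    using assms(2) by (rule eventually_mono) (rule ennreal_leI)
  ultimately show ?thesis unfolding Linf_norm_def by (rule esssup_I)
qed

section \<open>The comparison splines\<close>

lemma antiperiodic_int:
  fixes f :: "real \<Rightarrow> real"
  assumes "\<And>t. f (t + T) = - f t"
  shows "f (t + of_int k * T) = (if even k then f t else - f t)"
proof (induction k rule: int_induct[where k = 0])
  case base
  then show ?case by simp
next
  case (step1 i)
  have "f (t + of_int (i + 1) * T) = - f (t + of_int i * T)"
    using assms[of "t + of_int i * T"] by (simp add: algebra_simps)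
  then show ?case using step1 by simp
next
  case (step2 i)
  have "f (t + of_int i * T) = - f (t + of_int (i - 1) * T)"
    using assms[of "t + of_int (i - 1) * T"] by (simp add: algebra_simps)
  then show ?case using step2 by (auto split: if_splits)
qed

text \<open>The translate of \<open>psi m\<close> that is odd about \<open>0\<close> and increasing there.\<close>

definition cpsi :: "nat \<Rightarrow> real \<Rightarrow> real \<Rightarrow> real \<Rightarrow> real" where
  "cpsi m a1 a2 s = psi m a1 a2 (a1 / 2 + (real m - 1) * (half_period a1 a2 / 2) + s)"

locale psi_parameters =
  fixes a1 a2 T :: real
  assumes nonneg: "a1 \<ge> 0" "a2 \<ge> 0" and T_def: "T = half_period a1 a2"
begin

lemma T_pos: "T > 0"
  using half_period_pos[OF nonneg] by (simp add: T_def)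

lemma T_eq: "T = a1 + a2 + 2"
  by (simp add: T_def half_period_def)

text \<open>The point \<open>a1 / 2 + T / 2\<close> is the midpoint of the plateau of
  \<open>psi1\<close>. In the window of length \<open>T\<close> around it the graph is a symmetric
  trapezoid, which exhibits the evenness hidden in the piecewise definition.\<close>

lemma psi1_near_centre:
  assumes "\<bar>s\<bar> \<le> T / 2"
  shows "psi1 a1 a2 (a1 / 2 + T / 2 + s) = max 0 (min 1 (1 + a2 / 2 - \<bar>s\<bar>))"
proof -
  define t where "t = a1 / 2 + T / 2 + s"
  have s: "- (T / 2) \<le> s" "s \<le> T / 2" using assms by auto
  have t: "0 \<le> t" "t \<le> 2 * T" using s nonneg T_eq unfolding t_def by linarith+
  have e: "psi1 a1 a2 t = psi1_period a1 a2 t"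
    using psi1_eq_period[OF nonneg, of 0 t] t by (simp add: T_def)
  show ?thesis
  proof (cases "t \<le> T")
    case True
    then have "psi1 a1 a2 t = max 0 (min 1 (min (t - a1) (2 + a1 + a2 - t)))"
      using e t psi1_half_eq[OF nonneg, of t] by (simp add: psi1_period_def[OF nonneg] T_def)
    also have "t - a1 = 1 + a2 / 2 + s" using T_eq unfolding t_def by linarith
    also have "2 + a1 + a2 - t = 1 + a2 / 2 - s" using T_eq unfolding t_def by linarith
    also have "min (1 + a2 / 2 + s) (1 + a2 / 2 - s) = 1 + a2 / 2 - \<bar>s\<bar>" by auto
    finally show ?thesis by (simp add: t_def)
  next
    \<comment> \<open>The window extends past \<open>T\<close> by at most \<open>a1 / 2\<close>,
      hence only into the flat zero piece that opens the second half-period.\<close>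
    case False
    then have "psi1 a1 a2 t = - psi1_half a1 a2 (t - T)"
      using e by (simp add: psi1_period_def[OF nonneg] T_def)
    moreover have "t - T \<le> a1" using s T_eq nonneg unfolding t_def by linarith
    then have "psi1_half a1 a2 (t - T) = 0" by (simp add: psi1_half_def)
    ultimately have "psi1 a1 a2 t = 0" by simp
    moreover have "1 + a2 / 2 - \<bar>s\<bar> \<le> 0" using False T_eq unfolding t_def by linarith
    ultimately show ?thesis by (simp add: t_def)
  qed
qed

lemma psi1_antiperiodic: "psi1 a1 a2 (t + T) = - psi1 a1 a2 t"
proof -
  have T: "half_period a1 a2 = T" by (simp add: T_def)
  define k where "k = \<lfloor>t / (2 * T)\<rfloor>"
  have "of_int k \<le> t / (2 * T)" "t / (2 * T) < of_int k + 1" by (auto simp: k_def)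
  then have k: "2 * T * of_int k \<le> t" "t < 2 * T * (of_int k + 1)"
    using T_pos by (auto simp: field_simps)
  define s where "s = t - 2 * T * of_int k"
  have s: "0 \<le> s" "s < 2 * T" using k by (auto simp: s_def algebra_simps)
  have ps: "psi1 a1 a2 t = psi1_period a1 a2 s"
    using psi1_eq_period[OF nonneg, of k t] k by (simp add: s_def T)
  have z: "psi1_half a1 a2 0 = 0" "psi1_half a1 a2 T = 0"
    using nonneg psi1_half_eq[OF nonneg, of 0] psi1_half_eq[OF nonneg, of T] T_pos T_eq
    by (auto simp: T)
  show ?thesis
  proof (cases "s \<le> T")
    case True
    then have "psi1 a1 a2 (t + T) = psi1_period a1 a2 (s + T)"
      using psi1_eq_period[OF nonneg, of k "t + T"] k s T_pos
      by (simp add: s_def T algebra_simps)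
    then show ?thesis
      using ps True s z by (cases "s = 0") (auto simp: psi1_period_def[OF nonneg] T)
  next
    case False
    then have "psi1 a1 a2 (t + T) = psi1_period a1 a2 (s - T)"
      using psi1_eq_period[OF nonneg, of "k + 1" "t + T"] k s T_pos
      by (simp add: s_def T algebra_simps)
    then show ?thesis
      using ps False s by (auto simp: psi1_period_def[OF nonneg] T)
  qed
qed

lemma psi_has_derivative:
  assumes "m \<ge> 1"
  shows "(psi (Suc m) a1 a2 has_real_derivative psi m a1 a2 t) (at t)"
  using assms psi_Suc_Suc[OF nonneg, of "m - 1"] by (cases m) (auto simp: zero_mean_primitive_def)

lemma psi_continuous: "m \<ge> 1 \<Longrightarrow> continuous_on UNIV (psi m a1 a2)"
  using psi_aux[OF nonneg, of "m - 1"] by (cases m) auto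

text \<open>By antiperiodicity at the lower order, \<open>?f (t + T) + ?f t\<close> is constant.
  Integrating this constant over a half-period gives the integral over a full period, so the zero
  mean forces it to vanish.\<close>

lemma psi_antiperiodic:
  assumes "m \<ge> 1"
  shows "psi m a1 a2 (t + T) = - psi m a1 a2 t"
  using assms
proof (induction m arbitrary: t rule: nat_induct_at_least)
  case base
  then show ?case by (simp add: psi1_antiperiodic)
next
  case (Suc n)
  let ?f = "psi (Suc n) a1 a2"
  have "((\<lambda>t. ?f (t + T) + ?f t) has_real_derivative 0) (at t)" for t
    using DERIV_add[OF psi_has_derivative[OF Suc.hyps, of "t + T", unfolded DERIV_shift]
        psi_has_derivative[OF Suc.hyps, of t]] Suc.IH[of t] by simp
  then have c: "?f (t + T) + ?f t = ?f (0 + T) + ?f 0" for t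
    using DERIV_isconst_all[of "\<lambda>t. ?f (t + T) + ?f t"] by blast
  define C where "C = ?f (0 + T) + ?f 0"
  have int: "?f integrable_on {u..v}" for u v
    using psi_continuous[of "Suc n"] by (intro integrable_continuous_real) (auto intro: continuous_on_subset)
  have "(\<lambda>t. ?f (t + T)) = (\<lambda>t. C - ?f t)" using c by (auto simp: C_def algebra_simps)
  then have "integral {0..T} (\<lambda>t. C - ?f t) = integral {T..2 * T} ?f"
    using integral_shift_real_ivl[of T T "2 * T" ?f] by simp
  moreover have "integral {0..T} ?f + integral {T..2 * T} ?f = integral {0..2 * T} ?f"
    using T_pos int by (intro Henstock_Kurzweil_Integration.integral_combine) auto
  moreover have "integral {0..2 * T} ?f = 0"
    using psi_aux[OF nonneg, of n] by (simp add: T_def)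
  moreover have "integral {0..T} (\<lambda>t. C - ?f t) = T * C - integral {0..T} ?f"
    using T_pos int by (subst Henstock_Kurzweil_Integration.integral_diff) auto
  ultimately have "T * C = 0" by linarith
  then have "C = 0" using T_pos by simp
  then show ?case using c[of t] by (simp add: C_def)
qed

text \<open>The shift by \<open>T / 2\<close> comes from the centring, which moves by a quarter
  period with each order: the zero of a spline about which it is odd lies at an extremum of its
  derivative.\<close>

lemma cpsi_has_derivative:
  assumes "m \<ge> 1"
  shows "(cpsi (Suc m) a1 a2 has_real_derivative cpsi m a1 a2 (s + T / 2)) (at s)"
proof -
  define z where "z = a1 / 2 + real m * (T / 2)"
  have "((\<lambda>s. psi (Suc m) a1 a2 (z + s)) has_real_derivative psi m a1 a2 (z + s)) (at s)"
  proof -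
    have "((\<lambda>s. z + s) has_real_derivative 1) (at s)" by (auto intro!: derivative_eq_intros)
    from DERIV_chain2[OF psi_has_derivative[OF assms] this] show ?thesis by simp
  qed
  moreover have "cpsi (Suc m) a1 a2 = (\<lambda>s. psi (Suc m) a1 a2 (z + s))"
    by (rule ext) (simp add: cpsi_def z_def T_def)
  moreover have "cpsi m a1 a2 (s + T / 2) = psi m a1 a2 (z + s)"
    unfolding cpsi_def z_def T_def[symmetric]
    by (rule arg_cong[of _ _ "psi m a1 a2"]) (simp add: field_simps)
  ultimately show ?thesis by simp
qed

lemma cpsi_continuous:
  assumes "m \<ge> 1"
  shows "continuous_on S (cpsi m a1 a2)"
  unfolding cpsi_def
  by (rule continuous_on_compose2[OF psi_continuous[OF assms]]) (auto intro!: continuous_intros)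

lemma cpsi_antiperiodic: "m \<ge> 1 \<Longrightarrow> cpsi m a1 a2 (s + T) = - cpsi m a1 a2 s"
  using psi_antiperiodic[of m "a1 / 2 + (real m - 1) * (half_period a1 a2 / 2) + s"]
  by (simp add: cpsi_def add.assoc)

lemma cpsi_1_near_centre:
  assumes "\<bar>s\<bar> \<le> T / 2"
  shows "cpsi 1 a1 a2 (s + T / 2) = max 0 (min 1 (1 + a2 / 2 - \<bar>s\<bar>))"
  using psi1_near_centre[OF assms] by (simp add: cpsi_def algebra_simps)

text \<open>At order 1 this is the symmetry of the trapezoid. For higher orders the lower spline is
  even about \<open>T / 2\<close>, so \<open>?f (- s) + ?f s\<close> is constant, and
  antiperiodicity makes it zero at \<open>T / 2\<close>.\<close>

lemma cpsi_odd:
  assumes "m \<ge> 1"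
  shows "cpsi m a1 a2 (- s) = - cpsi m a1 a2 s"
  using assms
proof (induction m arbitrary: s rule: nat_induct_at_least)
  case base
  define k where "k = \<lfloor>s / T\<rfloor>"
  have "of_int k \<le> s / T" "s / T < of_int k + 1" by (auto simp: k_def)
  then have k: "T * of_int k \<le> s" "s < T * (of_int k + 1)"
    using T_pos by (auto simp: field_simps)
  define u where "u = s - (of_int k + 1 / 2) * T"
  have "u = s - T * of_int k - T / 2" "s < T * of_int k + T"
    using k(2) by (simp_all add: u_def algebra_simps)
  then have u: "\<bar>u\<bar> \<le> T / 2" using k(1) by linarith
  have "cpsi 1 a1 a2 s = cpsi 1 a1 a2 ((u + T / 2) + of_int k * T)"
    by (simp add: u_def algebra_simps)
  also have "\<dots> = (if even k then cpsi 1 a1 a2 (u + T / 2) else - cpsi 1 a1 a2 (u + T / 2))"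
    by (rule antiperiodic_int) (simp add: cpsi_antiperiodic)
  finally have 1: "cpsi 1 a1 a2 s = \<dots>" .
  \<comment> \<open>Reflection sends window \<open>k\<close> to window \<open>- k - 1\<close>, which
    has the opposite parity; this yields the change of sign.\<close>
  have "cpsi 1 a1 a2 (- s) = cpsi 1 a1 a2 ((- u + T / 2) + of_int (- k - 1) * T)"
    by (simp add: u_def algebra_simps)
  also have "\<dots> = (if even (- k - 1) then cpsi 1 a1 a2 (- u + T / 2) else - cpsi 1 a1 a2 (- u + T / 2))"
    by (rule antiperiodic_int) (simp add: cpsi_antiperiodic)
  finally have 2: "cpsi 1 a1 a2 (- s) = \<dots>" .
  have "cpsi 1 a1 a2 (- u + T / 2) = cpsi 1 a1 a2 (u + T / 2)"
    using cpsi_1_near_centre[of u] cpsi_1_near_centre[of "- u"] u by simp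
  then show ?case unfolding 1 2 by simp
next
  case (Suc n)
  let ?f = "cpsi (Suc n) a1 a2"
  have even: "cpsi n a1 a2 (- s + T / 2) = cpsi n a1 a2 (s + T / 2)" for s
    using Suc.IH[of "s - T / 2"] cpsi_antiperiodic[OF Suc.hyps, of "s - T / 2"]
    by (simp add: algebra_simps)
  have "((\<lambda>s. ?f (- s) + ?f s) has_real_derivative 0) (at s)" for s
  proof -
    have "((\<lambda>s. ?f (- s)) has_real_derivative cpsi n a1 a2 (- s + T / 2) * - 1) (at s)"
      by (rule DERIV_chain2[OF cpsi_has_derivative[OF Suc.hyps]]) (auto intro!: derivative_eq_intros)
    from DERIV_add[OF this cpsi_has_derivative[OF Suc.hyps, of s]] show ?thesis
      using even[of s] by simp
  qed
  then have "?f (- s) + ?f s = ?f (- (T / 2)) + ?f (T / 2)"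
    using DERIV_isconst_all[of "\<lambda>s. ?f (- s) + ?f s" s "T / 2"] by blast
  also have "\<dots> = 0" using cpsi_antiperiodic[of "Suc n" "- (T / 2)"] by simp
  finally show ?case by simp
qed

lemma cpsi_0: "m \<ge> 1 \<Longrightarrow> cpsi m a1 a2 0 = 0"
  using cpsi_odd[of m 0] by simp

lemma cpsi_even_centre: "m \<ge> 1 \<Longrightarrow> cpsi m a1 a2 (- s + T / 2) = cpsi m a1 a2 (s + T / 2)"
  using cpsi_odd[of m "s - T / 2"] cpsi_antiperiodic[of m "s - T / 2"] by (simp add: algebra_simps)

section \<open>Positivity, monotonicity and maxima of the centred splines\<close>

lemma cpsi_1_nonneg:
  assumes "0 \<le> s" "s \<le> T"
  shows "cpsi 1 a1 a2 s \<ge> 0"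
proof -
  have "\<bar>s - T / 2\<bar> \<le> T / 2" using assms by linarith
  from cpsi_1_near_centre[OF this] show ?thesis by simp
qed

lemma cpsi_1_centre: "cpsi 1 a1 a2 (T / 2) = 1"
  using cpsi_1_near_centre[of 0] T_pos nonneg by simp

text \<open>The slope at the zero \<open>0\<close> is the central value of the lower spline, so the
  function becomes positive at once. It does not decrease up to \<open>T / 2\<close>, and the second
  half follows by reflection.\<close>

lemma cpsi_pos_step:
  assumes m: "m \<ge> 1" and nn: "\<And>s. 0 \<le> s \<Longrightarrow> s \<le> T \<Longrightarrow> cpsi m a1 a2 s \<ge> 0"
    and c: "cpsi m a1 a2 (T / 2) > 0" and s: "0 < s" "s < T"
  shows "cpsi (Suc m) a1 a2 s > 0"
proof -
  let ?f = "cpsi (Suc m) a1 a2"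
  have half: "?f s > 0" if s: "0 < s" "s \<le> T / 2" for s
  proof -
    have "(?f has_real_derivative cpsi m a1 a2 (T / 2)) (at 0)"
      using cpsi_has_derivative[OF m, of 0] by simp
    then obtain d where d: "d > 0" "\<And>h. 0 < h \<Longrightarrow> h < d \<Longrightarrow> ?f (0 + h) > ?f 0"
      using DERIV_pos_inc_right[OF _ c] by blast
    define h where "h = min (d / 2) s"
    have h: "0 < h" "h < d" "h \<le> s" using d(1) s by (auto simp: h_def)
    have "0 < ?f h" using d(2)[OF h(1,2)] cpsi_0[of "Suc m"] by simp
    also have "?f h \<le> ?f s"
    proof (rule DERIV_nonneg_imp_nondecreasing[OF h(3)])
      fix x assume "h \<le> x" "x \<le> s"
      then have "0 \<le> x + T / 2" "x + T / 2 \<le> T" using h s by linarith+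
      then show "\<exists>y. (?f has_real_derivative y) (at x) \<and> 0 \<le> y"
        using cpsi_has_derivative[OF m] nn by blast
    qed
    finally show ?thesis .
  qed
  show ?thesis
  proof (cases "s \<le> T / 2")
    case True
    then show ?thesis using half s by simp
  next
    case False
    then show ?thesis using half[of "T - s"] cpsi_even_centre[of "Suc m" "s - T / 2"] s
      by (simp add: algebra_simps)
  qed
qed

lemma cpsi_pos_ge_2:
  assumes "m \<ge> 2" "0 < s" "s < T"
  shows "cpsi m a1 a2 s > 0"
  using assms
proof (induction m arbitrary: s rule: nat_induct_at_least)
  case base
  then show ?case
    using cpsi_pos_step[of 1 s] cpsi_1_nonneg cpsi_1_centre by (simp add: numeral_2_eq_2)
next
  case (Suc n)
  have "cpsi n a1 a2 0 = 0" "cpsi n a1 a2 T = 0"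
    using cpsi_0[of n] cpsi_antiperiodic[of n 0] Suc.hyps by auto
  moreover have "cpsi n a1 a2 s > 0" if "0 \<le> s" "s \<le> T" "s \<noteq> 0" "s \<noteq> T" for s
    by (rule Suc.IH) (use that in linarith)+
  ultimately have nn: "cpsi n a1 a2 s \<ge> 0" if "0 \<le> s" "s \<le> T" for s
    using that by (metis less_imp_le order_refl)
  have "cpsi n a1 a2 (T / 2) > 0"
    by (rule Suc.IH) (use T_pos in linarith)+
  then show ?case using cpsi_pos_step[OF _ nn] Suc.hyps Suc.prems by simp
qed

text \<open>At order 1 the spline has a flat zero stretch of length \<open>a1\<close> around each of
  its zeros; for \<open>a1 = 0\<close> the stretch shrinks to a point. This is why condition a)
  permits counting at order 1.\<close>

lemma cpsi_pos:
  assumes "m \<ge> 2 \<or> (a1 = 0 \<and> m = 1)" "0 < s" "s < T"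
  shows "cpsi m a1 a2 s > 0"
proof (cases "m \<ge> 2")
  case True
  then show ?thesis using cpsi_pos_ge_2 assms by simp
next
  case False
  then have m: "m = 1" "a1 = 0" using assms(1) by auto
  have "\<bar>s - T / 2\<bar> \<le> T / 2" using assms by linarith
  from cpsi_1_near_centre[OF this] have "cpsi 1 a1 a2 s = max 0 (min 1 (1 + a2 / 2 - \<bar>s - T / 2\<bar>))"
    by simp
  moreover have "1 + a2 / 2 - \<bar>s - T / 2\<bar> > 0" using assms(2,3) T_eq m(2) by linarith
  ultimately have "cpsi 1 a1 a2 s > 0" by linarith
  then show ?thesis unfolding m(1) .
qed

lemma cpsi_nonneg:
  assumes "m \<ge> 1" "0 \<le> s" "s \<le> T"
  shows "cpsi m a1 a2 s \<ge> 0"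
proof (cases "m = 1")
  case True
  then show ?thesis using cpsi_1_nonneg assms by simp
next
  case False
  have "cpsi m a1 a2 0 = 0" "cpsi m a1 a2 T = 0"
    using cpsi_0[of m] cpsi_antiperiodic[of m 0] assms by auto
  moreover have "cpsi m a1 a2 s > 0" if "s \<noteq> 0" "s \<noteq> T"
    by (rule cpsi_pos_ge_2) (use that assms False in linarith)+
  ultimately show ?thesis by (metis less_imp_le order_refl)
qed

lemma cpsi_mono:
  assumes "m \<ge> 2" "- (T / 2) \<le> s" "s \<le> s'" "s' \<le> T / 2"
  shows "cpsi m a1 a2 s \<le> cpsi m a1 a2 s'"
proof -
  define n where "n = m - 1"
  have m: "m = Suc n" "n \<ge> 1" using assms(1) unfolding n_def by linarith+
  show ?thesis unfolding m(1)
  proof (rule DERIV_nonneg_imp_nondecreasing[OF assms(3)])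
    fix x assume "s \<le> x" "x \<le> s'"
    then have "0 \<le> x + T / 2" "x + T / 2 \<le> T" using assms by linarith+
    then show "\<exists>y. (cpsi (Suc n) a1 a2 has_real_derivative y) (at x) \<and> 0 \<le> y"
      using cpsi_has_derivative[OF m(2)] cpsi_nonneg[OF m(2)] by blast
  qed
qed

text \<open>Translation by multiples of \<open>T\<close> and reflection bring the argument into the
  rising quarter period that ends at \<open>T / 2\<close>. Order 1 is read off from the trapezoid,
  the higher ones from monotonicity.\<close>

lemma cpsi_abs_le:
  assumes "m \<ge> 1"
  shows "\<bar>cpsi m a1 a2 s\<bar> \<le> cpsi m a1 a2 (T / 2)"
proof -
  define k where "k = \<lfloor>s / T\<rfloor>"
  have "of_int k \<le> s / T" "s / T < of_int k + 1" by (auto simp: k_def)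
  then have k: "T * of_int k \<le> s" "s < T * (of_int k + 1)"
    using T_pos by (auto simp: field_simps)
  define u where "u = s - (of_int k + 1 / 2) * T"
  have "u = s - T * of_int k - T / 2" "s < T * of_int k + T"
    using k(2) by (simp_all add: u_def algebra_simps)
  then have u: "\<bar>u\<bar> \<le> T / 2" using k(1) by linarith
  have "cpsi m a1 a2 s = cpsi m a1 a2 ((u + T / 2) + of_int k * T)"
    by (simp add: u_def algebra_simps)
  also have "\<dots> = (if even k then cpsi m a1 a2 (u + T / 2) else - cpsi m a1 a2 (u + T / 2))"
    by (rule antiperiodic_int) (rule cpsi_antiperiodic[OF assms])
  finally have "\<bar>cpsi m a1 a2 s\<bar> = cpsi m a1 a2 (u + T / 2)"
    using cpsi_nonneg[OF assms, of "u + T / 2"] u by (auto simp: abs_le_iff)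
  also have "\<dots> = cpsi m a1 a2 (- \<bar>u\<bar> + T / 2)"
    using cpsi_even_centre[OF assms, of u] by (auto simp: abs_if add.commute)
  also have "\<dots> \<le> cpsi m a1 a2 (T / 2)"
  proof (cases "m = 1")
    case True
    have "\<bar>- \<bar>u\<bar>\<bar> \<le> T / 2" using u by simp
    from cpsi_1_near_centre[OF this] have "cpsi 1 a1 a2 (- \<bar>u\<bar> + T / 2) \<le> 1" by linarith
    then show ?thesis unfolding True cpsi_1_centre .
  next
    case False
    then show ?thesis using assms u by (intro cpsi_mono) auto
  qed
  finally show ?thesis .
qed

lemma cpsi_centre_pos: "m \<ge> 1 \<Longrightarrow> cpsi m a1 a2 (T / 2) > 0"
proof (cases "m = 1")
  case True
  then show ?thesis by (simp only: cpsi_1_centre zero_less_one)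
next
  case False
  assume "m \<ge> 1"
  with False have "m \<ge> 2" by linarith
  then show ?thesis by (rule cpsi_pos_ge_2) (use T_pos in linarith)+
qed

end

section \<open>Sign changes\<close>

text \<open>Cyclic sign changes: \<open>\<sigma>\<close> fixes the sign at the first of \<open>N\<close> points of one period \<open>P\<close>.\<close>

definition alternates :: "real \<Rightarrow> nat \<Rightarrow> real \<Rightarrow> (real \<Rightarrow> real) \<Rightarrow> bool" where
  "alternates \<sigma> N P f \<longleftrightarrow> (\<exists>t :: nat \<Rightarrow> real. (\<forall>i<N. t i < t (Suc i)) \<and> t N = t 0 + P \<and>
     (\<forall>i\<le>N. 0 < \<sigma> * (-1) ^ i * f (t i)))"

text \<open>A cyclic form of Rolle's theorem: each of the \<open>N\<close> arcs between neighbouring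
  points yields a mean value with the sign of the increment, which explains
  \<open>- \<sigma>\<close>.\<close>

lemma alternates_deriv:
  assumes f: "\<And>t. (f has_real_derivative f' t) (at t)"
    and per: "\<And>t. f' (t + P) = f' t" and N: "even N" "N > 0" and alt: "alternates \<sigma> N P f"
  shows "alternates (- \<sigma>) N P f'"
proof -
  obtain t where t: "\<And>i. i < N \<Longrightarrow> t i < t (Suc i)" "t N = t 0 + P"
    "\<And>i. i \<le> N \<Longrightarrow> 0 < \<sigma> * (-1) ^ i * f (t i)"
    using alt unfolding alternates_def by blast
  have "\<exists>s. t i < s \<and> s < t (Suc i) \<and> 0 < - \<sigma> * (-1) ^ i * f' s" if i: "i < N" for i
  proof -
    obtain s where s: "t i < s" "s < t (Suc i)" "f (t (Suc i)) - f (t i) = (t (Suc i) - t i) * f' s"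
      using MVT2[OF t(1)[OF i], of f f'] f by blast
    define c where "c = - \<sigma> * (-1) ^ i"
    have "0 < - c * f (t i)" "0 < c * f (t (Suc i))"
      using t(3)[of i] t(3)[of "Suc i"] i by (simp_all add: c_def)
    then have "0 < c * (f (t (Suc i)) - f (t i))" by (simp add: right_diff_distrib)
    also have "\<dots> = (t (Suc i) - t i) * (c * f' s)" using s(3) by simp
    finally have "0 < c * f' s" using t(1)[OF i] by (simp add: zero_less_mult_iff)
    then show ?thesis using s unfolding c_def by blast
  qed
  then obtain s where s: "\<And>i. i < N \<Longrightarrow> t i < s i" "\<And>i. i < N \<Longrightarrow> s i < t (Suc i)"
    "\<And>i. i < N \<Longrightarrow> 0 < - \<sigma> * (-1) ^ i * f' (s i)" by metis
  \<comment> \<open>The list is closed by the first mean value point shifted by \<open>P\<close>;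
    since \<open>N\<close> is even, the sign required at the end agrees with the one at the
    start.\<close>
  define s' where "s' i = (if i < N then s i else s 0 + P)" for i
  have "s' i < s' (Suc i)" if "i < N" for i
  proof (cases "Suc i < N")
    case True
    then show ?thesis using s(2)[of i] s(1)[of "Suc i"] by (simp add: s'_def)
  next
    case False
    then have "Suc i = N" using that by simp
    then show ?thesis using s(2)[of i] s(1)[of 0] t(2) N by (simp add: s'_def)
  qed
  moreover have "s' N = s' 0 + P" using N by (simp add: s'_def)
  moreover have "0 < - \<sigma> * (-1) ^ i * f' (s' i)" if "i \<le> N" for i
    using that s(3)[of i] s(3)[of 0] N per by (cases "i < N") (auto simp: s'_def)
  ultimately show ?thesis unfolding alternates_def by blast
qed

text \<open>A one-sided form of single crossing on the rising branch, for all translates of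
  \<open>f\<close>. The weak inequality in the conclusion allows contact. Falling branches are
  covered by the same property of \<open>- f\<close>, because \<open>q\<close> is
  antiperiodic.\<close>

definition branch_crossing :: "real \<Rightarrow> (real \<Rightarrow> real) \<Rightarrow> (real \<Rightarrow> real) \<Rightarrow> bool" where
  "branch_crossing T q f \<longleftrightarrow> (\<forall>c s s'. - (T / 2) \<le> s \<longrightarrow> s < s' \<longrightarrow> s' \<le> T / 2 \<longrightarrow>
     0 < q s - f (s + c) \<longrightarrow> 0 \<le> q s' - f (s' + c))"

text \<open>The branch number \<open>\<mu>\<close> rises by at least one at each of the
  \<open>2 * n + 2\<close> sign changes, but a shift by the whole period raises it by exactly
  \<open>2 * n\<close>.\<close>

lemma not_alternates_if_branch_crossing:
  assumes T: "T > 0" and anti: "\<And>t. q (t + T) = - q t"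
    and f: "\<And>t. f (t + 2 * real n * T) = f t"
    and cross: "branch_crossing T q f" "branch_crossing T q (\<lambda>t. - f t)"
  shows "\<not> alternates \<sigma> (2 * n + 2) (2 * real n * T) (\<lambda>t. q (t + c) - f t)"
proof
  note q = antiperiodic_int[of q T, OF anti]
  let ?N = "2 * n + 2" and ?P = "2 * real n * T"
  define D where "D t = q (t + c) - f t" for t
  assume "alternates \<sigma> ?N ?P (\<lambda>t. q (t + c) - f t)"
  then obtain t where t: "\<And>i. i < ?N \<Longrightarrow> t i < t (Suc i)" "t ?N = t 0 + ?P"
    "\<And>i. i \<le> ?N \<Longrightarrow> 0 < \<sigma> * (-1) ^ i * D (t i)"
    unfolding alternates_def D_def by blast
  define k where "k t = \<lfloor>(t + c) / T + 1 / 2\<rfloor>" for t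
  \<comment> \<open>\<open>k t\<close> is the branch of \<open>t\<close>; the correction gives \<open>\<mu> t\<close> the parity of the sign of \<open>D t\<close>
    and, by single crossing, keeps \<open>\<mu>\<close> monotone, so that every sign change increases it.\<close>
  define \<mu> where "\<mu> t = (if (D t > 0) = even (k t) then k t else k t - 1)" for t
  have mono_k: "k u \<le> k v" if "u \<le> v" for u v
    unfolding k_def using that T by (intro floor_mono) (simp add: divide_right_mono)
  have mono: "\<mu> u \<le> \<mu> v" if uv: "u < v" "D u \<noteq> 0" "D v \<noteq> 0" for u v
  proof (cases "k u = k v")
    case False
    then show ?thesis using mono_k[of u v] uv by (auto simp: \<mu>_def)
  next
    case True
    define j where "j = k u"
    have range: "- (T / 2) \<le> w + c - of_int j * T" "w + c - of_int j * T \<le> T / 2" if "k w = j" for w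
    proof -
      have "of_int j \<le> (w + c) / T + 1 / 2" "(w + c) / T + 1 / 2 < of_int j + 1"
        using that unfolding k_def by linarith+
      then have "of_int j * T \<le> ((w + c) / T + 1 / 2) * T" "((w + c) / T + 1 / 2) * T < (of_int j + 1) * T"
        using T by (auto intro: mult_right_mono mult_strict_right_mono)
      moreover have "((w + c) / T + 1 / 2) * T = w + c + T / 2" using T by (simp add: field_simps)
      ultimately show "- (T / 2) \<le> w + c - of_int j * T" "w + c - of_int j * T \<le> T / 2"
        by (auto simp: algebra_simps)
    qed
    define s where "s w = w + c - of_int j * T" for w
    \<comment> \<open>Moving to the central branch replaces \<open>q\<close> by \<open>- q\<close>
      when \<open>j\<close> is odd, so the difference becomes minus the difference of
      \<open>q\<close> and \<open>- f\<close>.\<close>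
    have D: "D w = (if even j then q (s w) - f (s w + (of_int j * T - c))
        else - (q (s w) - (- f (s w + (of_int j * T - c)))))" for w
      using q[of "s w" j] by (auto simp: D_def s_def)
    have ku: "k u = j" "k v = j" using True by (simp_all add: j_def)
    have "0 \<le> D v" if "even j" "D u > 0"
    proof -
      have "0 < q (s u) - f (s u + (of_int j * T - c))" using that D[of u] by simp
      then have "0 \<le> q (s v) - f (s v + (of_int j * T - c))"
        using cross(1)[unfolded branch_crossing_def, rule_format, of "s u" "s v" "of_int j * T - c"]
          range[OF ku(1)] range[OF ku(2)] uv(1) by (simp add: s_def)
      then show ?thesis using that D[of v] by simp
    qed
    moreover have "D v \<le> 0" if "odd j" "D u < 0"
    proof -
      have "0 < q (s u) - (- f (s u + (of_int j * T - c)))" using that D[of u] by simp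
      then have "0 \<le> q (s v) - (- f (s v + (of_int j * T - c)))"
        using cross(2)[unfolded branch_crossing_def, rule_format, of "s u" "s v" "of_int j * T - c"]
          range[OF ku(1)] range[OF ku(2)] uv(1) by (simp add: s_def)
      then show ?thesis using that D[of v] by simp
    qed
    ultimately show ?thesis using uv ku by (auto simp: \<mu>_def)
  qed
  have parity: "even (\<mu> u) \<longleftrightarrow> D u > 0" for u by (auto simp: \<mu>_def)
  have neq: "D (t i) \<noteq> 0" if "i \<le> ?N" for i using t(3)[OF that] by auto
  have "\<mu> (t 0) + int i \<le> \<mu> (t i)" if "i \<le> ?N" for i
    using that
  proof (induction i)
    case 0
    then show ?case by simp
  next
    case (Suc i)
    then have i: "i < ?N" by simp
    have "\<mu> (t i) \<le> \<mu> (t (Suc i))" using mono t(1)[OF i] neq i by simp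
    moreover have "D (t i) > 0 \<longleftrightarrow> \<not> D (t (Suc i)) > 0"
    proof -
      define a where "a = \<sigma> * (-1) ^ i"
      have "0 < a * D (t i)" "0 < - a * D (t (Suc i))"
        using t(3)[of i] t(3)[of "Suc i"] i by (simp_all add: a_def)
      then show ?thesis by (auto simp: zero_less_mult_iff mult_less_0_iff)
    qed
    then have "\<mu> (t i) \<noteq> \<mu> (t (Suc i))" using parity by metis
    ultimately show ?case using Suc by simp
  qed
  then have "\<mu> (t 0) + int ?N \<le> \<mu> (t 0 + ?P)" using t(2) by (metis order_refl)
  moreover have "\<mu> (u + ?P) = \<mu> u + 2 * int n" for u
  proof -
    have "(u + ?P + c) / T + 1 / 2 = ((u + c) / T + 1 / 2) + of_int (2 * int n)"
      using T by (simp add: field_simps)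
    then have k: "k (u + ?P) = k u + 2 * int n" unfolding k_def by (simp only: floor_add_int)
    have "q (u + c + of_int (2 * int n) * T) = q (u + c)" by (subst q) simp
    then have "D (u + ?P) = D u" using f[of u] by (simp add: D_def algebra_simps)
    then show ?thesis using k by (simp add: \<mu>_def)
  qed
  ultimately show False by simp
qed

text \<open>Translate \<open>q\<close> to meet \<open>f\<close> at \<open>\<xi>\<close>. At the ends
  of branches \<open>q\<close> has its extreme values and dominates \<open>f\<close>, which gives
  one sign change per branch. On the branch through \<open>\<xi>\<close> the steeper
  \<open>f\<close> makes the difference pass from positive to negative, against the signs at the
  ends of that branch, and so adds two changes.\<close>

lemma alternates_if_steeper:
  assumes T: "T > 0" and n: "n > 0" and q: "\<And>t. q (t + T) = - q t" and qodd: "\<And>t. q (- t) = - q t"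
    and q': "\<And>t. (q has_real_derivative q' t) (at t)" and f': "\<And>t. (f has_real_derivative f' t) (at t)"
    and bd: "\<And>t. \<bar>f t\<bar> < q (T / 2)"
    and \<eta>: "- (T / 2) < \<eta>" "\<eta> < T / 2" "f \<xi> = q \<eta>" and steep: "f' \<xi> > q' \<eta>"
  shows "alternates (-1) (2 * n + 2) (2 * real n * T) (\<lambda>t. q (t + (\<eta> - \<xi>)) - f t)"
proof -
  define c where "c = \<eta> - \<xi>"
  define D where "D t = q (t + c) - f t" for t
  have "((\<lambda>t. q (t + c)) has_real_derivative q' (\<xi> + c)) (at \<xi>)"
    using q' DERIV_shift[of q "q' (\<xi> + c)" \<xi> c] by simp
  then have D': "(D has_real_derivative q' \<eta> - f' \<xi>) (at \<xi>)"
    using DERIV_diff[OF _ f', of "\<lambda>t. q (t + c)" "q' (\<xi> + c)" \<xi>] by (simp add: D_def[abs_def] c_def)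
  have D0: "D \<xi> = 0" using \<eta>(3) by (simp add: D_def c_def)
  have neg: "q' \<eta> - f' \<xi> < 0" using steep by simp
  obtain d1 where d1: "d1 > 0" "\<And>h. 0 < h \<Longrightarrow> h < d1 \<Longrightarrow> D \<xi> > D (\<xi> + h)"
    using DERIV_neg_dec_right[OF D' neg] by blast
  obtain d2 where d2: "d2 > 0" "\<And>h. 0 < h \<Longrightarrow> h < d2 \<Longrightarrow> D \<xi> < D (\<xi> - h)"
    using DERIV_neg_dec_left[OF D' neg] by blast
  \<comment> \<open>Small enough for the signs next to \<open>\<xi>\<close> and for both
    \<open>\<xi> - h\<close> and \<open>\<xi> + h\<close> to stay inside the branch.\<close>
  define h where "h = min (min d1 d2) (min (\<eta> + T / 2) (T / 2 - \<eta>)) / 2"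
  have h: "0 < h" "h < d1" "h < d2" "h < \<eta> + T / 2" "h < T / 2 - \<eta>"
    using d1(1) d2(1) \<eta> by (auto simp: h_def min_def)
  \<comment> \<open>The left end of the branch, the two points around \<open>\<xi>\<close>, then the
    right ends of this and the following branches. From index 3 on, index \<open>i\<close> belongs
    to the end with number \<open>i - 2\<close>.\<close>
  define t :: "nat \<Rightarrow> real" where
    "t i = (if i = 0 then - (T / 2) - c else if i = 1 then \<xi> - h else if i = 2 then \<xi> + h
       else (real i - 2) * T - T / 2 - c)" for i
  have q_end: "q (real j * T - T / 2) = (-1) ^ Suc j * q (T / 2)" for j
    using antiperiodic_int[of q T "- (T / 2)" "int j", OF q] qodd[of "T / 2"] by (simp add: algebra_simps)
  have D_end: "0 < (-1) ^ Suc j * D (real j * T - T / 2 - c)" for j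
  proof -
    have "(-1) ^ Suc j * D (real j * T - T / 2 - c) = q (T / 2) - (-1) ^ Suc j * f (real j * T - T / 2 - c)"
      using q_end[of j] by (simp add: D_def algebra_simps flip: power_add mult.assoc)
    moreover have "\<bar>(-1) ^ Suc j * f (real j * T - T / 2 - c)\<bar> < q (T / 2)"
      using bd[of "real j * T - T / 2 - c"] by (simp add: abs_mult)
    ultimately show ?thesis by linarith
  qed
  have "t i < t (Suc i)" for i
  proof -
    consider "i = 0" | "i = 1" | "i = 2" | "i \<ge> 3" by linarith
    then show ?thesis
    proof cases
      case 4
      then show ?thesis using T by (simp add: t_def algebra_simps)
    qed (use h T in \<open>simp_all add: t_def c_def\<close>)
  qed
  moreover have "t (2 * n + 2) = t 0 + 2 * real n * T"
    using n by (simp add: t_def)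
  moreover have "0 < (-1) * (-1) ^ i * D (t i)" for i
  proof -
    consider "i = 0" | "i = 1" | "i = 2" | "i \<ge> 3" by linarith
    then show ?thesis
    proof cases
      case 1
      then show ?thesis using D_end[of 0] by (simp add: t_def)
    next
      case 2
      then show ?thesis using d2(2)[OF h(1,3)] D0 by (simp add: t_def)
    next
      case 3
      then show ?thesis using d1(2)[OF h(1,2)] D0 by (simp add: t_def)
    next
      case 4
      then obtain j where j: "i = j + 2" "j > 0" by (metis le_Suc_ex numeral_3_eq_3 add_2_eq_Suc' less_Suc_eq_0_disj add_Suc)
      then show ?thesis using D_end[of j] by (simp add: t_def)
    qed
  qed
  ultimately show ?thesis
    unfolding alternates_def D_def c_def by (intro exI[of _ t]) simp
qed

section \<open>Integrals over humps\<close>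

text \<open>The derivative of \<open>R \<circ> \<tau>\<close> is \<open>h (f t) * \<tau>' t\<close>,
  whose modulus is at most \<open>- h (f t)\<close>. Hence \<open>S\<close> falls at least as fast
  as \<open>R \<circ> \<tau>\<close> changes in either direction.\<close>

lemma time_change_increment_le:
  fixes h q f R S \<tau> :: "real \<Rightarrow> real"
  assumes R: "\<And>s. (R has_real_derivative h (q s)) (at s)"
    and S: "\<And>t. (S has_real_derivative h (f t)) (at t)"
    and \<tau>: "\<And>t. (\<tau> has_real_derivative \<tau>' t) (at t)" "\<And>t. \<bar>\<tau>' t\<bar> \<le> 1" "\<And>t. f t = q (\<tau> t)"
    and h: "\<And>t. u \<le> t \<Longrightarrow> t \<le> v \<Longrightarrow> h (f t) \<le> 0" and uv: "u \<le> v"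
  shows "S v - S u \<le> R (\<tau> v) - R (\<tau> u)" "S v - S u \<le> R (\<tau> u) - R (\<tau> v)"
proof -
  have R\<tau>: "((\<lambda>t. R (\<tau> t)) has_real_derivative h (f t) * \<tau>' t) (at t)" for t
    using DERIV_chain2[OF R \<tau>(1)] by (simp add: \<tau>(3))
  have abs: "\<bar>h (f t) * \<tau>' t\<bar> \<le> - h (f t)" if "u \<le> t" "t \<le> v" for t
    using h[OF that] \<tau>(2)[of t] mult_left_mono[of "\<bar>\<tau>' t\<bar>" 1 "\<bar>h (f t)\<bar>"] by (simp add: abs_mult)
  have "R (\<tau> u) - S u \<le> R (\<tau> v) - S v"
  proof (rule DERIV_nonneg_imp_nondecreasing[OF uv])
    fix t assume "u \<le> t" "t \<le> v"
    then have "0 \<le> h (f t) * \<tau>' t - h (f t)" using abs[of t] by linarith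
    then show "\<exists>y. ((\<lambda>t. R (\<tau> t) - S t) has_real_derivative y) (at t) \<and> 0 \<le> y"
      using DERIV_diff[OF R\<tau> S] by blast
  qed
  then show "S v - S u \<le> R (\<tau> v) - R (\<tau> u)" by linarith
  have "R (\<tau> u) + S u \<ge> R (\<tau> v) + S v"
  proof (rule DERIV_nonpos_imp_nonincreasing[OF uv])
    fix t assume "u \<le> t" "t \<le> v"
    then have "h (f t) * \<tau>' t + h (f t) \<le> 0" using abs[of t] by linarith
    then show "\<exists>y. ((\<lambda>t. R (\<tau> t) + S t) has_real_derivative y) (at t) \<and> y \<le> 0"
      using DERIV_add[OF R\<tau> S] by blast
  qed
  then show "S v - S u \<le> R (\<tau> u) - R (\<tau> v)" by linarith
qed

text \<open>The factor of \<open>\<beta> - \<alpha>\<close> is the mean of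
  \<open>\<bar>q\<bar> powr p\<close> over a quarter period, so bounds for single humps add up to a
  bound for a full period. A hump of length at most \<open>T\<close> is compared by its height; on a
  longer one the area bound \<open>F_le\<close> supplies the missing control.\<close>

lemma hump_powr_le:
  fixes q f A B F V \<tau> :: "real \<Rightarrow> real"
  assumes p: "p \<ge> 1" and T: "T > 0"
    and q: "strict_mono_on {- (T / 2)..T / 2} q" "q 0 = 0"
    and \<tau>: "\<And>t. (\<tau> has_real_derivative \<tau>' t) (at t)" "\<And>t. \<bar>\<tau>' t\<bar> \<le> 1" "\<And>t. f t = q (\<tau> t)"
      "\<And>t. \<bar>\<tau> t\<bar> \<le> T / 2"
    and f: "continuous_on {\<alpha>..\<beta>} f"
    and A: "\<And>s. (A has_real_derivative \<bar>q s\<bar> powr p) (at s)"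
    and B: "\<And>s. (B has_real_derivative q s) (at s)"
    and V: "\<And>t. (V has_real_derivative \<bar>f t\<bar> powr p) (at t)"
    and F: "\<And>t. (F has_real_derivative f t) (at t)"
    and F_le: "F \<beta> - F \<alpha> \<le> 2 * (B (T / 2) - B 0)"
    and hump: "\<alpha> < \<beta>" "f \<alpha> = 0" "f \<beta> = 0" "\<And>t. \<alpha> < t \<Longrightarrow> t < \<beta> \<Longrightarrow> 0 < f t"
  shows "V \<beta> - V \<alpha> \<le> (\<beta> - \<alpha>) * (2 / T * (A (T / 2) - A 0))"
proof -
  obtain t1 where t1: "t1 \<in> {\<alpha>..\<beta>}" "\<And>t. t \<in> {\<alpha>..\<beta>} \<Longrightarrow> f t \<le> f t1"
    using continuous_attains_sup[of "{\<alpha>..\<beta>}" f] f hump(1) by auto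
  define M where "M = f t1"
  define s0 where "s0 = \<tau> t1"
  have "0 < f ((\<alpha> + \<beta>) / 2)" using hump(1) by (intro hump(4)) auto
  also have "\<dots> \<le> M" unfolding M_def using hump(1) by (intro t1(2)) auto
  finally have M: "M > 0" .
  have q_less: "q s < q s'" if "- (T / 2) \<le> s" "s < s'" "s' \<le> T / 2" for s s'
    using q(1) that by (auto simp: strict_mono_on_def)
  have q_le: "q s \<le> q s'" if "- (T / 2) \<le> s" "s \<le> s'" "s' \<le> T / 2" for s s'
    using q_less[of s s'] that by (cases "s = s'") auto
  have zero: "\<tau> t = 0" if "f t = 0" for t
    using q_less[of "\<tau> t" 0] q_less[of 0 "\<tau> t"] \<tau>(3)[of t] \<tau>(4)[of t] q(2) that T
    by (cases "\<tau> t" "0::real" rule: linorder_cases) auto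
  have s0: "0 < s0" "s0 \<le> T / 2"
  proof -
    show "s0 \<le> T / 2" using \<tau>(4)[of t1] unfolding s0_def by linarith
    have "\<not> s0 \<le> 0"
      using q_le[of s0 0] \<tau>(4)[of t1] \<tau>(3)[of t1] M T q(2) by (auto simp: s0_def M_def abs_le_iff)
    then show "0 < s0" by simp
  qed
  have qs0: "q s0 = M" by (simp add: s0_def M_def \<tau>(3))
  have f_range: "0 \<le> f t" "f t \<le> M" if "\<alpha> \<le> t" "t \<le> \<beta>" for t
  proof -
    show "0 \<le> f t" using hump(2,3) hump(4)[of t] that by (cases "t = \<alpha> \<or> t = \<beta>") auto
    show "f t \<le> M" unfolding M_def by (rule t1(2)) (use that in simp)
  qed
  have q_low: "0 \<le> q s" "q s \<le> M" if "0 \<le> s" "s \<le> s0" for s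
    using q_le[of 0 s] q_le[of s s0] that s0 T q(2) qs0 by auto
  have q_high: "M \<le> q s" if "s0 \<le> s" "s \<le> T / 2" for s
    using q_le[of s0 s] that s0 T qs0 by auto
  \<comment> \<open>The hump is cut at its peak \<open>t1\<close>. The rising and the falling part
    are each compared with the arc of \<open>q\<close> from \<open>0\<close> to \<open>s0\<close>,
    which produces the factor 2.\<close>
  have incr: "S \<beta> - S \<alpha> \<le> 2 * (R s0 - R 0)"
    if "\<And>s. (R has_real_derivative h (q s)) (at s)" "\<And>t. (S has_real_derivative h (f t)) (at t)"
      "\<And>y. 0 \<le> y \<Longrightarrow> y \<le> M \<Longrightarrow> h y \<le> 0" for R S h
  proof -
    have "S t1 - S \<alpha> \<le> R (\<tau> t1) - R (\<tau> \<alpha>)"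
      using t1(1) f_range that(3)
      by (intro time_change_increment_le(1)[OF that(1,2) \<tau>(1-3)]) auto
    moreover have "S \<beta> - S t1 \<le> R (\<tau> t1) - R (\<tau> \<beta>)"
      using t1(1) f_range that(3)
      by (intro time_change_increment_le(2)[OF that(1,2) \<tau>(1-3)]) auto
    ultimately show ?thesis using zero hump(2,3) by (simp add: s0_def)
  qed
  define L where "L = \<beta> - \<alpha>"
  define X where "X = A (T / 2) - A 0"
  have "A 0 \<le> A (T / 2)"
  proof (rule DERIV_nonneg_imp_nondecreasing[of 0 "T / 2" A])
    show "\<exists>y. (A has_real_derivative y) (at s) \<and> 0 \<le> y" for s using A[of s] powr_ge_zero by blast
  qed (use T in simp)
  then have X: "X \<ge> 0" by (simp add: X_def)
  have "V \<beta> - V \<alpha> \<le> L * (2 / T * X)"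
  proof (cases "L \<le> T")
    case True
    \<comment> \<open>Subtracting the peak value makes the integrand nonpositive below the peak
      height and nonnegative above it. The latter bounds the part of the spline beyond
      \<open>s0\<close> from below.\<close>
    define c where "c = M powr p"
    have A_c: "((\<lambda>s. A s - c * s) has_real_derivative \<bar>q s\<bar> powr p - c) (at s)" for s
      by (auto intro!: derivative_eq_intros A)
    have V_c: "((\<lambda>t. V t - c * t) has_real_derivative \<bar>f t\<bar> powr p - c) (at t)" for t
      by (auto intro!: derivative_eq_intros V)
    have "(V \<beta> - c * \<beta>) - (V \<alpha> - c * \<alpha>) \<le> 2 * ((A s0 - c * s0) - (A 0 - c * 0))"
      using p by (intro incr[OF A_c V_c]) (auto simp: c_def intro!: powr_mono2)
    moreover have "A s0 - c * s0 \<le> A 0 - c * 0"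
    proof (rule DERIV_nonpos_imp_nonincreasing[of 0 s0])
      fix s assume "0 \<le> s" "s \<le> s0"
      then have "\<bar>q s\<bar> powr p - c \<le> 0" using q_low[of s] p by (auto simp: c_def intro!: powr_mono2)
      then show "\<exists>y. ((\<lambda>s. A s - c * s) has_real_derivative y) (at s) \<and> y \<le> 0" using A_c by blast
    qed (use s0 in simp)
    moreover have "A s0 - c * s0 \<le> A (T / 2) - c * (T / 2)"
    proof (rule DERIV_nonneg_imp_nondecreasing[OF s0(2)])
      fix s assume "s0 \<le> s" "s \<le> T / 2"
      then have "0 \<le> \<bar>q s\<bar> powr p - c" using q_high[of s] p M by (auto simp: c_def intro!: powr_mono2)
      then show "\<exists>y. ((\<lambda>s. A s - c * s) has_real_derivative y) (at s) \<and> 0 \<le> y" using A_c by blast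
    qed
    moreover define J where "J = A s0 - A 0 - c * s0"
    ultimately have J: "V \<beta> - V \<alpha> \<le> c * L + 2 * J" "J \<le> 0" "J + c * (T / 2) \<le> X"
      by (simp_all add: L_def X_def algebra_simps)
    \<comment> \<open>\<open>J\<close> is the nonpositive integral of the reduced power over the arc
      up to \<open>s0\<close>; per unit of length its negative contribution weighs more on the
      shorter hump.\<close>
    have "(c * L + 2 * J) * T \<le> L * (2 * (J + c * (T / 2)))"
    proof -
      have "L * (2 * (J + c * (T / 2))) - (c * L + 2 * J) * T = 2 * (J * (L - T))"
        by (simp add: algebra_simps)
      also have "\<dots> \<ge> 0" using J(2) True by (simp add: mult_nonpos_nonpos)
      finally show ?thesis by simp
    qed
    also have "\<dots> \<le> L * (2 * X)" using J(3) hump(1) by (intro mult_left_mono) (auto simp: L_def)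
    finally have "c * L + 2 * J \<le> L * (2 * X) / T" using T by (simp add: pos_le_divide_eq)
    then show ?thesis using J(1) by simp
  next
    case False
    \<comment> \<open>With this slope \<open>y powr p - K * y\<close> changes sign exactly at the
      peak height. The linear part is paid by \<open>F_le\<close>, giving the integral over a whole
      hump of the spline, and \<open>L > T\<close> then allows the factor
      \<open>L / T\<close>.\<close>
    define K where "K = M powr (p - 1)"
    have K0: "K \<ge> 0" by (simp add: K_def)
    have powr_split: "\<bar>y\<bar> powr p = y * y powr (p - 1)" if "y \<ge> 0" for y :: real
      using that by (cases "y = 0") (auto simp: powr_mult_base)
    have A_K: "((\<lambda>s. A s - K * B s) has_real_derivative \<bar>q s\<bar> powr p - K * q s) (at s)" for s
      by (auto intro!: derivative_eq_intros A B)
    have V_K: "((\<lambda>t. V t - K * F t) has_real_derivative \<bar>f t\<bar> powr p - K * f t) (at t)" for t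
      by (auto intro!: derivative_eq_intros V F)
    have low: "\<bar>y\<bar> powr p - K * y \<le> 0" if "0 \<le> y" "y \<le> M" for y
    proof -
      have "y * y powr (p - 1) \<le> y * K"
        using that p unfolding K_def by (intro mult_left_mono powr_mono2) auto
      then show ?thesis using powr_split[OF that(1)] by (simp add: mult.commute)
    qed
    have high: "0 \<le> \<bar>y\<bar> powr p - K * y" if "M \<le> y" for y
    proof -
      have "y * K \<le> y * y powr (p - 1)"
        using that p M unfolding K_def by (intro mult_left_mono powr_mono2) auto
      then show ?thesis using powr_split[of y] that M by (simp add: mult.commute)
    qed
    have "(V \<beta> - K * F \<beta>) - (V \<alpha> - K * F \<alpha>) \<le> 2 * ((A s0 - K * B s0) - (A 0 - K * B 0))"
      by (rule incr[OF A_K V_K low])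
    moreover have "A s0 - K * B s0 \<le> A (T / 2) - K * B (T / 2)"
    proof (rule DERIV_nonneg_imp_nondecreasing[OF s0(2)])
      fix s assume "s0 \<le> s" "s \<le> T / 2"
      then have "0 \<le> \<bar>q s\<bar> powr p - K * q s" using q_high[of s] high by blast
      then show "\<exists>y. ((\<lambda>s. A s - K * B s) has_real_derivative y) (at s) \<and> 0 \<le> y" using A_K by blast
    qed
    moreover have "K * (F \<beta> - F \<alpha>) \<le> K * (2 * (B (T / 2) - B 0))"
      using F_le K0 by (rule mult_left_mono)
    ultimately have "V \<beta> - V \<alpha> \<le> 2 * X" by (simp add: X_def algebra_simps)
    also have "\<dots> \<le> (L / T) * (2 * X)" using False T X by (simp add: field_simps mult_right_mono)
    finally show ?thesis by simp
  qed
  then show ?thesis by (simp add: L_def X_def)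
qed

text \<open>The zeros of the function may be infinitely many, so humps cannot be summed one after
  another. Instead one moves to the right within the closed set: its points carry a nonpositive
  derivative, and jumps across gaps do not raise \<open>W\<close>.\<close>

lemma nonincreasing_across_gaps:
  fixes W w :: "real \<Rightarrow> real"
  assumes W: "\<And>t. (W has_real_derivative w t) (at t)" and Z: "closed Z" "a \<in> Z" "b \<in> Z" "a \<le> b"
    and w: "\<And>t. t \<in> Z \<Longrightarrow> w t \<le> 0"
    and gap: "\<And>u v. u \<in> Z \<Longrightarrow> v \<in> Z \<Longrightarrow> u < v \<Longrightarrow> (\<And>t. u < t \<Longrightarrow> t < v \<Longrightarrow> t \<notin> Z) \<Longrightarrow> W v \<le> W u"
  shows "W b \<le> W a"
proof -
  have eps: "W b \<le> W a + e * (b - a)" if e: "e > 0" for e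
  proof -
    \<comment> \<open>The tilt makes the derivative strictly negative on \<open>Z\<close>, so that
      \<open>E\<close> decreases immediately to the right of each of its points.\<close>
    define E where "E t = W t - e * t" for t
    have E': "(E has_real_derivative w t - e) (at t)" for t
      unfolding E_def[abs_def] by (auto intro!: derivative_eq_intros W)
    define S where "S = Z \<inter> {a..b} \<inter> {t. E t \<le> E a}"
    have "continuous_on UNIV E" using E' by (meson DERIV_isCont continuous_at_imp_continuous_on)
    then have "closed {t. E t \<le> E a}" by (intro closed_Collect_le continuous_intros)
    then have cS: "compact S" unfolding S_def using Z(1) by (intro closed_Int_compact compact_Int_closed) auto
    have aS: "a \<in> S" using Z by (simp add: S_def)
    obtain z where z: "z \<in> S" "\<And>t. t \<in> S \<Longrightarrow> t \<le> z" using compact_attains_sup[OF cS] aS by blast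
    have "z = b"
    proof (rule ccontr)
      assume "z \<noteq> b"
      then have zb: "z < b" "z \<in> Z" "a \<le> z" "E z \<le> E a" using z(1) by (auto simp: S_def)
      have "w z - e < 0" using w[OF zb(2)] e by simp
      then obtain d where d: "d > 0" "\<And>h. 0 < h \<Longrightarrow> h < d \<Longrightarrow> E z > E (z + h)"
        using DERIV_neg_dec_right[OF E'] by blast
      \<comment> \<open>A point of \<open>Z\<close> nearer than \<open>d\<close> would lie in
        \<open>S\<close>, against the maximality of \<open>z\<close>. So \<open>z\<close> is the
        left end of a gap, whose right end \<open>v\<close> is the first point of
        \<open>G\<close>.\<close>
      have far: "z + d \<le> t" if "t \<in> Z" "z < t" "t \<le> b" for t
      proof (rule ccontr)
        assume "\<not> z + d \<le> t"
        then have "E t \<le> E a" using d(2)[of "t - z"] that zb by simp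
        then have "t \<in> S" using that zb by (simp add: S_def)
        then show False using z(2) that by fastforce
      qed
      define G where "G = Z \<inter> {z + d..b}"
      have "compact G" unfolding G_def using Z(1) by (intro closed_Int_compact) auto
      moreover have "b \<in> G" using far[OF Z(3)] zb Z(3) by (simp add: G_def)
      ultimately obtain v where v: "v \<in> G" "\<And>t. t \<in> G \<Longrightarrow> v \<le> t"
        using compact_attains_inf[of G] by blast
      have vz: "v \<in> Z" "z < v" "v \<le> b" using v(1) d(1) by (auto simp: G_def)
      have "t \<notin> Z" if "z < t" "t < v" for t
      proof
        assume "t \<in> Z"
        then have "t \<in> G" using far[of t] that vz by (simp add: G_def)
        then show False using v(2) that by fastforce
      qed
      then have "W v \<le> W z" using gap zb(2) vz by blast
      moreover have "e * z < e * v" using vz e by simp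
      ultimately have "E v \<le> E a" using zb(4) by (simp add: E_def)
      then have "v \<in> S" using vz zb by (simp add: S_def)
      then show False using z(2) vz by fastforce
    qed
    then have "E b \<le> E a" using z(1) by (simp add: S_def)
    then show ?thesis by (simp add: E_def algebra_simps)
  qed
  show ?thesis
  proof (rule field_le_epsilon)
    fix \<epsilon> :: real assume \<epsilon>: "\<epsilon> > 0"
    have "W b \<le> W a + \<epsilon> / (b - a + 1) * (b - a)" using \<epsilon> Z(4) by (intro eps) simp
    also have "\<epsilon> / (b - a + 1) * (b - a) \<le> \<epsilon>" using \<epsilon> Z(4) by (simp add: field_simps)
    finally show "W b \<le> W a + \<epsilon>" by simp
  qed
qed

text \<open>The tilted integral \<open>W\<close> has derivative \<open>- C\<close> at zeros of
  \<open>f\<close>, and the hump estimate shows that it does not rise between neighbouring zeros.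
  Negative humps are reflected, which the oddness of \<open>q\<close> permits.\<close>

lemma period_powr_le:
  fixes q f A B F V \<tau> :: "real \<Rightarrow> real"
  assumes p: "p \<ge> 1" and T: "T > 0"
    and q: "strict_mono_on {- (T / 2)..T / 2} q" "\<And>s. q (- s) = - q s"
    and \<tau>: "\<And>t. (\<tau> has_real_derivative \<tau>' t) (at t)" "\<And>t. \<bar>\<tau>' t\<bar> \<le> 1" "\<And>t. f t = q (\<tau> t)"
      "\<And>t. \<bar>\<tau> t\<bar> \<le> T / 2"
    and f: "continuous_on UNIV f"
    and A: "\<And>s. (A has_real_derivative \<bar>q s\<bar> powr p) (at s)"
    and B: "\<And>s. (B has_real_derivative q s) (at s)"
    and V: "\<And>t. (V has_real_derivative \<bar>f t\<bar> powr p) (at t)"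
    and F: "\<And>t. (F has_real_derivative f t) (at t)"
    and F_le: "\<And>u v. F v - F u \<le> 2 * (B (T / 2) - B 0)"
    and P: "P > 0" "\<And>t. f (t + P) = f t" "\<And>t. F (t + P) = F t"
  shows "V P - V 0 \<le> P * (2 / T * (A (T / 2) - A 0))"
proof -
  define C where "C = 2 / T * (A (T / 2) - A 0)"
  have "A 0 \<le> A (T / 2)"
  proof (rule DERIV_nonneg_imp_nondecreasing[of 0 "T / 2" A])
    show "\<exists>y. (A has_real_derivative y) (at s) \<and> 0 \<le> y" for s using A[of s] powr_ge_zero by blast
  qed (use T in simp)
  then have C: "C \<ge> 0" using T by (simp add: C_def)
  have q0: "q 0 = 0" using q(2)[of 0] by simp
  have contf: "continuous_on S f" for S using f by (rule continuous_on_subset) simp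
  \<comment> \<open>The periodic primitive \<open>F\<close> gives \<open>f\<close> mean zero, hence
    a zero. The estimate runs over the period starting there and is moved to \<open>0\<close> at the
    end.\<close>
  obtain z where z: "f z = 0"
  proof -
    obtain z where "F P - F 0 = (P - 0) * f z" using MVT2[OF P(1), of F f] F by blast
    then show ?thesis using that P(1) P(3)[of 0] by simp
  qed
  define W where "W t = V t - C * t" for t
  have W': "(W has_real_derivative \<bar>f t\<bar> powr p - C) (at t)" for t
    unfolding W_def[abs_def] by (auto intro!: derivative_eq_intros V)
  have "W (z + P) \<le> W z"
  proof (rule nonincreasing_across_gaps[OF W', where Z = "{t. f t = 0}"])
    show "closed {t. f t = 0}" using f by (intro closed_Collect_eq continuous_intros)
    show "z \<in> {t. f t = 0}" "z + P \<in> {t. f t = 0}" "z \<le> z + P" using z P by auto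
    show "\<bar>f t\<bar> powr p - C \<le> 0" if "t \<in> {t. f t = 0}" for t using that C by simp
    fix u v assume uv: "u \<in> {t. f t = 0}" "v \<in> {t. f t = 0}" "u < v"
      "\<And>t. u < t \<Longrightarrow> t < v \<Longrightarrow> t \<notin> {t. f t = 0}"
    have "(\<forall>t. u < t \<longrightarrow> t < v \<longrightarrow> 0 < f t) \<or> (\<forall>t. u < t \<longrightarrow> t < v \<longrightarrow> 0 < - f t)"
    proof (rule ccontr)
      assume "\<not> ?thesis"
      then obtain s t where st: "u < s" "s < v" "u < t" "t < v" "f s \<le> 0" "f t \<ge> 0" by force
      have "\<exists>y. min s t \<le> y \<and> y \<le> max s t \<and> f y = 0"
      proof (cases "s \<le> t")
        case True
        then show ?thesis using IVT'[of f s 0 t] st contf by (auto simp: min_def max_def)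
      next
        case False
        then show ?thesis using IVT2'[of f s 0 t] st contf by (auto simp: min_def max_def)
      qed
      then obtain y where "min s t \<le> y" "y \<le> max s t" "f y = 0" by blast
      moreover from this have "u < y" "y < v" using st by linarith+
      ultimately show False using uv(4)[of y] by simp
    qed
    then have "V v - V u \<le> (v - u) * C"
    proof
      assume "\<forall>t. u < t \<longrightarrow> t < v \<longrightarrow> 0 < f t"
      then show ?thesis unfolding C_def
        using uv by (intro hump_powr_le[OF p T q(1) q0 \<tau> contf A B V F F_le]) auto
    next
      assume neg: "\<forall>t. u < t \<longrightarrow> t < v \<longrightarrow> 0 < - f t"
      show ?thesis unfolding C_def
      proof (rule hump_powr_le[where f = "\<lambda>t. - f t" and \<tau> = "\<lambda>t. - \<tau> t" and \<tau>' = "\<lambda>t. - \<tau>' t"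
            and F = "\<lambda>t. - F t", OF p T q(1) q0 _ _ _ _ _ A B])
        show "((\<lambda>t. - \<tau> t) has_real_derivative - \<tau>' t) (at t)"
          "((\<lambda>t. - F t) has_real_derivative - f t) (at t)" for t
          by (auto intro!: derivative_eq_intros \<tau> F)
        show "continuous_on {u..v} (\<lambda>t. - f t)" by (intro continuous_intros contf)
        show "- F v - - F u \<le> 2 * (B (T / 2) - B 0)" using F_le[of u v] by simp
      qed (use uv neg V \<tau> q(2) in auto)
    qed
    then show "W v \<le> W u" by (simp add: W_def algebra_simps)
  qed
  moreover have "V (z + P) - V z = V (0 + P) - V 0"
  proof -
    have "((\<lambda>t. V (t + P) - V t) has_real_derivative 0) (at t)" for t
      using DERIV_diff[OF V[of "t + P", unfolded DERIV_shift] V[of t]] P(2) by simp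
    then show ?thesis using DERIV_isconst_all[of "\<lambda>t. V (t + P) - V t"] by blast
  qed
  ultimately show ?thesis unfolding C_def[symmetric] by (simp add: W_def algebra_simps)
qed

text \<open>Here \<open>\<tau>\<close> is the inverse of the rising branch of \<open>q\<close>
  applied to \<open>f\<close>, and \<open>cmp\<close> at equal heights is precisely the bound on its
  derivative.\<close>

lemma comparison_time_change:
  fixes q q' f f' :: "real \<Rightarrow> real"
  assumes T: "T > 0" and q: "\<And>s. (q has_real_derivative q' s) (at s)" "\<And>s. q (- s) = - q s"
    and q': "\<And>s. - (T / 2) < s \<Longrightarrow> s < T / 2 \<Longrightarrow> 0 < q' s"
    and f: "\<And>t. (f has_real_derivative f' t) (at t)" "\<And>t. \<bar>f t\<bar> < q (T / 2)"
    and cmp: "\<And>\<xi> \<eta>. - (T / 2) < \<eta> \<Longrightarrow> \<eta> < T / 2 \<Longrightarrow> f \<xi> = q \<eta> \<Longrightarrow> \<bar>f' \<xi>\<bar> \<le> q' \<eta>"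
  shows "\<exists>\<tau> \<tau>'. \<forall>t. (\<tau> has_real_derivative \<tau>' t) (at t) \<and> \<bar>\<tau>' t\<bar> \<le> 1 \<and>
    f t = q (\<tau> t) \<and> \<bar>\<tau> t\<bar> \<le> T / 2"
proof -
  \<comment> \<open>The open branch, because \<open>q'\<close> may vanish at its ends; the strict
    bound on \<open>f\<close> keeps \<open>\<tau>\<close> inside.\<close>
  define I where "I = {- (T / 2)<..<T / 2}"
  have contq: "continuous_on S q" for S
    using q(1) by (meson DERIV_isCont continuous_at_imp_continuous_on)
  have mono: "q s < q s'" if "s < s'" "s \<in> I" "s' \<in> I" for s s'
    using that q(1) q' by (intro DERIV_pos_imp_increasing[of s s' q]) (force simp: I_def)+
  have inj: "inj_on q I"
    by (rule inj_onI) (metis mono linorder_neqE_linordered_idom less_irrefl)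
  define \<tau> where "\<tau> t = the_inv_into I q (f t)" for t
  have ex: "\<exists>s\<in>I. q s = f t" for t
  proof -
    have "q (- (T / 2)) < f t" "f t < q (T / 2)" using f(2)[of t] q(2)[of "T / 2"] by auto
    moreover obtain s where "- (T / 2) \<le> s" "s \<le> T / 2" "q s = f t"
      using IVT'[of q "- (T / 2)" "f t" "T / 2"] calculation T contq by auto
    ultimately show ?thesis by (intro bexI[of _ s]) (auto simp: I_def less_le)
  qed
  then have \<tau>I: "\<tau> t \<in> I" and f_eq: "f t = q (\<tau> t)" for t
    unfolding \<tau>_def using the_inv_into_into[OF inj, of "f t" I] f_the_inv_into_f[OF inj, of "f t"]
    by (metis image_eqI order_refl)+
  have \<tau>_range: "- (T / 2) < \<tau> t" "\<tau> t < T / 2" for t using \<tau>I[of t] by (auto simp: I_def)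
  have \<tau>': "(\<tau> has_real_derivative f' t / q' (\<tau> t)) (at t)" for t
  proof -
    have pos: "q' (\<tau> t) > 0" using q' \<tau>_range by blast
    have "(the_inv_into I q has_derivative ((*) (1 / q' (\<tau> t)))) (at (q (\<tau> t)))"
    proof (rule has_derivative_inverse_strong[of I "\<tau> t" q])
      show "(q has_derivative (*) (q' (\<tau> t))) (at (\<tau> t))"
        using q(1)[of "\<tau> t"] by (simp add: has_field_derivative_def)
      show "the_inv_into I q (q s) = s" if "s \<in> I" for s using that by (rule the_inv_into_f_f[OF inj])
      show "(*) (q' (\<tau> t)) \<circ> ((*) (1 / q' (\<tau> t))) = id" using pos by auto
    qed (use \<tau>I contq in \<open>auto simp: I_def\<close>)
    then have "(the_inv_into I q has_real_derivative 1 / q' (\<tau> t)) (at (f t))"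
      using f_eq[of t] by (simp add: has_field_derivative_def)
    from DERIV_chain2[OF this f(1)] show ?thesis by (simp add: \<tau>_def[abs_def])
  qed
  have "\<bar>f' t / q' (\<tau> t)\<bar> \<le> 1" for t
    using cmp[OF \<tau>_range f_eq] q'[OF \<tau>_range, of t] by (simp add: abs_divide divide_le_eq)
  moreover have "\<bar>\<tau> t\<bar> \<le> T / 2" for t using \<tau>_range[of t] by auto
  ultimately show ?thesis
    using \<tau>' f_eq by (intro exI[of _ \<tau>] exI[of _ "\<lambda>t. f' t / q' (\<tau> t)"]) blast
qed

section \<open>The comparison theorem\<close>

text \<open>
  \<open>g m\<close> stands for the derivative of order \<open>r - m\<close> of the given function, rescaled so that it has to be
  compared with \<open>cpsi m\<close>; \<open>m0\<close> is the order at which sign changes are counted directly.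
\<close>

locale psi_comparison = psi_parameters +
  fixes r n m0 i0 :: nat and P :: real and g :: "nat \<Rightarrow> real \<Rightarrow> real"
  assumes g_deriv: "\<And>m s. 1 \<le> m \<Longrightarrow> m < r \<Longrightarrow> (g (Suc m) has_real_derivative g m s) (at s)"
    and g_per: "\<And>m s. 1 \<le> m \<Longrightarrow> m \<le> r \<Longrightarrow> g m (s + P) = g m s"
    and g_lip: "\<And>u v. \<bar>g 1 u - g 1 v\<bar> \<le> \<bar>u - v\<bar>"
    and g_top: "\<And>s. \<bar>g r s\<bar> \<le> cpsi r a1 a2 (T / 2)"
    and P: "P > 0" "real i0 * P = 2 * real n * T" and n: "n > 0"
    and base: "(m0 = 1 \<and> a1 = 0 \<and> (\<forall>s. \<bar>g 1 s\<bar> \<le> 1)) \<or>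
      (m0 = 2 \<and> (\<forall>s. \<bar>g 2 s\<bar> \<le> cpsi 2 a1 a2 (T / 2)) \<and> (a2 = 0 \<or> (\<forall>s. \<bar>g 1 s\<bar> \<le> 1)))"
    and m0_less: "m0 < r"
begin

lemma m0_ge_1: "1 \<le> m0"
  using base by auto

text \<open>The factor \<open>\<theta>\<close> turns the norm bounds into the strict ones required
  for the sign counts and for the time change. It is removed later by letting it tend to 1.\<close>

lemma scaled_less:
  assumes "\<bar>y\<bar> \<le> M" "0 < M" "\<bar>\<theta>\<bar> < (1::real)"
  shows "\<bar>\<theta> * y\<bar> < M"
proof (cases "y = 0")
  case False
  then have "\<bar>\<theta>\<bar> * \<bar>y\<bar> < 1 * \<bar>y\<bar>" using assms(3) by (intro mult_strict_right_mono) auto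
  then show ?thesis using assms(1) by (simp add: abs_mult)
qed (use assms in simp)

lemma scaled_lip:
  assumes "\<bar>\<theta>\<bar> < 1"
  shows "\<bar>\<theta> * g 1 u - \<theta> * g 1 v\<bar> \<le> \<bar>u - v\<bar>"
proof -
  have "\<bar>\<theta> * g 1 u - \<theta> * g 1 v\<bar> = \<bar>\<theta>\<bar> * \<bar>g 1 u - g 1 v\<bar>"
    by (simp add: abs_mult flip: right_diff_distrib)
  also have "\<dots> \<le> 1 * \<bar>u - v\<bar>" using assms g_lip[of u v] by (intro mult_mono) auto
  finally show ?thesis by simp
qed

text \<open>For \<open>a1 = 0\<close> the branch is the identity truncated to
  \<open>{- 1..1}\<close>. A function with Lipschitz constant 1 cannot overtake its rising part, and
  \<open>\<bar>\<theta> * g 1 t\<bar> < 1\<close> rules out the upper plateau.\<close>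

lemma branch_crossing_1:
  assumes a1: "a1 = 0" and g1: "\<And>s. \<bar>g 1 s\<bar> \<le> 1" and \<theta>: "\<bar>\<theta>\<bar> < 1"
  shows "branch_crossing T (cpsi 1 a1 a2) (\<lambda>t. \<theta> * g 1 t)"
  unfolding branch_crossing_def
proof (intro allI impI)
  fix c s s' :: real
  assume s: "- (T / 2) \<le> s" "s < s'" "s' \<le> T / 2" "0 < cpsi 1 a1 a2 s - \<theta> * g 1 (s + c)"
  have pos: "cpsi 1 a1 a2 v = min 1 v" if "0 \<le> v" "v \<le> T / 2" for v
  proof -
    have v: "\<bar>v - T / 2\<bar> \<le> T / 2" using that by linarith
    have "1 + a2 / 2 - \<bar>v - T / 2\<bar> = v" using that T_eq a1 by linarith
    then show ?thesis using cpsi_1_near_centre[OF v] that by simp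
  qed
  have q: "cpsi 1 a1 a2 v = max (- 1) (min 1 v)" if "- (T / 2) \<le> v" "v \<le> T / 2" for v
    using pos[of v] pos[of "- v"] cpsi_odd[of 1 v] that by (cases "0 \<le> v") auto
  have bd: "\<bar>\<theta> * g 1 t\<bar> < 1" for t using scaled_less[OF g1 _ \<theta>] by simp
  have "\<theta> * g 1 (s' + c) - \<theta> * g 1 (s + c) \<le> s' - s"
    using scaled_lip[OF \<theta>, of "s' + c" "s + c"] s(2) by linarith
  moreover have "cpsi 1 a1 a2 s = max (- 1) (min 1 s)" "cpsi 1 a1 a2 s' = max (- 1) (min 1 s')"
    using q s by auto
  ultimately show "0 \<le> cpsi 1 a1 a2 s' - \<theta> * g 1 (s' + c)"
    using s bd[of "s + c"] bd[of "s' + c"] by (auto simp: max_def min_def split: if_splits)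
qed

text \<open>A wrong crossing, together with the signs near the ends of the branch, gives
  \<open>D\<close> the signs minus, plus, minus, plus. Mean values then yield
  \<open>u < z < v\<close> where the derivative is positive, negative, positive, and no position of
  \<open>z\<close> on the trapezoid allows this.\<close>

lemma branch_crossing_2:
  assumes g2: "\<And>s. \<bar>g 2 s\<bar> \<le> cpsi 2 a1 a2 (T / 2)"
    and g1: "a2 = 0 \<or> (\<forall>s. \<bar>g 1 s\<bar> \<le> 1)" and \<theta>: "\<bar>\<theta>\<bar> < 1" and r: "1 < r"
  shows "branch_crossing T (cpsi 2 a1 a2) (\<lambda>t. \<theta> * g 2 t)"
  unfolding branch_crossing_def
proof (intro allI impI, rule ccontr)
  fix c s s' :: real
  assume s: "- (T / 2) \<le> s" "s < s'" "s' \<le> T / 2" "0 < cpsi 2 a1 a2 s - \<theta> * g 2 (s + c)"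
    and "\<not> 0 \<le> cpsi 2 a1 a2 s' - \<theta> * g 2 (s' + c)"
  then have s': "cpsi 2 a1 a2 s' - \<theta> * g 2 (s' + c) < 0" by simp
  \<comment> \<open>Half the width of the support of the trapezoid \<open>\<Theta>\<close>; beyond
    it \<open>cpsi 2\<close> stays at its extreme values on the branch.\<close>
  define w where "w = 1 + a2 / 2"
  define M where "M = cpsi 2 a1 a2 (T / 2)"
  define \<Theta> where "\<Theta> v = cpsi 1 a1 a2 (v + T / 2)" for v
  define D where "D v = cpsi 2 a1 a2 v - \<theta> * g 2 (v + c)" for v
  have w: "0 < w" "w \<le> T / 2" using nonneg T_eq by (auto simp: w_def)
  have \<Theta>: "\<Theta> v = max 0 (min 1 (w - \<bar>v\<bar>))" if "\<bar>v\<bar> \<le> T / 2" for v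
    using cpsi_1_near_centre[OF that] by (simp add: \<Theta>_def w_def)
  have q': "(cpsi 2 a1 a2 has_real_derivative \<Theta> v) (at v)" for v
    using cpsi_has_derivative[of 1 v] by (simp add: \<Theta>_def numeral_2_eq_2)
  have D': "(D has_real_derivative \<Theta> v - \<theta> * g 1 (v + c)) (at v)" for v
  proof -
    have "((\<lambda>v. g 2 (v + c)) has_real_derivative g 1 (v + c)) (at v)"
      using g_deriv[of 1 "v + c"] r by (simp add: DERIV_shift numeral_2_eq_2)
    then show ?thesis unfolding D_def[abs_def] by (intro DERIV_diff q' DERIV_cmult)
  qed
  have bd: "\<bar>\<theta> * g 2 t\<bar> < M" for t
    using scaled_less[OF g2 _ \<theta>] cpsi_centre_pos[of 2] by (simp add: M_def)
  have qw: "cpsi 2 a1 a2 w = M"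
  proof (cases "w = T / 2")
    case False
    then have "w < T / 2" using w by simp
    then obtain z where z: "w < z" "z < T / 2" "cpsi 2 a1 a2 (T / 2) - cpsi 2 a1 a2 w = (T / 2 - w) * \<Theta> z"
      using MVT2[of w "T / 2" "cpsi 2 a1 a2" \<Theta>] q' by blast
    then have "\<Theta> z = 0" using \<Theta>[of z] w by simp
    then show ?thesis using z by (simp add: M_def)
  next
    case True
    then show ?thesis unfolding M_def by (rule arg_cong)
  qed
  then have qmw: "cpsi 2 a1 a2 (- w) = - M" using cpsi_odd[of 2 w] by simp
  have Dw: "D (- w) < 0" "D w > 0"
    using bd[of "- w + c"] bd[of "w + c"] qw qmw by (auto simp: D_def)
  have sw: "- w < s"
  proof (rule ccontr)
    assume "\<not> - w < s"
    then have "cpsi 2 a1 a2 s \<le> - M" using cpsi_mono[of 2 s "- w"] s w qmw by simp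
    then show False using s(4) bd[of "s + c"] by linarith
  qed
  have s'w: "s' < w"
  proof (rule ccontr)
    assume "\<not> s' < w"
    then have "M \<le> cpsi 2 a1 a2 s'" using cpsi_mono[of 2 w s'] s w qw by simp
    then show False using s' bd[of "s' + c"] by linarith
  qed
  define d where "d v = \<Theta> v - \<theta> * g 1 (v + c)" for v
  obtain u where u: "- w < u" "u < s" "D s - D (- w) = (s - - w) * d u"
    using MVT2[OF sw, of D d] D' unfolding d_def by blast
  obtain z where z: "s < z" "z < s'" "D s' - D s = (s' - s) * d z"
    using MVT2[OF s(2), of D d] D' unfolding d_def by blast
  obtain v where v: "s' < v" "v < w" "D w - D s' = (w - s') * d v"
    using MVT2[OF s'w, of D d] D' unfolding d_def by blast
  have Ds: "D s > 0" "D s' < 0" using s(4) s' by (auto simp: D_def)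
  have "0 < (s - - w) * d u" using u(3) Ds Dw by linarith
  then have du: "d u > 0" using sw by (simp add: zero_less_mult_iff)
  have "(s' - s) * d z < 0" using z(3) Ds by linarith
  then have dz: "d z < 0" using s(2) by (simp add: mult_less_0_iff)
  have "0 < (w - s') * d v" using v(3) Ds Dw by linarith
  then have dv: "d v > 0" using s'w by (simp add: zero_less_mult_iff)
  have \<Theta>_in: "\<Theta> y = min 1 (w - \<bar>y\<bar>)" if "- w < y" "y < w" for y
    using \<Theta>[of y] that w by auto
  have order: "- w < u" "u < z" "z < v" "v < w" using u z v by auto
  \<comment> \<open>On the slopes \<open>\<Theta>\<close> changes at unit rate, at least as fast as
    \<open>\<theta> * g 1\<close>, so the negative sign at \<open>z\<close> contradicts the one at
    \<open>u\<close> or \<open>v\<close>. On the plateau the bound on \<open>g 1\<close> makes the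
    derivative positive; for \<open>a2 = 0\<close> that case is empty.\<close>
  consider "z \<le> - (a2 / 2)" | "z \<ge> a2 / 2" | "- (a2 / 2) < z" "z < a2 / 2" by linarith
  then show False
  proof cases
    case 1
    then have "\<Theta> z - \<Theta> u = z - u" using \<Theta>_in[of u] \<Theta>_in[of z] order nonneg by (auto simp: w_def)
    then have "d z \<ge> d u" using scaled_lip[OF \<theta>, of "z + c" "u + c"] order unfolding d_def by linarith
    then show False using du dz by simp
  next
    case 2
    then have "\<Theta> z - \<Theta> v = v - z" using \<Theta>_in[of v] \<Theta>_in[of z] order nonneg by (auto simp: w_def)
    then have "d z \<ge> d v" using scaled_lip[OF \<theta>, of "z + c" "v + c"] order unfolding d_def by linarith
    then show False using dv dz by simp
  next
    case 3
    then have "\<Theta> z = 1" using \<Theta>_in[of z] order by (auto simp: w_def)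
    moreover have "\<bar>\<theta> * g 1 (z + c)\<bar> < 1" using scaled_less[of "g 1 (z + c)" 1 \<theta>] g1 3 \<theta> by auto
    ultimately show False using dz by (simp add: d_def)
  qed
qed

lemma branch_crossing_m0:
  assumes "\<bar>\<theta>\<bar> < 1"
  shows "branch_crossing T (cpsi m0 a1 a2) (\<lambda>t. \<theta> * g m0 t)"
  using base
proof (elim disjE conjE)
  assume "m0 = 1" "a1 = 0" "\<forall>s. \<bar>g 1 s\<bar> \<le> 1"
  then show ?thesis using branch_crossing_1[OF _ _ assms] by blast
qed (use branch_crossing_2[OF _ _ assms] m0_less in auto)

lemma g_common_period:
  assumes "1 \<le> m" "m \<le> r"
  shows "g m (s + 2 * real n * T) = g m s"
proof -
  have "g m (s + real i * P) = g m s" for i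
  proof (induction i)
    case (Suc i)
    then show ?case using g_per[OF assms, of "s + real i * P"] by (simp add: algebra_simps)
  qed simp
  from this[of i0] show ?thesis by (simp add: P(2))
qed

text \<open>An alternation at order \<open>m + 1\<close> would pass to order \<open>m\<close> by
  Rolle, down to the single crossing at \<open>m0\<close>. Each descent flips the sign and moves the
  phase by \<open>T / 2\<close>, hence the induction for arbitrary \<open>\<sigma>\<close> and
  \<open>c\<close>.\<close>

lemma not_alternates_level:
  assumes "m0 \<le> m" "m \<le> r" "\<bar>\<theta>\<bar> < 1"
  shows "\<not> alternates \<sigma> (2 * n + 2) (2 * real n * T) (\<lambda>t. cpsi m a1 a2 (t + c) - \<theta> * g m t)"
  using assms
proof (induction m arbitrary: \<sigma> c rule: nat_induct_at_least)
  case base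
  have "branch_crossing T (cpsi m0 a1 a2) (\<lambda>t. - (\<theta> * g m0 t))"
    using branch_crossing_m0[of "- \<theta>"] base by simp
  moreover have "\<theta> * g m0 (t + 2 * real n * T) = \<theta> * g m0 t" for t
    using g_common_period[of m0 t] m0_ge_1 m0_less by simp
  ultimately show ?case
    using base by (intro not_alternates_if_branch_crossing T_pos branch_crossing_m0
        cpsi_antiperiodic m0_ge_1)
next
  case (Suc m)
  have m: "1 \<le> m" "m < r" using Suc m0_ge_1 by auto
  have q_per: "cpsi m a1 a2 (t + 2 * real n * T) = cpsi m a1 a2 t" for t
    using antiperiodic_int[of "cpsi m a1 a2" T t "2 * int n", OF cpsi_antiperiodic[OF m(1)]] by simp
  show ?case
  proof
    assume alt: "alternates \<sigma> (2 * n + 2) (2 * real n * T)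
        (\<lambda>t. cpsi (Suc m) a1 a2 (t + c) - \<theta> * g (Suc m) t)"
    have "((\<lambda>t. cpsi (Suc m) a1 a2 (t + c) - \<theta> * g (Suc m) t) has_real_derivative
        cpsi m a1 a2 (t + (c + T / 2)) - \<theta> * g m t) (at t)" for t
      using cpsi_has_derivative[OF m(1), of "t + c", unfolded DERIV_shift[symmetric]]
      by (intro DERIV_diff DERIV_cmult g_deriv m) (simp add: DERIV_shift add.assoc)
    then have "alternates (- \<sigma>) (2 * n + 2) (2 * real n * T)
        (\<lambda>t. cpsi m a1 a2 (t + (c + T / 2)) - \<theta> * g m t)"
    proof (rule alternates_deriv[OF _ _ _ _ alt])
      fix t
      have "cpsi m a1 a2 (t + 2 * real n * T + (c + T / 2)) = cpsi m a1 a2 (t + (c + T / 2))"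
        using q_per[of "t + (c + T / 2)"] by (simp add: algebra_simps)
      then show "cpsi m a1 a2 (t + 2 * real n * T + (c + T / 2)) - \<theta> * g m (t + 2 * real n * T) =
          cpsi m a1 a2 (t + (c + T / 2)) - \<theta> * g m t"
        using g_common_period[of m t] m by simp
    qed auto
    then show False using Suc m by simp
  qed
qed

text \<open>A violation of the upper bound would create the alternation just excluded at order
  \<open>m + 1\<close>; changing the signs of \<open>\<theta>\<close> and \<open>\<eta>\<close>
  gives the lower bound. Only order \<open>m + 1\<close> is counted, so \<open>m\<close> may be one
  below \<open>m0\<close>.\<close>

lemma comparison_step:
  assumes m: "1 \<le> m" "m0 \<le> Suc m" "m < r" and \<theta>: "\<bar>\<theta>\<bar> < 1"
    and bd: "\<And>s. \<bar>g (Suc m) s\<bar> \<le> cpsi (Suc m) a1 a2 (T / 2)"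
    and \<eta>: "- (T / 2) < \<eta>" "\<eta> < T / 2" "\<theta> * g (Suc m) \<xi> = cpsi (Suc m) a1 a2 \<eta>"
  shows "\<bar>\<theta> * g m \<xi>\<bar> \<le> cpsi m a1 a2 (\<eta> + T / 2)"
proof -
  have upper: "\<theta> * g m \<xi> \<le> cpsi m a1 a2 (\<eta> + T / 2)"
    if \<theta>: "\<bar>\<theta>\<bar> < 1" and \<eta>: "- (T / 2) < \<eta>" "\<eta> < T / 2" "\<theta> * g (Suc m) \<xi> = cpsi (Suc m) a1 a2 \<eta>"
    for \<theta> \<eta>
  proof (rule ccontr)
    assume "\<not> ?thesis"
    then have steep: "\<theta> * g m \<xi> > cpsi m a1 a2 (\<eta> + T / 2)" by simp
    have "\<bar>\<theta> * g (Suc m) t\<bar> < cpsi (Suc m) a1 a2 (T / 2)" for t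
      using scaled_less[OF bd _ \<theta>] cpsi_centre_pos[of "Suc m"] by simp
    then have "alternates (-1) (2 * n + 2) (2 * real n * T)
        (\<lambda>t. cpsi (Suc m) a1 a2 (t + (\<eta> - \<xi>)) - \<theta> * g (Suc m) t)"
    proof (intro alternates_if_steeper[where q' = "\<lambda>t. cpsi m a1 a2 (t + T / 2)"
          and f' = "\<lambda>t. \<theta> * g m t"] T_pos n \<eta> steep)
      show "cpsi (Suc m) a1 a2 (t + T) = - cpsi (Suc m) a1 a2 t"
        "cpsi (Suc m) a1 a2 (- t) = - cpsi (Suc m) a1 a2 t"
        "(cpsi (Suc m) a1 a2 has_real_derivative cpsi m a1 a2 (t + T / 2)) (at t)"
        "((\<lambda>t. \<theta> * g (Suc m) t) has_real_derivative \<theta> * g m t) (at t)" for t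
        using cpsi_antiperiodic[of "Suc m" t] cpsi_odd[of "Suc m" t] cpsi_has_derivative[OF m(1), of t]
          DERIV_cmult[OF g_deriv[OF m(1,3)], of \<theta> t] by auto
    qed
    then show False using not_alternates_level[of "Suc m" \<theta>] m \<theta> by simp
  qed
  have "- (\<theta> * g m \<xi>) \<le> cpsi m a1 a2 (- \<eta> + T / 2)"
    using upper[of "- \<theta>" "- \<eta>"] \<theta> \<eta> cpsi_odd[of "Suc m" \<eta>] by simp
  then show ?thesis
    using upper[OF \<theta> \<eta>] cpsi_even_centre[OF m(1), of \<eta>] by (simp add: abs_le_iff)
qed

text \<open>The bound descends from the top order \<open>r\<close>: the intermediate value theorem
  finds a point of the spline at the same height, the comparison there bounds the next derivative,
  and \<open>\<theta>\<close> tends to 1.\<close>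

lemma g_bound:
  assumes "1 \<le> m" "m0 \<le> Suc m" "m \<le> r"
  shows "\<bar>g m s\<bar> \<le> cpsi m a1 a2 (T / 2)"
  using assms(3,1,2)
proof (induction m arbitrary: s rule: inc_induct)
  case base
  show ?case by (rule g_top)
next
  case (step m)
  have IH: "\<bar>g (Suc m) s\<bar> \<le> cpsi (Suc m) a1 a2 (T / 2)" for s using step by simp
  have scaled: "\<theta> * \<bar>g m s\<bar> \<le> cpsi m a1 a2 (T / 2)" if \<theta>: "0 < \<theta>" "\<theta> < 1" for \<theta>
  proof -
    let ?q = "cpsi (Suc m) a1 a2"
    have "\<bar>\<theta> * g (Suc m) s\<bar> < ?q (T / 2)"
      using scaled_less[OF IH _, of \<theta>] cpsi_centre_pos[of "Suc m"] \<theta> by simp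
    then have less: "?q (- (T / 2)) < \<theta> * g (Suc m) s" "\<theta> * g (Suc m) s < ?q (T / 2)"
      using cpsi_odd[of "Suc m" "T / 2"] by auto
    obtain \<eta> where \<eta>: "- (T / 2) \<le> \<eta>" "\<eta> \<le> T / 2" "?q \<eta> = \<theta> * g (Suc m) s"
      using IVT'[of ?q "- (T / 2)" "\<theta> * g (Suc m) s" "T / 2"] less T_pos cpsi_continuous[of "Suc m"] by auto
    then have "- (T / 2) < \<eta>" "\<eta> < T / 2" using less by (auto simp: less_le)
    then have "\<bar>\<theta> * g m s\<bar> \<le> cpsi m a1 a2 (\<eta> + T / 2)"
      using comparison_step[of m \<theta> \<eta> s] step IH \<theta> \<eta>(3) by simp
    also have "\<dots> \<le> cpsi m a1 a2 (T / 2)" using cpsi_abs_le[of m "\<eta> + T / 2"] step by simp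
    finally show ?thesis using \<theta> by (simp add: abs_mult)
  qed
  show ?case
    by (rule field_le_mult_one_interval) (rule scaled)
qed

text \<open>The order below \<open>m\<close> furnishes the contraction \<open>\<tau>\<close>, the
  order above furnishes the primitive and the bound on its oscillation; hence \<open>m\<close> lies
  strictly between \<open>m0\<close> and \<open>r\<close>.\<close>

lemma scaled_period_powr_le:
  assumes p: "p \<ge> 1" and m: "m0 < m" "m < r" and \<theta>: "\<bar>\<theta>\<bar> < 1"
    and A: "\<And>s. (A has_real_derivative \<bar>cpsi m a1 a2 s\<bar> powr p) (at s)"
    and V: "\<And>t. (V has_real_derivative \<bar>\<theta> * g m t\<bar> powr p) (at t)"
  shows "V P - V 0 \<le> P * (2 / T * (A (T / 2) - A 0))"
proof -
  define l where "l = m - 1"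
  have l: "m = Suc l" "1 \<le> l" "l < r" "m0 \<le> Suc l" using m m0_ge_1 by (auto simp: l_def)
  let ?q = "cpsi m a1 a2" and ?f = "\<lambda>t. \<theta> * g m t"
  have q': "(?q has_real_derivative cpsi l a1 a2 (s + T / 2)) (at s)" for s
    unfolding l(1) by (rule cpsi_has_derivative[OF l(2)])
  \<comment> \<open>From \<open>m0 < m\<close> one gets \<open>l \<ge> m0\<close>, so order 1 occurs
    here only together with \<open>a1 = 0\<close>.\<close>
  have q'_pos: "0 < cpsi l a1 a2 (s + T / 2)" if "- (T / 2) < s" "s < T / 2" for s
    using that base m(1) by (intro cpsi_pos) (auto simp: l_def)
  have f': "(?f has_real_derivative \<theta> * g l t) (at t)" for t
    unfolding l(1) by (intro DERIV_cmult g_deriv l)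
  have bd: "\<bar>g j s\<bar> \<le> cpsi j a1 a2 (T / 2)" if "m \<le> j" "j \<le> r" for j s
    using that m m0_ge_1 by (intro g_bound) auto
  have f_less: "\<bar>?f t\<bar> < ?q (T / 2)" for t
    using scaled_less[OF bd _ \<theta>, of m t] cpsi_centre_pos[of m] m by simp
  have cmp: "\<bar>\<theta> * g l \<xi>\<bar> \<le> cpsi l a1 a2 (\<eta> + T / 2)"
    if "- (T / 2) < \<eta>" "\<eta> < T / 2" "\<theta> * g m \<xi> = ?q \<eta>" for \<xi> \<eta>
    using that comparison_step[OF l(2,4,3) \<theta> bd[of m, unfolded l(1)], of \<eta> \<xi>] m l(1) by simp
  have q_odd: "?q (- s) = - ?q s" for s by (rule cpsi_odd) (use l in simp)
  obtain \<tau> \<tau>' where \<tau>: "\<And>t. (\<tau> has_real_derivative \<tau>' t) (at t)" "\<And>t. \<bar>\<tau>' t\<bar> \<le> 1"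
    "\<And>t. ?f t = ?q (\<tau> t)" "\<And>t. \<bar>\<tau> t\<bar> \<le> T / 2"
    using comparison_time_change[of T ?q "\<lambda>s. cpsi l a1 a2 (s + T / 2)" ?f "\<lambda>t. \<theta> * g l t",
        OF T_pos q' q_odd q'_pos f' f_less cmp] by blast
  have mono: "strict_mono_on {- (T / 2)..T / 2} ?q"
  proof (rule strict_mono_onI)
    fix s s' assume s: "s \<in> {- (T / 2)..T / 2}" "s' \<in> {- (T / 2)..T / 2}" "s < s'"
    show "?q s < ?q s'"
    proof (rule DERIV_pos_imp_increasing_open[OF s(3)])
      show "\<exists>y. (?q has_real_derivative y) (at x) \<and> 0 < y" if "s < x" "x < s'" for x
        using q'[of x] q'_pos[of x] that s by (intro exI conjI) auto
      show "continuous_on {s..s'} ?q" using l by (intro cpsi_continuous) auto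
    qed
  qed
  \<comment> \<open>The shift undoes the one in the derivative rule. It makes the increment over a
    quarter period equal to the maximum of \<open>cpsi (Suc m)\<close>, so the allowed oscillation
    is twice the bound on \<open>g (Suc m)\<close>.\<close>
  define B where "B s = cpsi (Suc m) a1 a2 (s - T / 2)" for s
  have B': "(B has_real_derivative ?q s) (at s)" for s
  proof -
    have "(cpsi (Suc m) a1 a2 has_real_derivative ?q s) (at (s + - (T / 2)))"
      using cpsi_has_derivative[of m "s + - (T / 2)"] l by simp
    then have "((\<lambda>s. cpsi (Suc m) a1 a2 (s + - (T / 2))) has_real_derivative ?q s) (at s)"
      by (rule DERIV_shift[THEN iffD1])
    then show ?thesis by (simp add: B_def[abs_def])
  qed
  have B_diff: "B (T / 2) - B 0 = cpsi (Suc m) a1 a2 (T / 2)"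
    using cpsi_odd[of "Suc m" "T / 2"] cpsi_0[of "Suc m"] by (simp add: B_def)
  show ?thesis
  proof (rule period_powr_le[OF p T_pos mono q_odd \<tau> _ A B' V])
    show "continuous_on UNIV ?f" using f' by (meson DERIV_isCont continuous_at_imp_continuous_on)
    show "((\<lambda>t. \<theta> * g (Suc m) t) has_real_derivative ?f t) (at t)" for t
      using l m by (intro DERIV_cmult g_deriv) auto
    show "\<theta> * g (Suc m) v - \<theta> * g (Suc m) u \<le> 2 * (B (T / 2) - B 0)" for u v
    proof -
      have "\<bar>\<theta> * g (Suc m) t\<bar> < cpsi (Suc m) a1 a2 (T / 2)" for t
        using scaled_less[OF bd _ \<theta>, of "Suc m" t] cpsi_centre_pos[of "Suc m"] m by simp
      from this[of u] this[of v] show ?thesis unfolding B_diff by linarith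
    qed
    show "P > 0" by (rule P(1))
    show "?f (t + P) = ?f t" "\<theta> * g (Suc m) (t + P) = \<theta> * g (Suc m) t" for t
      using g_per[of m t] g_per[of "Suc m" t] l m by auto
  qed
qed

lemma period_integral_powr_le:
  assumes p: "p \<ge> 1" and m: "m0 < m" "m < r"
  shows "integral {0..P} (\<lambda>t. \<bar>g m t\<bar> powr p) \<le>
    P * (2 / T * integral {0..T / 2} (\<lambda>s. \<bar>cpsi m a1 a2 s\<bar> powr p))"
proof -
  define l where "l = m - 1"
  have l: "m = Suc l" "1 \<le> l" "l < r" using m m0_ge_1 by (auto simp: l_def)
  have "continuous_on UNIV (g m)"
    unfolding l(1) using g_deriv[OF l(2,3)] by (meson DERIV_isCont continuous_at_imp_continuous_on)
  then have cg: "continuous_on UNIV (\<lambda>t. \<bar>g m t\<bar> powr p)"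
    using p by (intro continuous_on_powr' continuous_intros) auto
  have cq: "continuous_on UNIV (\<lambda>s. \<bar>cpsi m a1 a2 s\<bar> powr p)"
    using p l by (intro continuous_on_powr' continuous_intros cpsi_continuous) auto
  obtain V where V: "\<And>t. (V has_real_derivative \<bar>g m t\<bar> powr p) (at t)"
    by (rule antiderivative_exists[OF cg]) (erule that)
  obtain A where A: "\<And>s. (A has_real_derivative \<bar>cpsi m a1 a2 s\<bar> powr p) (at s)"
    by (rule antiderivative_exists[OF cq]) (erule that)
  have scaled: "\<theta> powr p * (V P - V 0) \<le> P * (2 / T * (A (T / 2) - A 0))" if \<theta>: "0 < \<theta>" "\<theta> < 1" for \<theta>
  proof -
    have "((\<lambda>t. \<theta> powr p * V t) has_real_derivative \<bar>\<theta> * g m t\<bar> powr p) (at t)" for t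
      using DERIV_cmult[OF V, of "\<theta> powr p" t] \<theta> by (simp add: abs_mult powr_mult)
    from scaled_period_powr_le[OF p m _ A this] \<theta> show ?thesis by (simp add: right_diff_distrib)
  qed
  have "V P - V 0 \<le> P * (2 / T * (A (T / 2) - A 0))"
  proof (rule field_le_mult_one_interval)
    fix z :: real assume z: "0 < z" "z < 1"
    \<comment> \<open>The choice \<open>\<theta> = z powr (1 / p)\<close> turns the factor
      \<open>\<theta> powr p\<close> into \<open>z\<close>, which may then tend to 1.\<close>
    have "z powr (1 / p) < 1" using z p powr_less_mono2[of "1 / p" z 1] by simp
    moreover have "(z powr (1 / p)) powr p = z" using z p by (simp add: powr_powr)
    ultimately show "z * (V P - V 0) \<le> P * (2 / T * (A (T / 2) - A 0))"
      using scaled[of "z powr (1 / p)"] z by simp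
  qed
  then show ?thesis
    using integral_eq_antiderivative_diff[OF V, of 0 P] integral_eq_antiderivative_diff[OF A, of 0 "T / 2"]
      P T_pos by simp
qed

end

section \<open>Norms of the derivatives\<close>

text \<open>Off the countable set \<open>C\<close>, \<open>deriv h\<close> is the limit of
  difference quotients with step \<open>1 / (i + 1)\<close>. This provides the measurability without
  which the essential supremum would be \<open>top\<close>.\<close>

lemma Linf_norm_deriv_le:
  fixes h :: "real \<Rightarrow> real"
  assumes h: "continuous_on UNIV h" and C: "countable C"
    and D: "\<And>t. t \<notin> C \<Longrightarrow> \<exists>D. (h has_real_derivative D) (at t) \<and> \<bar>D\<bar> \<le> K"
  shows "Linf_norm (deriv h) \<le> ennreal K"
proof (rule Linf_norm_le_AE)
  define L where "L t = lim (\<lambda>i. (h (t + inverse (real (Suc i))) - h t) / inverse (real (Suc i)))" for t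
  have "h \<in> borel_measurable borel" using h by (rule borel_measurable_continuous_onI)
  then have "L \<in> borel_measurable borel" unfolding L_def[abs_def] by measurable
  then have "L \<in> borel_measurable lebesgue" by (simp add: measurable_completion)
  then show "deriv h \<in> borel_measurable lebesgue"
  proof (rule measurable_discrete_difference[OF _ C])
    fix t :: real assume "t \<notin> C"
    then obtain D where "(h has_real_derivative D) (at t)" using D by blast
    then have D': "(h has_real_derivative deriv h t) (at t)" by (simp add: DERIV_imp_deriv)
    have "filterlim (\<lambda>i. inverse (real (Suc i))) (at 0) sequentially"
      using LIMSEQ_inverse_real_of_nat by (simp only: filterlim_at) simp
    with D' have "(\<lambda>i. (h (t + inverse (real (Suc i))) - h t) / inverse (real (Suc i))) \<longlonglongrightarrow> deriv h t"
      unfolding DERIV_def by (rule filterlim_compose)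
    then show "L t = deriv h t" unfolding L_def by (rule limI)
  qed auto
  have "AE t in lebesgue. t \<notin> C"
    using C by (intro AE_not_in) (auto intro: countable_imp_null_set_lborel null_sets_completionI)
  then show "AE t in lebesgue. \<bar>deriv h t\<bar> \<le> K"
    by (rule eventually_mono) (use D DERIV_imp_deriv in metis)
qed

lemma Lp_norm_continuous:
  assumes "continuous_on UNIV f" "p > 0"
  shows "Lp_norm p 0 1 f = integral {0..1} (\<lambda>t. \<bar>f t\<bar> powr p) powr (1 / p)"
proof -
  have "continuous_on UNIV (\<lambda>t. \<bar>f t\<bar> powr p)"
    using assms by (intro continuous_on_powr' continuous_intros) auto
  then have "(\<lambda>t. \<bar>f t\<bar> powr p) absolutely_integrable_on {0..1}"
    by (intro absolutely_integrable_continuous_real) (auto intro: continuous_on_subset)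
  then have "(\<lambda>t. \<bar>f t\<bar> powr p) absolutely_integrable_on {0<..<1}"
    by (rule set_integrable_subset) auto
  then have "(LINT t:{0<..<1}|lebesgue. \<bar>f t\<bar> powr p) = integral {0<..<1} (\<lambda>t. \<bar>f t\<bar> powr p)"
    by (rule set_lebesgue_integral_eq_integral)
  then show ?thesis by (simp add: Lp_norm_def integral_open_interval_real)
qed

lemma Lr_inf_has_derivative:
  assumes "x \<in> Lr_inf r" "Suc k < r"
  shows "((deriv ^^ k) x has_real_derivative (deriv ^^ Suc k) x t) (at t)"
  using assms by (simp add: Lr_inf_def DERIV_deriv_iff_field_differentiable)

text \<open>The norm of order \<open>r\<close> controls the derivative only almost everywhere; local
  absolute continuity turns this into a genuine Lipschitz bound.\<close>

lemma Lr_inf_lipschitz: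
  assumes x: "x \<in> Lr_inf r" and r: "r \<ge> 1" and K: "K \<ge> 0" "Linf_norm ((deriv ^^ r) x) \<le> ennreal K"
  shows "\<bar>(deriv ^^ (r - 1)) x u - (deriv ^^ (r - 1)) x v\<bar> \<le> K * \<bar>u - v\<bar>"
proof -
  let ?f = "(deriv ^^ (r - 1)) x"
  have r': "(deriv ^^ r) x = deriv ?f" using r by (cases r) auto
  have "AE t in lebesgue. ennreal \<bar>deriv ?f t\<bar> \<le> ennreal K"
    using esssup_AE[of "\<lambda>t. ennreal \<bar>deriv ?f t\<bar>" lebesgue] K(2) unfolding Linf_norm_def r'
    by (auto elim!: eventually_mono)
  moreover have "AE t in lebesgue. ?f field_differentiable at t" using x by (simp add: Lr_inf_def)
  ultimately have ae: "AE t in lebesgue. \<exists>D. (?f has_real_derivative D) (at t) \<and> \<bar>D\<bar> \<le> K"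
    by eventually_elim
      (use K(1) in \<open>auto simp: ennreal_le_iff simp flip: DERIV_deriv_iff_field_differentiable\<close>)
  have "\<bar>?f v - ?f u\<bar> \<le> K * (v - u)" if "u \<le> v" for u v
    using x that K(1) ae by (intro abs_cont_on_lipschitz) (auto simp: Lr_inf_def locally_abs_cont_def)
  from this[of u v] this[of v u] show ?thesis by (cases "u \<le> v") (auto simp: abs_minus_commute)
qed

lemma lipschitz_continuous_on:
  fixes f :: "real \<Rightarrow> real"
  assumes "\<And>u v. \<bar>f u - f v\<bar> \<le> K * \<bar>u - v\<bar>"
  shows "continuous_on S f"
proof -
  have "K \<ge> 0" using order_trans[OF abs_ge_zero assms[of 1 0]] by simp
  then have "K-lipschitz_on S f" using assms by (intro lipschitz_onI) (auto simp: dist_real_def)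
  then show ?thesis by (rule lipschitz_on_continuous_on)
qed

lemma Lr_inf_continuous:
  assumes x: "x \<in> Lr_inf r" and k: "k < r" and K: "K \<ge> 0" "Linf_norm ((deriv ^^ r) x) \<le> ennreal K"
  shows "continuous_on S ((deriv ^^ k) x)"
proof (cases "Suc k < r")
  case True
  then show ?thesis
    using Lr_inf_has_derivative[OF x] by (meson DERIV_isCont continuous_at_imp_continuous_on)
next
  case False
  then have "k = r - 1" "r \<ge> 1" using k by simp_all
  then show ?thesis using lipschitz_continuous_on[OF Lr_inf_lipschitz[OF x _ K]] by blast
qed

text \<open>\<open>deriv\<close> chooses a value depending only on the predicate of being a
  derivative, and this predicate is the same at \<open>t\<close> and \<open>t + c\<close>. So
  periodicity passes on even where no derivative exists.\<close>

lemma deriv_shift_periodic: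
  fixes x :: "real \<Rightarrow> real"
  assumes "\<And>t. x (t + c) = x t"
  shows "(deriv ^^ k) x (t + c) = (deriv ^^ k) x t"
proof (induction k arbitrary: t)
  case (Suc k)
  have "(\<lambda>D. ((deriv ^^ k) x has_real_derivative D) (at (t + c))) =
      (\<lambda>D. ((deriv ^^ k) x has_real_derivative D) (at t))"
    using Suc by (auto simp: DERIV_shift)
  then show ?case unfolding funpow.simps comp_apply deriv_def[of "(deriv ^^ k) x"] by (rule arg_cong)
qed (simp add: assms)

section \<open>Norms of the derivatives of \<open>Psi\<close>\<close>

context psi_parameters
begin

lemma psi_eq_cpsi: "psi m a1 a2 t = cpsi m a1 a2 (t - (a1 / 2 + (real m - 1) * (T / 2)))"
  by (simp add: cpsi_def T_def)

lemma Psi_eq: "Psi r a1 a2 b lam = (\<lambda>t. b * (lam / (2 * T)) ^ r * psi r a1 a2 (2 * T / lam * t))"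
  by (rule ext) (simp add: Psi_def T_eq algebra_simps)

lemma deriv_Psi:
  assumes lam: "lam > 0" and k: "k < r"
  shows "(deriv ^^ k) (Psi r a1 a2 b lam) =
    (\<lambda>t. b * (lam / (2 * T)) ^ (r - k) * psi (r - k) a1 a2 (2 * T / lam * t))"
  using k
proof (induction k)
  case 0
  then show ?case by (simp add: Psi_eq)
next
  case (Suc k)
  define m where "m = r - Suc k"
  have m: "r - k = Suc m" "m \<ge> 1" using Suc.prems by (auto simp: m_def)
  have "((\<lambda>t. b * (lam / (2 * T)) ^ Suc m * psi (Suc m) a1 a2 (2 * T / lam * t)) has_real_derivative
      b * (lam / (2 * T)) ^ Suc m * (psi m a1 a2 (2 * T / lam * t) * (2 * T / lam))) (at t)" for t
    by (intro DERIV_cmult DERIV_chain2[OF psi_has_derivative[OF m(2)]])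
      (use lam in \<open>auto intro!: derivative_eq_intros\<close>)
  then have "deriv (\<lambda>t. b * (lam / (2 * T)) ^ Suc m * psi (Suc m) a1 a2 (2 * T / lam * t)) t =
      b * (lam / (2 * T)) ^ Suc m * (psi m a1 a2 (2 * T / lam * t) * (2 * T / lam))" for t
    by (rule DERIV_imp_deriv)
  moreover have "b * (lam / (2 * T)) ^ Suc m * (y * (2 * T / lam)) = b * (lam / (2 * T)) ^ m * y" for y
    using lam T_pos by (simp add: field_simps)
  ultimately show ?case using Suc m by (simp add: m_def[symmetric])
qed

lemma psi_abs_le: "m \<ge> 1 \<Longrightarrow> \<bar>psi m a1 a2 t\<bar> \<le> cpsi m a1 a2 (T / 2)"
  unfolding psi_eq_cpsi by (rule cpsi_abs_le)

text \<open>The norms of \<open>Psi\<close> stand on the larger side of the hypotheses of the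
  theorem, so an upper bound for them passes to the derivatives of \<open>x\<close>.\<close>

lemma Linf_norm_deriv_Psi_le:
  assumes lam: "lam > 0" and k: "k < r"
  shows "Linf_norm ((deriv ^^ k) (Psi r a1 a2 b lam))
    \<le> ennreal (\<bar>b\<bar> * (lam / (2 * T)) ^ (r - k) * cpsi (r - k) a1 a2 (T / 2))"
proof (rule Linf_norm_le_AE)
  have m: "r - k \<ge> 1" using k by simp
  have "continuous_on UNIV (\<lambda>t. b * (lam / (2 * T)) ^ (r - k) * psi (r - k) a1 a2 (2 * T / lam * t))"
    by (intro continuous_intros continuous_on_compose2[OF psi_continuous[OF m]]) auto
  then show "(deriv ^^ k) (Psi r a1 a2 b lam) \<in> borel_measurable lebesgue"
    unfolding deriv_Psi[OF assms]
    by (intro measurable_completion) (simp add: borel_measurable_continuous_onI)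
  have "\<bar>(deriv ^^ k) (Psi r a1 a2 b lam) t\<bar>
      \<le> \<bar>b\<bar> * (lam / (2 * T)) ^ (r - k) * cpsi (r - k) a1 a2 (T / 2)" for t
    unfolding deriv_Psi[OF assms] abs_mult
    using lam T_pos psi_abs_le[OF m] by (intro mult_mono) auto
  then show "AE t in lebesgue. \<bar>(deriv ^^ k) (Psi r a1 a2 b lam) t\<bar>
      \<le> \<bar>b\<bar> * (lam / (2 * T)) ^ (r - k) * cpsi (r - k) a1 a2 (T / 2)" by simp
qed

lemma trapezoid_derivative:
  fixes s :: real
  assumes "\<bar>s\<bar> \<noteq> a2 / 2" "\<bar>s\<bar> \<noteq> 1 + a2 / 2"
  shows "\<exists>D. ((\<lambda>s. max 0 (min 1 (1 + a2 / 2 - \<bar>s\<bar>))) has_real_derivative D) (at s) \<and> \<bar>D\<bar> \<le> 1"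
proof -
  let ?h = "\<lambda>s. max 0 (min 1 (1 + a2 / 2 - \<bar>s\<bar>))" and ?w = "1 + a2 / 2"
  have local: "\<exists>D. (?h has_real_derivative D) (at s) \<and> \<bar>D\<bar> \<le> 1"
    if "open S" "s \<in> S" "\<And>u. u \<in> S \<Longrightarrow> l u = ?h u" "(l has_real_derivative D) (at s)" "\<bar>D\<bar> \<le> 1"
    for S l D
    using has_field_derivative_transform_within_open[OF that(4,1,2,3)] that(5) by blast
  consider "s > ?w" | "s < - ?w" | "\<bar>s\<bar> < a2 / 2" | "a2 / 2 < s" "s < ?w" | "- ?w < s" "s < - (a2 / 2)"
    using assms by linarith
  then show ?thesis
  proof cases
    case 1
    then show ?thesis using nonneg by (intro local[of "{?w<..}" "\<lambda>_. 0" 0]) auto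
  next
    case 2
    then show ?thesis using nonneg by (intro local[of "{..<- ?w}" "\<lambda>_. 0" 0]) auto
  next
    case 3
    then show ?thesis by (intro local[of "{- (a2 / 2)<..<a2 / 2}" "\<lambda>_. 1" 0]) auto
  next
    case 4
    then show ?thesis using nonneg
      by (intro local[of "{a2 / 2<..<?w}" "\<lambda>u. ?w - u" "-1"]) (auto intro!: derivative_eq_intros)
  next
    case 5
    then show ?thesis using nonneg
      by (intro local[of "{- ?w<..<- (a2 / 2)}" "\<lambda>u. ?w + u" 1]) (auto intro!: derivative_eq_intros)
  qed
qed

lemma psi1_derivative_off_kinks:
  obtains C where "countable C"
    "\<And>t. t \<notin> C \<Longrightarrow> \<exists>D. (psi1 a1 a2 has_real_derivative D) (at t) \<and> \<bar>D\<bar> \<le> 1"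
proof
  define z where "z j = a1 / 2 + T / 2 + of_int j * T" for j
  \<comment> \<open>For every window this collects the four kinks of the trapezoid and the two
    window ends, so that any other point is interior to its window and to an affine piece.\<close>
  define C where "C = (\<Union>j. (\<lambda>e. z j + e) ` {- (T / 2), T / 2, a2 / 2, - (a2 / 2), 1 + a2 / 2, - (1 + a2 / 2)})"
  show "countable C" unfolding C_def by (intro countable_UN) auto
  fix t assume t: "t \<notin> C"
  define j where "j = \<lfloor>(t - a1 / 2) / T\<rfloor>"
  define s where "s = t - z j"
  have tC: "s \<noteq> e" if "e \<in> {- (T / 2), T / 2, a2 / 2, - (a2 / 2), 1 + a2 / 2, - (1 + a2 / 2)}" for e
  proof
    assume "s = e"
    then have "t = z j + e" by (simp add: s_def)
    then show False using t that unfolding C_def by blast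
  qed
  have "of_int j \<le> (t - a1 / 2) / T" "(t - a1 / 2) / T < of_int j + 1" by (auto simp: j_def)
  then have "of_int j * T \<le> t - a1 / 2" "t - a1 / 2 < (of_int j + 1) * T"
    using T_pos by (auto simp: field_simps)
  then have "- (T / 2) \<le> s" "s < T / 2" by (auto simp: s_def z_def algebra_simps)
  then have s: "\<bar>s\<bar> < T / 2" using tC[of "- (T / 2)"] by auto
  define \<sigma> :: real where "\<sigma> = (if even j then 1 else -1)"
  let ?h = "\<lambda>s. max 0 (min 1 (1 + a2 / 2 - \<bar>s\<bar>))"
  have "s \<noteq> a2 / 2" "s \<noteq> - (a2 / 2)" "s \<noteq> 1 + a2 / 2" "s \<noteq> - (1 + a2 / 2)" by (rule tC; simp)+
  then have "\<bar>s\<bar> \<noteq> a2 / 2" "\<bar>s\<bar> \<noteq> 1 + a2 / 2" unfolding abs_eq_iff' by blast+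
  then obtain D where D: "(?h has_real_derivative D) (at s)" "\<bar>D\<bar> \<le> 1"
    using trapezoid_derivative by blast
  have "((\<lambda>u. \<sigma> * ?h (u + - z j)) has_real_derivative \<sigma> * D) (at t)"
    using D(1) by (intro DERIV_cmult DERIV_shift[THEN iffD1]) (simp add: s_def)
  moreover have "\<sigma> * ?h (u + - z j) = psi1 a1 a2 u" if "u \<in> {z j - T / 2<..<z j + T / 2}" for u
  proof -
    have "z j - T / 2 < u" "u < z j + T / 2" using that by simp_all
    then have u: "\<bar>u - z j\<bar> \<le> T / 2" by linarith
    have "psi1 a1 a2 u = psi1 a1 a2 ((a1 / 2 + T / 2 + (u - z j)) + of_int j * T)"
      by (simp add: z_def)
    also have "\<dots> = \<sigma> * psi1 a1 a2 (a1 / 2 + T / 2 + (u - z j))"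
      by (subst antiperiodic_int[of "psi1 a1 a2" T, OF psi1_antiperiodic]) (simp add: \<sigma>_def)
    finally show ?thesis using psi1_near_centre[OF u] by simp
  qed
  moreover have "t \<in> {z j - T / 2<..<z j + T / 2}"
  proof -
    have "z j - T / 2 < t" "t < z j + T / 2" using s unfolding s_def by linarith+
    then show ?thesis by simp
  qed
  ultimately have "(psi1 a1 a2 has_real_derivative \<sigma> * D) (at t)"
    using has_field_derivative_transform_within_open open_greaterThanLessThan by blast
  then show "\<exists>D. (psi1 a1 a2 has_real_derivative D) (at t) \<and> \<bar>D\<bar> \<le> 1"
    using D(2) by (intro exI[of _ "\<sigma> * D"]) (auto simp: abs_mult \<sigma>_def)
qed

lemma Linf_norm_top_deriv_Psi_le:
  assumes lam: "lam > 0" and r: "r \<ge> 1"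
  shows "Linf_norm ((deriv ^^ r) (Psi r a1 a2 b lam)) \<le> ennreal \<bar>b\<bar>"
proof -
  obtain C where C: "countable C"
    "\<And>t. t \<notin> C \<Longrightarrow> \<exists>D. (psi1 a1 a2 has_real_derivative D) (at t) \<and> \<bar>D\<bar> \<le> 1"
    using psi1_derivative_off_kinks by blast
  let ?h = "\<lambda>t. b * (lam / (2 * T)) * psi1 a1 a2 (2 * T / lam * t)"
  have eq: "(deriv ^^ r) (Psi r a1 a2 b lam) = deriv ?h"
    using deriv_Psi[OF lam, of "r - 1" r b] r by (cases r) auto
  show ?thesis unfolding eq
  proof (rule Linf_norm_deriv_le)
    have psi1: "continuous_on UNIV (psi1 a1 a2)" using psi_continuous[of 1] by simp
    show "continuous_on UNIV ?h"
      by (intro continuous_intros continuous_on_compose2[OF psi1]) auto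
    show "countable ((\<lambda>t. lam / (2 * T) * t) ` C)" using C(1) by simp
    fix t assume t: "t \<notin> (\<lambda>t. lam / (2 * T) * t) ` C"
    have "2 * T / lam * t \<notin> C"
    proof
      assume "2 * T / lam * t \<in> C"
      then have "lam / (2 * T) * (2 * T / lam * t) \<in> (\<lambda>t. lam / (2 * T) * t) ` C" by (rule imageI)
      then show False using t lam T_pos by simp
    qed
    then obtain D where D: "(psi1 a1 a2 has_real_derivative D) (at (2 * T / lam * t))" "\<bar>D\<bar> \<le> 1"
      using C(2) by blast
    have "(?h has_real_derivative b * (lam / (2 * T)) * (D * (2 * T / lam))) (at t)"
    proof -
      have "((\<lambda>t. 2 * T / lam * t) has_real_derivative 2 * T / lam) (at t)"
        using DERIV_cmult[OF DERIV_ident, of "2 * T / lam" t] by simp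
      from DERIV_cmult[OF DERIV_chain2[of "psi1 a1 a2" _ "\<lambda>t. 2 * T / lam * t", OF D(1) this]]
      show ?thesis .
    qed
    moreover have "b * (lam / (2 * T)) * (D * (2 * T / lam)) = b * D"
      using lam T_pos by simp
    ultimately show "\<exists>D. (?h has_real_derivative D) (at t) \<and> \<bar>D\<bar> \<le> \<bar>b\<bar>"
      using D(2) by (intro exI[of _ "b * D"]) (simp add: abs_mult mult_left_le)
  qed
qed

text \<open>The interval \<open>{0..1}\<close> is one full period, which consists of four congruent
  quarter periods of \<open>\<bar>cpsi\<bar>\<close>. The norm thus becomes a scale factor times a
  mean over a quarter period, the form in which the estimate for \<open>x\<close> arrives.\<close>

lemma Lp_norm_deriv_Psi:
  assumes p: "p \<ge> 1" and k: "k < r"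
  shows "lam ^ (r - k) * Lp_norm p 0 1 ((deriv ^^ k) (Psi r a1 a2 b 1)) =
    lam ^ (r - k) * (\<bar>b\<bar> * (1 / (2 * T)) ^ (r - k) *
      (2 / T * integral {0..T / 2} (\<lambda>s. \<bar>cpsi (r - k) a1 a2 s\<bar> powr p)) powr (1 / p))"
proof -
  define m where "m = r - k"
  have m: "m \<ge> 1" using k by (simp add: m_def)
  define z where "z = a1 / 2 + (real m - 1) * (T / 2)"
  define c where "c = \<bar>b\<bar> * (1 / (2 * T)) ^ m"
  let ?u = "\<lambda>s. \<bar>cpsi m a1 a2 s\<bar> powr p"
  have c: "c \<ge> 0" using T_pos by (simp add: c_def)
  have f: "(deriv ^^ k) (Psi r a1 a2 b 1) = (\<lambda>t. b * (1 / (2 * T)) ^ m * cpsi m a1 a2 (2 * T * t - z))"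
    unfolding deriv_Psi[OF zero_less_one k] m_def[symmetric] psi_eq_cpsi z_def by simp
  have cu: "continuous_on UNIV ?u"
    using p by (intro continuous_on_powr' continuous_intros cpsi_continuous m) auto
  obtain A where A: "\<And>s. (A has_real_derivative ?u s) (at s)"
    by (rule antiderivative_exists[OF cu]) (erule that)
  have shift: "A (s + T) - A s = A (T / 2) - A (- (T / 2))" for s
  proof -
    have "((\<lambda>s. A (s + T) - A s) has_real_derivative 0) (at s)" for s
      using DERIV_diff[OF A[of "s + T", unfolded DERIV_shift] A[of s]] cpsi_antiperiodic[OF m, of s] by simp
    then have "A (s + T) - A s = A (- (T / 2) + T) - A (- (T / 2))"
      using DERIV_isconst_all[of "\<lambda>s. A (s + T) - A s"] by blast
    then show ?thesis by simp
  qed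
  have refl: "A (T / 2) + A (- (T / 2)) = 2 * A 0"
  proof -
    have "((\<lambda>s. A s + A (- s)) has_real_derivative 0) (at s)" for s
    proof -
      have "((\<lambda>s. A (- s)) has_real_derivative ?u (- s) * - 1) (at s)"
        by (rule DERIV_chain2[OF A]) (auto intro!: derivative_eq_intros)
      from DERIV_add[OF A this] show ?thesis using cpsi_odd[OF m, of s] by simp
    qed
    then have "A (T / 2) + A (- (T / 2)) = A 0 + A (- 0)"
      using DERIV_isconst_all[of "\<lambda>s. A s + A (- s)"] by blast
    then show ?thesis by simp
  qed
  have "((\<lambda>t. c powr p * (A (2 * T * t - z) / (2 * T))) has_real_derivative
      \<bar>(deriv ^^ k) (Psi r a1 a2 b 1) t\<bar> powr p) (at t)" for t
  proof -
    have "((\<lambda>t. A (2 * T * t - z)) has_real_derivative ?u (2 * T * t - z) * (2 * T)) (at t)"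
      by (rule DERIV_chain2[OF A]) (auto intro!: derivative_eq_intros)
    from DERIV_cmult[OF DERIV_cdivide[OF this, of "2 * T"], of "c powr p"]
    have "((\<lambda>t. c powr p * (A (2 * T * t - z) / (2 * T))) has_real_derivative
        c powr p * ?u (2 * T * t - z)) (at t)" using T_pos by simp
    moreover have "\<bar>(deriv ^^ k) (Psi r a1 a2 b 1) t\<bar> = c * \<bar>cpsi m a1 a2 (2 * T * t - z)\<bar>"
      unfolding f using T_pos by (simp add: c_def abs_mult)
    ultimately show ?thesis using c by (simp add: powr_mult)
  qed
  then have "integral {0..1} (\<lambda>t. \<bar>(deriv ^^ k) (Psi r a1 a2 b 1) t\<bar> powr p) =
      c powr p * (A (2 * T * 1 - z) / (2 * T)) - c powr p * (A (2 * T * 0 - z) / (2 * T))"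
    by (intro integral_eq_antiderivative_diff) auto
  also have "\<dots> = c powr p * ((A (2 * T - z) - A (- z)) / (2 * T))"
    by (simp add: diff_divide_distrib right_diff_distrib)
  \<comment> \<open>Two half-periods by \<open>shift\<close>, each split into two equal quarters by
    \<open>refl\<close>.\<close>
  also have "A (2 * T - z) - A (- z) = 4 * (A (T / 2) - A 0)"
    using shift[of "- z"] shift[of "T - z"] refl by (simp add: algebra_simps)
  also have "4 * (A (T / 2) - A 0) = 4 * integral {0..T / 2} ?u"
    using integral_eq_antiderivative_diff[OF A, of 0 "T / 2"] T_pos by simp
  also have "4 * integral {0..T / 2} ?u / (2 * T) = 2 / T * integral {0..T / 2} ?u" by simp
  finally have int: "integral {0..1} (\<lambda>t. \<bar>(deriv ^^ k) (Psi r a1 a2 b 1) t\<bar> powr p) =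
      c powr p * (2 / T * integral {0..T / 2} ?u)" .
  have "continuous_on UNIV ((deriv ^^ k) (Psi r a1 a2 b 1))"
    unfolding f by (intro continuous_intros continuous_on_compose2[OF cpsi_continuous[OF m, of UNIV]]) auto
  then have "Lp_norm p 0 1 ((deriv ^^ k) (Psi r a1 a2 b 1)) =
      (c powr p * (2 / T * integral {0..T / 2} ?u)) powr (1 / p)"
    using p int by (simp add: Lp_norm_continuous)
  also have "\<dots> = (c powr p) powr (1 / p) * (2 / T * integral {0..T / 2} ?u) powr (1 / p)"
    by (rule powr_mult)
  also have "(c powr p) powr (1 / p) = c" using c p by (simp add: powr_powr)
  finally show ?thesis by (simp add: c_def m_def)
qed

end

section \<open>The inequality for the \<open>L_p\<close> norms\<close>

context psi_parameters
begin

lemma rescaled_abs_le: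
  fixes \<kappa> \<mu> :: real
  assumes "\<bar>y\<bar> \<le> \<bar>b\<bar> * \<kappa> ^ j * M" "b \<noteq> 0" "0 \<le> \<kappa>" "\<kappa> \<le> \<mu>" "0 < \<mu>" "0 \<le> M"
  shows "\<bar>y / (\<bar>b\<bar> * \<mu> ^ j)\<bar> \<le> M"
proof -
  have "\<bar>b\<bar> * \<kappa> ^ j * M \<le> \<bar>b\<bar> * \<mu> ^ j * M"
    using assms by (intro mult_right_mono mult_left_mono power_mono) auto
  then have "\<bar>y\<bar> \<le> M * (\<bar>b\<bar> * \<mu> ^ j)" using assms(1) by (simp add: mult_ac)
  then show ?thesis using assms by (simp add: abs_divide abs_mult pos_divide_le_eq)
qed

text \<open>A rational scale \<open>i / n\<close> replaces \<open>lam\<close>: after rescaling,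
  \<open>i\<close> periods of \<open>x\<close> fill exactly \<open>n\<close> periods of the spline.
  Since it is at least \<open>lam\<close>, the assumed bounds remain true.\<close>

lemma rational_scale_integral_le:
  assumes x: "x \<in> Lr_inf r" and per: "\<And>t. x (t + 1) = x t" and b: "b \<noteq> 0"
    and lip: "\<And>u v. \<bar>(deriv ^^ (r - 1)) x u - (deriv ^^ (r - 1)) x v\<bar> \<le> \<bar>b\<bar> * \<bar>u - v\<bar>"
    and lam: "lam > 0"
    and bd0: "\<And>t. \<bar>x t\<bar> \<le> \<bar>b\<bar> * (lam / (2 * T)) ^ r * cpsi r a1 a2 (T / 2)"
    and bd: "(m0 = 1 \<and> a1 = 0 \<and> (\<forall>t. \<bar>(deriv ^^ (r - 1)) x t\<bar> \<le> \<bar>b\<bar> * (lam / (2 * T)) ^ 1 * 1)) \<or>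
      (m0 = 2 \<and> (\<forall>t. \<bar>(deriv ^^ (r - 2)) x t\<bar> \<le> \<bar>b\<bar> * (lam / (2 * T)) ^ 2 * cpsi 2 a1 a2 (T / 2)) \<and>
        (a2 = 0 \<or> (\<forall>t. \<bar>(deriv ^^ (r - 1)) x t\<bar> \<le> \<bar>b\<bar> * (lam / (2 * T)) ^ 1 * 1)))"
    and m: "m0 < m" "m < r" and p: "p \<ge> 1"
    and i: "i > 0" and n: "n > 0" and l: "lam \<le> real i / real n"
  shows "integral {0..1} (\<lambda>t. \<bar>(deriv ^^ (r - m)) x t\<bar> powr p) \<le>
    (\<bar>b\<bar> * (real i / real n / (2 * T)) ^ m) powr p *
      (2 / T * integral {0..T / 2} (\<lambda>s. \<bar>cpsi m a1 a2 s\<bar> powr p))"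
proof -
  define \<mu> where "\<mu> = real i / real n / (2 * T)"
  \<comment> \<open>The power of \<open>\<mu>\<close> absorbs the chain rule, so that
    differentiation lowers the index without a factor; dividing by \<open>\<bar>b\<bar>\<close>
    makes the Lipschitz constant of \<open>g 1\<close> equal to 1.\<close>
  define g where "g j s = (deriv ^^ (r - j)) x (\<mu> * s) / (\<bar>b\<bar> * \<mu> ^ j)" for j s
  have \<mu>: "\<mu> > 0" using i n T_pos by (simp add: \<mu>_def)
  have \<kappa>: "0 \<le> lam / (2 * T)" "lam / (2 * T) \<le> \<mu>"
    using lam T_pos divide_right_mono[OF l, of "2 * T"] by (simp_all add: \<mu>_def)
  have scale: "((\<lambda>s. \<mu> * s) has_real_derivative \<mu>) (at s)" for s
    using DERIV_cmult[OF DERIV_ident, of \<mu> s] by simp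
  note g_le = rescaled_abs_le[OF _ b \<kappa> \<mu>]
  interpret psi_comparison a1 a2 T r n m0 i "1 / \<mu>" g
  proof
    fix j s assume j: "1 \<le> j" "j < r"
    have "Suc (r - Suc j) = r - j" "Suc (r - Suc j) < r" using j by auto
    then have "((deriv ^^ (r - Suc j)) x has_real_derivative (deriv ^^ (r - j)) x t) (at t)" for t
      using Lr_inf_has_derivative[OF x, of "r - Suc j" t] by metis
    from DERIV_cdivide[OF DERIV_chain2[OF this scale], of "\<bar>b\<bar> * \<mu> ^ Suc j"]
    show "(g (Suc j) has_real_derivative g j s) (at s)"
      using \<mu> b by (simp add: g_def[abs_def])
  next
    fix j s
    have "(deriv ^^ (r - j)) x (\<mu> * (s + 1 / \<mu>)) = (deriv ^^ (r - j)) x (\<mu> * s)"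
      using deriv_shift_periodic[of x 1 "r - j" "\<mu> * s", OF per] \<mu> by (simp add: algebra_simps)
    then show "g j (s + 1 / \<mu>) = g j s" by (simp add: g_def)
  next
    fix u v
    have "\<bar>g 1 u - g 1 v\<bar> = \<bar>(deriv ^^ (r - 1)) x (\<mu> * u) - (deriv ^^ (r - 1)) x (\<mu> * v)\<bar> / (\<bar>b\<bar> * \<mu>)"
      using \<mu> by (simp add: g_def abs_divide abs_mult flip: diff_divide_distrib)
    also have "\<dots> \<le> \<bar>b\<bar> * \<bar>\<mu> * u - \<mu> * v\<bar> / (\<bar>b\<bar> * \<mu>)"
      using lip[of "\<mu> * u" "\<mu> * v"] \<mu> by (intro divide_right_mono) auto
    also have "\<dots> = \<bar>u - v\<bar>"
      using \<mu> b by (simp add: abs_mult flip: right_diff_distrib)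
    finally show "\<bar>g 1 u - g 1 v\<bar> \<le> \<bar>u - v\<bar>" .
  next
    show "\<bar>g r s\<bar> \<le> cpsi r a1 a2 (T / 2)" for s
      using g_le[OF bd0, of "\<mu> * s"] cpsi_centre_pos[of r] m by (simp add: g_def)
    show "0 < 1 / \<mu>" using \<mu> by simp
    show "real i * (1 / \<mu>) = 2 * real n * T" using i n T_pos by (simp add: \<mu>_def)
    show "0 < n" by (rule n)
    show "m0 < r" using m by simp
    have g1: "\<bar>g 1 s\<bar> \<le> 1" if "\<forall>t. \<bar>(deriv ^^ (r - 1)) x t\<bar> \<le> \<bar>b\<bar> * (lam / (2 * T)) ^ 1 * 1" for s
      unfolding g_def by (rule g_le) (use that in auto)
    have g2: "\<bar>g 2 s\<bar> \<le> cpsi 2 a1 a2 (T / 2)"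
      if "\<forall>t. \<bar>(deriv ^^ (r - 2)) x t\<bar> \<le> \<bar>b\<bar> * (lam / (2 * T)) ^ 2 * cpsi 2 a1 a2 (T / 2)" for s
      unfolding g_def by (rule g_le) (use that cpsi_centre_pos[of 2] in auto)
    show "m0 = 1 \<and> a1 = 0 \<and> (\<forall>s. \<bar>g 1 s\<bar> \<le> 1) \<or>
      m0 = 2 \<and> (\<forall>s. \<bar>g 2 s\<bar> \<le> cpsi 2 a1 a2 (T / 2)) \<and> (a2 = 0 \<or> (\<forall>s. \<bar>g 1 s\<bar> \<le> 1))"
      using bd g1 g2 by blast
  qed
  define c where "c = (\<bar>b\<bar> * \<mu> ^ m) powr p"
  have c: "c > 0" using b \<mu> by (simp add: c_def)
  let ?y = "\<lambda>t. \<bar>(deriv ^^ (r - m)) x t\<bar> powr p"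
  have "continuous_on UNIV ((deriv ^^ (r - m)) x)"
  proof -
    have "Suc (r - m) < r" using m m0_ge_1 by auto
    from Lr_inf_has_derivative[OF x this] show ?thesis
      by (meson DERIV_isCont continuous_at_imp_continuous_on)
  qed
  then have "continuous_on UNIV ?y" using p by (intro continuous_on_powr' continuous_intros) auto
  then obtain V where V: "\<And>t. (V has_real_derivative ?y t) (at t)"
    by (rule antiderivative_exists) (erule that)
  have "((\<lambda>s. V (\<mu> * s) / (c * \<mu>)) has_real_derivative \<bar>g m s\<bar> powr p) (at s)" for s
  proof -
    have "\<bar>g m s\<bar> powr p = ?y (\<mu> * s) / c"
      using b \<mu> unfolding g_def c_def by (simp add: abs_mult powr_divide)
    moreover have "((\<lambda>s. V (\<mu> * s) / (c * \<mu>)) has_real_derivative ?y (\<mu> * s) * \<mu> / (c * \<mu>)) (at s)"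
      by (rule DERIV_cdivide[OF DERIV_chain2[OF V scale]])
    ultimately show ?thesis using \<mu> by simp
  qed
  then have "integral {0..1 / \<mu>} (\<lambda>s. \<bar>g m s\<bar> powr p) = V (\<mu> * (1 / \<mu>)) / (c * \<mu>) - V (\<mu> * 0) / (c * \<mu>)"
    using \<mu> by (intro integral_eq_antiderivative_diff) auto
  also have "\<dots> = (V 1 - V 0) / (c * \<mu>)" using \<mu> by (simp add: diff_divide_distrib)
  also have "V 1 - V 0 = integral {0..1} ?y"
    using integral_eq_antiderivative_diff[OF V, of 0 1] by simp
  finally have "integral {0..1} ?y / (c * \<mu>) \<le>
      1 / \<mu> * (2 / T * integral {0..T / 2} (\<lambda>s. \<bar>cpsi m a1 a2 s\<bar> powr p))"
    using period_integral_powr_le[OF p m] by simp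
  then have "integral {0..1} ?y \<le>
      1 / \<mu> * (2 / T * integral {0..T / 2} (\<lambda>s. \<bar>cpsi m a1 a2 s\<bar> powr p)) * (c * \<mu>)"
    using c \<mu> by (subst (asm) pos_divide_le_eq) auto
  also have "\<dots> = c * (2 / T * integral {0..T / 2} (\<lambda>s. \<bar>cpsi m a1 a2 s\<bar> powr p))"
    using \<mu> by simp
  finally show ?thesis by (simp add: c_def \<mu>_def)
qed

text \<open>The right-hand side is continuous in the scale, so a failure at \<open>lam\<close> would
  persist at a slightly larger rational scale, where the inequality is known.\<close>

lemma scale_integral_le:
  assumes x: "x \<in> Lr_inf r" and per: "\<And>t. x (t + 1) = x t" and b: "b \<noteq> 0"
    and lip: "\<And>u v. \<bar>(deriv ^^ (r - 1)) x u - (deriv ^^ (r - 1)) x v\<bar> \<le> \<bar>b\<bar> * \<bar>u - v\<bar>"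
    and lam: "lam > 0"
    and bd0: "\<And>t. \<bar>x t\<bar> \<le> \<bar>b\<bar> * (lam / (2 * T)) ^ r * cpsi r a1 a2 (T / 2)"
    and bd: "(m0 = 1 \<and> a1 = 0 \<and> (\<forall>t. \<bar>(deriv ^^ (r - 1)) x t\<bar> \<le> \<bar>b\<bar> * (lam / (2 * T)) ^ 1 * 1)) \<or>
      (m0 = 2 \<and> (\<forall>t. \<bar>(deriv ^^ (r - 2)) x t\<bar> \<le> \<bar>b\<bar> * (lam / (2 * T)) ^ 2 * cpsi 2 a1 a2 (T / 2)) \<and>
        (a2 = 0 \<or> (\<forall>t. \<bar>(deriv ^^ (r - 1)) x t\<bar> \<le> \<bar>b\<bar> * (lam / (2 * T)) ^ 1 * 1)))"
    and m: "m0 < m" "m < r" and p: "p \<ge> 1"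
  shows "integral {0..1} (\<lambda>t. \<bar>(deriv ^^ (r - m)) x t\<bar> powr p) \<le>
    (\<bar>b\<bar> * (lam / (2 * T)) ^ m) powr p *
      (2 / T * integral {0..T / 2} (\<lambda>s. \<bar>cpsi m a1 a2 s\<bar> powr p))"
    (is "?I \<le> (\<bar>b\<bar> * (lam / (2 * T)) ^ m) powr p * ?J")
proof (rule ccontr)
  let ?\<phi> = "\<lambda>l. (\<bar>b\<bar> * (l / (2 * T)) ^ m) powr p * ?J"
  assume "\<not> ?thesis"
  then have less: "?\<phi> lam < ?I" by simp
  have "isCont ?\<phi> lam"
    using b lam T_pos by (intro continuous_intros) auto
  then have "eventually (\<lambda>l. ?\<phi> l < ?I) (at lam)"
    using less unfolding isCont_def by (rule order_tendstoD(2))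
  then obtain d where d: "d > 0" "\<And>l. l \<noteq> lam \<Longrightarrow> dist l lam < d \<Longrightarrow> ?\<phi> l < ?I"
    unfolding eventually_at by auto
  obtain l where l: "l \<in> \<rat>" "lam < l" "l < lam + d"
    using Rats_dense_in_real[of lam "lam + d"] d(1) by auto
  then obtain j n where jn: "l = real_of_int j / real n" "n \<noteq> 0"
    unfolding Rats_eq_int_div_nat by blast
  have "0 < real_of_int j / real n" using jn(1) l(2) lam by linarith
  then have "j > 0" using jn(2) by (simp add: zero_less_divide_iff)
  then have l_eq: "l = real (nat j) / real n" using jn by simp
  have "?I \<le> ?\<phi> l" unfolding l_eq
    using \<open>j > 0\<close> jn(2) l(2) l_eq
    by (intro rational_scale_integral_le[OF x per b lip lam bd0 bd m p]) auto
  moreover have "?\<phi> l < ?I" using l by (intro d(2)) (auto simp: dist_real_def)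
  ultimately show False by simp
qed

text \<open>The derivatives below order \<open>r\<close> are continuous, so essential bounds hold
  pointwise; for order \<open>r - 1\<close> the continuity rests on the bound of order
  \<open>r\<close>.\<close>

lemma deriv_abs_le:
  assumes x: "x \<in> Lr_inf r" and lam: "lam > 0" and k: "k < r"
    and top: "Linf_norm ((deriv ^^ r) x) \<le> Linf_norm ((deriv ^^ r) (Psi r a1 a2 b lam))"
    and le: "Linf_norm ((deriv ^^ k) x) \<le> Linf_norm ((deriv ^^ k) (Psi r a1 a2 b lam))"
  shows "\<bar>(deriv ^^ k) x t\<bar> \<le> \<bar>b\<bar> * (lam / (2 * T)) ^ (r - k) * cpsi (r - k) a1 a2 (T / 2)"
proof (rule Linf_norm_le_pointwise[of "(deriv ^^ k) x"])
  show "Linf_norm ((deriv ^^ k) x) \<le> ennreal (\<bar>b\<bar> * (lam / (2 * T)) ^ (r - k) * cpsi (r - k) a1 a2 (T / 2))"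
    using le Linf_norm_deriv_Psi_le[OF lam k] by (rule order_trans)
  have "r \<ge> 1" using k by simp
  from order_trans[OF top Linf_norm_top_deriv_Psi_le[OF lam this]]
  have "Linf_norm ((deriv ^^ r) x) \<le> ennreal \<bar>b\<bar>" .
  then show "continuous_on UNIV ((deriv ^^ k) x)" by (intro Lr_inf_continuous[OF x k]) auto
  show "0 \<le> \<bar>b\<bar> * (lam / (2 * T)) ^ (r - k) * cpsi (r - k) a1 a2 (T / 2)"
  proof -
    have "0 < cpsi (r - k) a1 a2 (T / 2)" by (rule cpsi_centre_pos) (use k in simp)
    then show ?thesis using lam T_pos by (intro mult_nonneg_nonneg) auto
  qed
qed

text \<open>The starting order \<open>m0\<close> encodes the condition, 1 for a) and 2 for b) or c),
  so \<open>k + m0 < r\<close> expresses both ranges of \<open>k\<close>.\<close>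

lemma deriv_Lp_norm_le:
  assumes x: "x \<in> Lr_inf r" and per: "\<And>t. x (t + 1) = x t" and b: "b \<noteq> 0" and lam: "lam > 0"
    and norms: "(m0 = 1 \<and> a1 = 0 \<and> deriv_norms_le {0, r - 1, r} x (Psi r a1 a2 b lam)) \<or>
      (m0 = 2 \<and> a2 = 0 \<and> deriv_norms_le {0, r - 2, r} x (Psi r a1 a2 b lam)) \<or>
      (m0 = 2 \<and> deriv_norms_le {0, r - 2, r - 1, r} x (Psi r a1 a2 b lam))"
    and k: "k \<ge> 1" "k + m0 < r" and p: "p \<ge> 1"
  shows "Lp_norm p 0 1 ((deriv ^^ k) x) \<le> lam ^ (r - k) * Lp_norm p 0 1 ((deriv ^^ k) (Psi r a1 a2 b 1))"
proof -
  define m where "m = r - k"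
  have m0: "m0 \<in> {1, 2}" using norms by auto
  have m: "m0 < m" "m < r" "r - m = k" "k < r" using k by (auto simp: m_def)
  have r: "r - (r - 1) = 1" "r - (r - 2) = 2" if "m0 = 2" using k that by auto
  have r1: "r - (r - 1) = 1" "1 \<le> r" "r - 1 < r" using k by auto
  let ?\<Psi> = "Psi r a1 a2 b lam"
  have n0: "Linf_norm x \<le> Linf_norm ?\<Psi>" and nr: "Linf_norm ((deriv ^^ r) x) \<le> Linf_norm ((deriv ^^ r) ?\<Psi>)"
    using norms by (auto simp: deriv_norms_le_def)
  have top: "Linf_norm ((deriv ^^ r) x) \<le> ennreal \<bar>b\<bar>"
    using nr Linf_norm_top_deriv_Psi_le[OF lam r1(2)] by (rule order_trans)
  have bd0: "\<bar>x t\<bar> \<le> \<bar>b\<bar> * (lam / (2 * T)) ^ r * cpsi r a1 a2 (T / 2)" for t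
    using deriv_abs_le[OF x lam _ nr, of 0 t] n0 r1 by simp
  have bd1: "\<forall>t. \<bar>(deriv ^^ (r - 1)) x t\<bar> \<le> \<bar>b\<bar> * (lam / (2 * T)) ^ 1 * 1"
    if "Linf_norm ((deriv ^^ (r - 1)) x) \<le> Linf_norm ((deriv ^^ (r - 1)) ?\<Psi>)"
    using deriv_abs_le[OF x lam r1(3) nr that] unfolding r1(1) cpsi_1_centre by blast
  have bd2: "\<forall>t. \<bar>(deriv ^^ (r - 2)) x t\<bar> \<le> \<bar>b\<bar> * (lam / (2 * T)) ^ 2 * cpsi 2 a1 a2 (T / 2)"
    if "m0 = 2" "Linf_norm ((deriv ^^ (r - 2)) x) \<le> Linf_norm ((deriv ^^ (r - 2)) ?\<Psi>)"
  proof -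
    have "r - 2 < r" using k that by simp
    from deriv_abs_le[OF x lam this nr that(2)] show ?thesis unfolding r(2)[OF that(1)] by blast
  qed
  have bd: "(m0 = 1 \<and> a1 = 0 \<and> (\<forall>t. \<bar>(deriv ^^ (r - 1)) x t\<bar> \<le> \<bar>b\<bar> * (lam / (2 * T)) ^ 1 * 1)) \<or>
      (m0 = 2 \<and> (\<forall>t. \<bar>(deriv ^^ (r - 2)) x t\<bar> \<le> \<bar>b\<bar> * (lam / (2 * T)) ^ 2 * cpsi 2 a1 a2 (T / 2)) \<and>
        (a2 = 0 \<or> (\<forall>t. \<bar>(deriv ^^ (r - 1)) x t\<bar> \<le> \<bar>b\<bar> * (lam / (2 * T)) ^ 1 * 1)))"
    using norms bd1 bd2 unfolding deriv_norms_le_def by blast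
  have lip: "\<bar>(deriv ^^ (r - 1)) x u - (deriv ^^ (r - 1)) x v\<bar> \<le> \<bar>b\<bar> * \<bar>u - v\<bar>" for u v
    by (rule Lr_inf_lipschitz[OF x r1(2) _ top]) simp
  let ?I = "integral {0..1} (\<lambda>t. \<bar>(deriv ^^ k) x t\<bar> powr p)"
  let ?J = "2 / T * integral {0..T / 2} (\<lambda>s. \<bar>cpsi m a1 a2 s\<bar> powr p)"
  have I: "?I \<le> (\<bar>b\<bar> * (lam / (2 * T)) ^ m) powr p * ?J"
    using scale_integral_le[OF x per b lip lam bd0 bd m(1,2) p] unfolding m(3) .
  have cont: "continuous_on UNIV ((deriv ^^ k) x)" by (rule Lr_inf_continuous[OF x m(4) _ top]) simp
  have "Lp_norm p 0 1 ((deriv ^^ k) x) = ?I powr (1 / p)"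
    using cont p by (intro Lp_norm_continuous) auto
  also have "\<dots> \<le> ((\<bar>b\<bar> * (lam / (2 * T)) ^ m) powr p * ?J) powr (1 / p)"
  proof (intro powr_mono2)
    have "continuous_on {0..1} (\<lambda>t. \<bar>(deriv ^^ k) x t\<bar> powr p)"
      using cont p by (intro continuous_on_powr' continuous_intros) (auto intro: continuous_on_subset)
    then show "0 \<le> ?I" by (intro integral_nonneg integrable_continuous_real) auto
  qed (use p I in auto)
  also have "\<dots> = ((\<bar>b\<bar> * (lam / (2 * T)) ^ m) powr p) powr (1 / p) * ?J powr (1 / p)"
    by (rule powr_mult)
  also have "((\<bar>b\<bar> * (lam / (2 * T)) ^ m) powr p) powr (1 / p) = \<bar>b\<bar> * (lam / (2 * T)) ^ m"
    using p lam T_pos by (simp add: powr_powr)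
  also have "\<bar>b\<bar> * (lam / (2 * T)) ^ m * ?J powr (1 / p) =
      lam ^ m * (\<bar>b\<bar> * (1 / (2 * T)) ^ m * ?J powr (1 / p))"
    by (simp add: power_divide)
  also have "\<dots> = lam ^ (r - k) * Lp_norm p 0 1 ((deriv ^^ k) (Psi r a1 a2 b 1))"
    by (simp only: Lp_norm_deriv_Psi[OF p m(4)] m_def)
  finally show ?thesis .
qed

end

theorem theorem4:
  fixes r :: nat and x :: "real \<Rightarrow> real" and a1 a2 lam b :: real
  assumes r: "r \<ge> 1"
    and x: "x \<in> Lr_inf_inf r"
    and periodic: "\<And>t. x (t + 1) = x t"
    and params: "a1 \<ge> 0" "a2 \<ge> 0" "lam > 0" "b \<noteq> 0"
    and conditions:
      "(a1 = 0 \<and> deriv_norms_le {0, r - 1, r} x (Psi r a1 a2 b lam)) \<or>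
       (a2 = 0 \<and> r \<ge> 2 \<and> deriv_norms_le {0, r - 2, r} x (Psi r a1 a2 b lam)) \<or>
       (r \<ge> 2 \<and> deriv_norms_le {0, r - 2, r - 1, r} x (Psi r a1 a2 b lam))"
  shows "\<forall>p::real. p \<ge> 1 \<longrightarrow> (\<forall>k::nat. k \<ge> 1 \<longrightarrow>
      (k + 2 < r \<or>
       (a1 = 0 \<and> deriv_norms_le {0, r - 1, r} x (Psi r a1 a2 b lam) \<and> k + 1 < r)) \<longrightarrow>
      Lp_norm p 0 1 ((deriv ^^ k) x)
        \<le> lam ^ (r - k) * Lp_norm p 0 1 ((deriv ^^ k) (Psi r a1 a2 b 1)))"
proof (intro allI impI)
  fix p :: real and k :: nat
  assume p: "p \<ge> 1" and k: "k \<ge> 1"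
    and case_k: "k + 2 < r \<or> (a1 = 0 \<and> deriv_norms_le {0, r - 1, r} x (Psi r a1 a2 b lam) \<and> k + 1 < r)"
  interpret psi_parameters a1 a2 "half_period a1 a2"
    using params by unfold_locales auto
  have x': "x \<in> Lr_inf r" using x by (simp add: Lr_inf_inf_def)
  \<comment> \<open>Condition a) takes precedence when several hold: it admits the larger range of
    \<open>k\<close>, which includes all \<open>k\<close> with \<open>k + 2 < r\<close>.\<close>
  define m0 :: nat where
    "m0 = (if a1 = 0 \<and> deriv_norms_le {0, r - 1, r} x (Psi r a1 a2 b lam) then 1 else 2)"
  show "Lp_norm p 0 1 ((deriv ^^ k) x) \<le> lam ^ (r - k) * Lp_norm p 0 1 ((deriv ^^ k) (Psi r a1 a2 b 1))"
  proof (rule deriv_Lp_norm_le[where x = x and r = r and b = b and lam = lam,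
        OF x' periodic params(4,3) _ k _ p])
    show "(m0 = 1 \<and> a1 = 0 \<and> deriv_norms_le {0, r - 1, r} x (Psi r a1 a2 b lam)) \<or>
      (m0 = 2 \<and> a2 = 0 \<and> deriv_norms_le {0, r - 2, r} x (Psi r a1 a2 b lam)) \<or>
      (m0 = 2 \<and> deriv_norms_le {0, r - 2, r - 1, r} x (Psi r a1 a2 b lam))"
      using conditions unfolding m0_def by auto
    show "k + m0 < r" using case_k unfolding m0_def by auto
  qed
qed

end
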